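(* Suppose that Assumptions (A), (B), (C), (D) hold. If $T_n\cap\,]x-h,x+h[\,\neq\emptyset$ and $nh\ge1$, then for any $x\in\,]0,1[$, $$\mathbb E(\hat g_n^{pro}(x))-g(x)=\frac12h^2g''(x)B+o(h^2)+O\Big(\frac{N_{T_n}}{h^3}\sup_{0\le j\le n}d_{j,n}^3+N_{T_n}\alpha_{n,h}+n\beta_{n,h}\Big),$$ where $B=\int_{-1}^1t^2K(t)\,dt$, $$\alpha_{n,h}=\sup_{0\le i\le n}\ \sup_{t_{i,n}\le s,t\le t_{i+1,n}}d_{i,n}|\alpha(s)\varphi_{x,h}(s)-\alpha(t)\varphi_{x,h}(t)|,\qquad \beta_{n,h}=\sup_{0\le t\le1}\frac{1}{\alpha(t)}\|R^{(0,2)}(\cdot,t)\|\frac{\sqrt C}{\sqrt h}\sup_{0\le j\le n}d_{j,n}^2 .$$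
   Context: Model: $Y_j(t_i)=g(t_i)+\varepsilon_j(t_i)$, $1\le i\le n$, $1\le j\le m$, with $g\in C^2([0,1])$ and $\varepsilon_1,\dots,\varepsilon_m$ i.i.d. copies of a centered second-order process $\varepsilon$ on $[0,1]$ with known continuous autocovariance $R$ such that $(R(s,t))_{s,t\in T}$ is non-singular for every finite $T\subset[0,1]$. $\overline Y(t_i)=\frac1m\sum_jY_j(t_i)$. $K$ is a kernel of class $C^1$ with support $[-1,1]$, $\int_{-1}^1K=1$, $\int_{-1}^1tK(t)dt=0$, $\int_{-1}^1t^2K(t)dt<\infty$; $\varphi_{x,h}(s)=\frac1hK(\frac{x-s}h)$, $h=h(n)\in(0,1)$. Projection estimator: $f_{x,h}(t)=\int_0^1R(s,t)\varphi_{x,h}(s)ds$, $(m_{x,h}(t_1),\dots,m_{x,h}(t_n))=(f_{x,h}(t_1),\dots,f_{x,h}(t_n))R_{|T_n}^{-1}$ with $R_{|T_n}=(R(t_i,t_j))_{i,j}$, and $\hat g_n^{pro}(x)=\sum_{i=1}^nm_{x,h}(t_i)\overline Y(t_i)$. Designs: $T_n=(t_{i,n})_{1\le i\le n}$, $0\le t_{1,n}<\dots<t_{n,n}\le1$; $t_{0,n}=0$, $t_{n+1,n}=1$, $d_{j,n}=t_{j+1,n}-t_{j,n}$; $N_{T_n}=\mathrm{Card}\{i\in\{1,\dots,n\}:[t_{i-1,n},t_{i+1,n}]\cap\,]x-h,x+h[\,\ne\emptyset\}$. Notation: $R^{(k,l)}$ is the partial derivative of order $k$ in the first and $l$ in the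 second variable; $R^{(0,1)}(t,t^-)=\lim_{s\uparrow t}\partial R(t,s)/\partial s$, $R^{(0,1)}(t,t^+)=\lim_{s\downarrow t}\partial R(t,s)/\partial s$, similarly for order 2. $\alpha(t)=R^{(0,1)}(t,t^-)-R^{(0,1)}(t,t^+)$ for $t\in]0,1[$ (extended by continuity to $[0,1]$ under (B)). $\|\cdot\|$ is the norm of RKHS($R$), the reproducing kernel Hilbert space with kernel $R$. (A) $R$ is continuous on $[0,1]^2$, $R^{(0,1)}(t,t^\pm)$ and $R^{(0,2)}(t,t^\pm)$ exist and are continuous, and off the diagonal $R$ has continuous derivatives up to order two. (B) $\alpha$ is Lipschitz on $]0,1[$, $\inf_{0<t<1}\alpha(t)=\alpha_0>0$, $\sup_{0<t<1}\alpha(t)=\alpha_1<\infty$. (C) For each $t\in[0,1]$, $R^{(0,2)}(\cdot,t^+)\in$ RKHS($R$) and $\sup_{0\le t\le1}\|R^{(0,2)}(\cdot,t^+)\|<\infty$. (One then writes $R^{(0,2)}(\cdot,t)$ for $R^{(0,2)}(\cdot,t^+)$.) (D) $K$ is even and $K'$ is Lipschitz on $[-1,1]$. Constant $C$: with $K_\infty=\sup_{[-1,1]}|K|$, $R_1=\sup_{s,t}|R^{(1,1)}(s^-,t^+)|$, $R_2=\sup_{s,t}|R^{(0,2)}(s,t^+)|$, $C=K_\infty^2(\frac43\alpha_1+R_1+\frac43R_2)$ if $x-h,x+h\in T_n$, and $C=K_\infty^2(\frac83\alpha_1+\frac53R_1+\frac83R_2)$ otherwise. *)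

theory Defs
  imports
    "HOL-Probability.Probability"
    "HOL-Library.Landau_Symbols"
    "Jordan_Normal_Form.Gauss_Jordan_Elimination"
begin

subsection \<open>Error processes on the unit interval\<close>

definition sample_path :: "(real \<Rightarrow> 'a \<Rightarrow> real) \<Rightarrow> 'a \<Rightarrow> real \<Rightarrow> real" where
  "sample_path X \<omega> = (\<lambda>t\<in>{0..1}. X t \<omega>)"

definition path_space :: "(real \<Rightarrow> real) measure" where
  "path_space = (\<Pi>\<^sub>M t\<in>{0..1}. borel)"

definition centered_second_order_process ::
    "'a measure \<Rightarrow> (real \<Rightarrow> 'a \<Rightarrow> real) \<Rightarrow> (real \<Rightarrow> real \<Rightarrow> real) \<Rightarrow> bool" where
  "centered_second_order_process P X R \<longleftrightarrow>
     prob_space P \<and>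
     (\<forall>t\<in>{0..1}. X t \<in> borel_measurable P \<and> integrable P (\<lambda>\<omega>. (X t \<omega>)\<^sup>2) \<and>
                 (LINT \<omega>|P. X t \<omega>) = 0) \<and>
     (\<forall>s\<in>{0..1}. \<forall>t\<in>{0..1}. (LINT \<omega>|P. X s \<omega> * X t \<omega>) = R s t)"

text \<open>\<open>\<epsilon> 1, \<dots>, \<epsilon> m\<close> on \<open>M\<close> are independent and each has the law of the process \<open>X\<close> on \<open>P\<close>.\<close>

definition iid_copies ::
    "'a measure \<Rightarrow> nat \<Rightarrow> (nat \<Rightarrow> real \<Rightarrow> 'a \<Rightarrow> real) \<Rightarrow> 'b measure \<Rightarrow> (real \<Rightarrow> 'b \<Rightarrow> real) \<Rightarrow> bool" where
  "iid_copies M m \<epsilon> P X \<longleftrightarrow>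
     prob_space M \<and>
     prob_space.indep_vars M (\<lambda>_. path_space) (\<lambda>j. sample_path (\<epsilon> j)) {1..m} \<and>
     (\<forall>j\<in>{1..m}. distr M path_space (sample_path (\<epsilon> j)) = distr P path_space (sample_path X))"

definition gram_mat :: "(real \<Rightarrow> real \<Rightarrow> real) \<Rightarrow> real list \<Rightarrow> real mat" where
  "gram_mat R ts = Matrix.mat (length ts) (length ts) (\<lambda>(i, j). R (ts ! i) (ts ! j))"

definition nonsingular_kernel :: "(real \<Rightarrow> real \<Rightarrow> real) \<Rightarrow> bool" where
  "nonsingular_kernel R \<longleftrightarrow>
     (\<forall>T. finite T \<and> T \<subseteq> {0..1} \<longrightarrow> invertible_mat (gram_mat R (sorted_list_of_set T)))"

subsection \<open>Reproducing kernel Hilbert spaces\<close>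

text \<open>Functions on \<open>D\<close> are represented by functions vanishing outside \<open>D\<close>.\<close>

definition on_domain :: "'a set \<Rightarrow> ('a \<Rightarrow> real) \<Rightarrow> 'a \<Rightarrow> real" where
  "on_domain D f = (\<lambda>s. if s \<in> D then f s else 0)"

definition ip_norm :: "(('a \<Rightarrow> real) \<Rightarrow> ('a \<Rightarrow> real) \<Rightarrow> real) \<Rightarrow> ('a \<Rightarrow> real) \<Rightarrow> real" where
  "ip_norm ip f = sqrt (ip f f)"

text \<open>\<open>(H, ip)\<close> is the Hilbert space of functions on \<open>D\<close> with reproducing kernel \<open>k\<close>;
  by the Moore--Aronszajn theorem it is determined by \<open>k\<close> (up to values of \<open>ip\<close> outside \<open>H\<close>).\<close>

definition is_rkhs ::
    "'a set \<Rightarrow> ('a \<Rightarrow> 'a \<Rightarrow> real) \<Rightarrow> ('a \<Rightarrow> real) set \<Rightarrow>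
     (('a \<Rightarrow> real) \<Rightarrow> ('a \<Rightarrow> real) \<Rightarrow> real) \<Rightarrow> bool" where
  "is_rkhs D k H ip \<longleftrightarrow>
     (\<forall>f\<in>H. \<forall>s. s \<notin> D \<longrightarrow> f s = 0) \<and>
     (\<lambda>_. 0) \<in> H \<and>
     (\<forall>f\<in>H. \<forall>g\<in>H. (\<lambda>s. f s + g s) \<in> H) \<and>
     (\<forall>c. \<forall>f\<in>H. (\<lambda>s. c * f s) \<in> H) \<and>
     (\<forall>f\<in>H. \<forall>g\<in>H. ip f g = ip g f) \<and>
     (\<forall>f\<in>H. \<forall>g\<in>H. \<forall>u\<in>H. ip (\<lambda>s. f s + g s) u = ip f u + ip g u) \<and>
     (\<forall>c. \<forall>f\<in>H. \<forall>u\<in>H. ip (\<lambda>s. c * f s) u = c * ip f u) \<and>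
     (\<forall>f\<in>H. 0 \<le> ip f f \<and> (ip f f = 0 \<longrightarrow> f = (\<lambda>_. 0))) \<and>
     (\<forall>F :: nat \<Rightarrow> 'a \<Rightarrow> real.
        (\<forall>i. F i \<in> H) \<and>
        (\<forall>e>0. \<exists>N. \<forall>i\<ge>N. \<forall>j\<ge>N. ip_norm ip (\<lambda>s. F i s - F j s) < e) \<longrightarrow>
        (\<exists>f\<in>H. (\<lambda>i. ip_norm ip (\<lambda>s. F i s - f s)) \<longlonglongrightarrow> 0)) \<and>
     (\<forall>t\<in>D. on_domain D (\<lambda>s. k s t) \<in> H \<and>
             (\<forall>f\<in>H. ip f (on_domain D (\<lambda>s. k s t)) = f t))"

subsection \<open>Derivatives of the autocovariance\<close>

text \<open>Partial derivatives on the unit square, one-sided at its boundary.\<close>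

definition pd1 :: "(real \<Rightarrow> real \<Rightarrow> real) \<Rightarrow> real \<Rightarrow> real \<Rightarrow> real" where
  "pd1 F s t = vector_derivative (\<lambda>u. F u t) (at s within {0..1})"

definition pd2 :: "(real \<Rightarrow> real \<Rightarrow> real) \<Rightarrow> real \<Rightarrow> real \<Rightarrow> real" where
  "pd2 F s t = vector_derivative (\<lambda>u. F s u) (at t within {0..1})"

definition has_pds_at :: "(real \<Rightarrow> real \<Rightarrow> real) \<Rightarrow> real \<Rightarrow> real \<Rightarrow> bool" where
  "has_pds_at F s t \<longleftrightarrow>
     (\<lambda>u. F u t) differentiable (at s within {0..1}) \<and>
     (\<lambda>u. F s u) differentiable (at t within {0..1})"

definition off_diag :: "(real \<times> real) set" where
  "off_diag = {(s, t). s \<in> {0..1} \<and> t \<in> {0..1} \<and> s \<noteq> t}"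

text \<open>\<open>D(t, t\<^sup>-)\<close> and \<open>D(t, t\<^sup>+)\<close> for a function \<open>D\<close> of two variables.\<close>

definition diag_left :: "(real \<Rightarrow> real \<Rightarrow> real) \<Rightarrow> real \<Rightarrow> real" where
  "diag_left D t = Lim (at_left t) (\<lambda>s. D t s)"

definition diag_right :: "(real \<Rightarrow> real \<Rightarrow> real) \<Rightarrow> real \<Rightarrow> real" where
  "diag_right D t = Lim (at_right t) (\<lambda>s. D t s)"

definition continuous_diag_limits :: "(real \<Rightarrow> real \<Rightarrow> real) \<Rightarrow> bool" where
  "continuous_diag_limits D \<longleftrightarrow>
     (\<forall>t\<in>{0<..1}. \<exists>l. ((\<lambda>s. D t s) \<longlongrightarrow> l) (at_left t)) \<and>
     (\<forall>t\<in>{0..<1}. \<exists>l. ((\<lambda>s. D t s) \<longlongrightarrow> l) (at_right t)) \<and>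
     continuous_on {0<..1} (diag_left D) \<and>
     continuous_on {0..<1} (diag_right D)"

definition assumption_A :: "(real \<Rightarrow> real \<Rightarrow> real) \<Rightarrow> bool" where
  "assumption_A R \<longleftrightarrow>
     continuous_on ({0..1} \<times> {0..1}) (\<lambda>(s, t). R s t) \<and>
     continuous_diag_limits (pd2 R) \<and>
     continuous_diag_limits (pd2 (pd2 R)) \<and>
     (\<forall>(s, t)\<in>off_diag. has_pds_at R s t \<and> has_pds_at (pd1 R) s t \<and> has_pds_at (pd2 R) s t) \<and>
     (\<forall>D\<in>{pd1 R, pd2 R, pd1 (pd1 R), pd1 (pd2 R), pd2 (pd1 R), pd2 (pd2 R)}.
        continuous_on off_diag (\<lambda>(s, t). D s t))"

definition jump :: "(real \<Rightarrow> real \<Rightarrow> real) \<Rightarrow> real \<Rightarrow> real" where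
  "jump R t = diag_left (pd2 R) t - diag_right (pd2 R) t"

text \<open>The function \<open>\<alpha>\<close>, extended by continuity to the end points.\<close>

definition alpha :: "(real \<Rightarrow> real \<Rightarrow> real) \<Rightarrow> real \<Rightarrow> real" where
  "alpha R t =
     (if t \<le> 0 then Lim (at_right 0) (jump R)
      else if 1 \<le> t then Lim (at_left 1) (jump R)
      else jump R t)"

text \<open>The Lipschitz condition makes \<open>\<alpha>\<close> bounded, so the infimum below is a genuine one.\<close>

definition assumption_B :: "(real \<Rightarrow> real \<Rightarrow> real) \<Rightarrow> bool" where
  "assumption_B R \<longleftrightarrow>
     (\<exists>L. L-lipschitz_on {0<..<1} (alpha R)) \<and>
     0 < (INF t\<in>{0<..<1}. alpha R t) \<and>
     bdd_above (alpha R ` {0<..<1})"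

text \<open>\<open>R\<^sup>(\<^sup>0\<^sup>,\<^sup>2\<^sup>)(s, t\<^sup>+)\<close>. At the corner \<open>s = t = 1\<close>, where there is no limit from the right,
  the one available one-sided limit is used.\<close>

definition R02p :: "(real \<Rightarrow> real \<Rightarrow> real) \<Rightarrow> real \<Rightarrow> real \<Rightarrow> real" where
  "R02p R s t =
     (if s \<noteq> t then pd2 (pd2 R) s t
      else if t < 1 then diag_right (pd2 (pd2 R)) t
      else diag_left (pd2 (pd2 R)) t)"

abbreviation R02_section :: "(real \<Rightarrow> real \<Rightarrow> real) \<Rightarrow> real \<Rightarrow> real \<Rightarrow> real" where
  "R02_section R t \<equiv> on_domain {0..1} (\<lambda>s. R02p R s t)"

definition assumption_C ::
    "(real \<Rightarrow> real \<Rightarrow> real) \<Rightarrow> (real \<Rightarrow> real) set \<Rightarrow> ((real \<Rightarrow> real) \<Rightarrow> (real \<Rightarrow> real) \<Rightarrow> real) \<Rightarrow> bool" where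
  "assumption_C R H ip \<longleftrightarrow>
     (\<forall>t\<in>{0..1}. R02_section R t \<in> H) \<and>
     bdd_above ((\<lambda>t. ip_norm ip (R02_section R t)) ` {0..1})"

subsection \<open>Kernel and estimator\<close>

definition C1_kernel :: "(real \<Rightarrow> real) \<Rightarrow> (real \<Rightarrow> real) \<Rightarrow> bool" where
  "C1_kernel K K' \<longleftrightarrow>
     (\<forall>t. (K has_real_derivative K' t) (at t)) \<and> continuous_on UNIV K' \<and>
     closure {t. K t \<noteq> 0} = {-1..1} \<and>
     integral {-1..1} K = 1 \<and>
     integral {-1..1} (\<lambda>t. t * K t) = 0 \<and>
     (\<lambda>t. t\<^sup>2 * K t) absolutely_integrable_on {-1..1}"

definition assumption_D :: "(real \<Rightarrow> real) \<Rightarrow> (real \<Rightarrow> real) \<Rightarrow> bool" where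
  "assumption_D K K' \<longleftrightarrow> (\<forall>t. K (- t) = K t) \<and> (\<exists>L. L-lipschitz_on {-1..1} K')"

definition phi :: "(real \<Rightarrow> real) \<Rightarrow> real \<Rightarrow> real \<Rightarrow> real \<Rightarrow> real" where
  "phi K x h s = 1 / h * K ((x - s) / h)"

definition smoothed_cov ::
    "(real \<Rightarrow> real \<Rightarrow> real) \<Rightarrow> (real \<Rightarrow> real) \<Rightarrow> real \<Rightarrow> real \<Rightarrow> real \<Rightarrow> real" where
  "smoothed_cov R K x h t = integral {0..1} (\<lambda>s. R s t * phi K x h s)"

text \<open>A design of size \<open>n\<close> is given by the values \<open>T 1, \<dots>, T n\<close>.\<close>

definition design :: "nat \<Rightarrow> (nat \<Rightarrow> real) \<Rightarrow> bool" where
  "design n T \<longleftrightarrow> T ` {1..n} \<subseteq> {0..1} \<and> strict_mono_on {1..n} T"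

abbreviation design_list :: "nat \<Rightarrow> (nat \<Rightarrow> real) \<Rightarrow> real list" where
  "design_list n T \<equiv> map T [1..<Suc n]"

text \<open>The row vector \<open>(m(t\<^sub>1), \<dots>, m(t\<^sub>n))\<close>; matrix indices start at \<open>0\<close>.\<close>

definition weight_row ::
    "(real \<Rightarrow> real \<Rightarrow> real) \<Rightarrow> (real \<Rightarrow> real) \<Rightarrow> real \<Rightarrow> real \<Rightarrow> nat \<Rightarrow> (nat \<Rightarrow> real) \<Rightarrow> real mat" where
  "weight_row R K x h n T =
     Matrix.mat 1 n (\<lambda>(_, k). smoothed_cov R K x h (T (Suc k))) *
     the (mat_inverse (gram_mat R (design_list n T)))"

definition weight ::
    "(real \<Rightarrow> real \<Rightarrow> real) \<Rightarrow> (real \<Rightarrow> real) \<Rightarrow> real \<Rightarrow> real \<Rightarrow> nat \<Rightarrow> (nat \<Rightarrow> real) \<Rightarrow> nat \<Rightarrow> real" where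
  "weight R K x h n T i = weight_row R K x h n T $$ (0, i - 1)"

definition observation ::
    "(real \<Rightarrow> real) \<Rightarrow> (nat \<Rightarrow> real \<Rightarrow> 'a \<Rightarrow> real) \<Rightarrow> nat \<Rightarrow> real \<Rightarrow> 'a \<Rightarrow> real" where
  "observation g \<epsilon> j t \<omega> = g t + \<epsilon> j t \<omega>"

definition mean_observation ::
    "(real \<Rightarrow> real) \<Rightarrow> (nat \<Rightarrow> real \<Rightarrow> 'a \<Rightarrow> real) \<Rightarrow> nat \<Rightarrow> real \<Rightarrow> 'a \<Rightarrow> real" where
  "mean_observation g \<epsilon> m t \<omega> = 1 / real m * (\<Sum>j = 1..m. observation g \<epsilon> j t \<omega>)"

definition g_pro ::
    "(real \<Rightarrow> real) \<Rightarrow> (nat \<Rightarrow> real \<Rightarrow> 'a \<Rightarrow> real) \<Rightarrow> nat \<Rightarrow> (real \<Rightarrow> real \<Rightarrow> real) \<Rightarrow> (real \<Rightarrow> real) \<Rightarrow>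
     real \<Rightarrow> real \<Rightarrow> nat \<Rightarrow> (nat \<Rightarrow> real) \<Rightarrow> 'a \<Rightarrow> real" where
  "g_pro g \<epsilon> m R K x h n T \<omega> =
     (\<Sum>i = 1..n. weight R K x h n T i * mean_observation g \<epsilon> m (T i) \<omega>)"

subsection \<open>Quantities in the error bound\<close>

text \<open>The design completed by \<open>t\<^sub>0 = 0\<close> and \<open>t\<^sub>n\<^sub>+\<^sub>1 = 1\<close>.\<close>

definition node :: "nat \<Rightarrow> (nat \<Rightarrow> real) \<Rightarrow> nat \<Rightarrow> real" where
  "node n T i = (if i = 0 then 0 else if i \<le> n then T i else 1)"

definition gap :: "nat \<Rightarrow> (nat \<Rightarrow> real) \<Rightarrow> nat \<Rightarrow> real" where
  "gap n T j = node n T (Suc j) - node n T j"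

definition N_design :: "real \<Rightarrow> real \<Rightarrow> nat \<Rightarrow> (nat \<Rightarrow> real) \<Rightarrow> nat" where
  "N_design x h n T =
     card {i\<in>{1..n}. {node n T (i - 1)..node n T (i + 1)} \<inter> {x - h<..<x + h} \<noteq> {}}"

definition K_sup :: "(real \<Rightarrow> real) \<Rightarrow> real" where
  "K_sup K = (SUP t\<in>{-1..1}. \<bar>K t\<bar>)"

definition alpha_sup :: "(real \<Rightarrow> real \<Rightarrow> real) \<Rightarrow> real" where
  "alpha_sup R = (SUP t\<in>{0<..<1}. alpha R t)"

text \<open>The one-sided limits \<open>R\<^sup>(\<^sup>1\<^sup>,\<^sup>1\<^sup>)(s\<^sup>-, t\<^sup>+)\<close> are ordinary values off the diagonal, and on the
  diagonal they are limits of such values, so they do not affect the supremum.\<close>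

definition abs_R11_values :: "(real \<Rightarrow> real \<Rightarrow> real) \<Rightarrow> real set" where
  "abs_R11_values R = (\<lambda>(s, t). \<bar>pd1 (pd2 R) s t\<bar>) ` off_diag"

definition R11_sup :: "(real \<Rightarrow> real \<Rightarrow> real) \<Rightarrow> real" where
  "R11_sup R = Sup (abs_R11_values R)"

definition R02_sup :: "(real \<Rightarrow> real \<Rightarrow> real) \<Rightarrow> real" where
  "R02_sup R = (SUP (s, t)\<in>{0..1} \<times> {0..1}. \<bar>R02p R s t\<bar>)"

definition C_const ::
    "(real \<Rightarrow> real \<Rightarrow> real) \<Rightarrow> (real \<Rightarrow> real) \<Rightarrow> real \<Rightarrow> real \<Rightarrow> nat \<Rightarrow> (nat \<Rightarrow> real) \<Rightarrow> real" where
  "C_const R K x h n T =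
     (if x - h \<in> T ` {1..n} \<and> x + h \<in> T ` {1..n}
      then (K_sup K)\<^sup>2 * (4 / 3 * alpha_sup R + R11_sup R + 4 / 3 * R02_sup R)
      else (K_sup K)\<^sup>2 * (8 / 3 * alpha_sup R + 5 / 3 * R11_sup R + 8 / 3 * R02_sup R))"

definition alpha_nh ::
    "(real \<Rightarrow> real \<Rightarrow> real) \<Rightarrow> (real \<Rightarrow> real) \<Rightarrow> real \<Rightarrow> real \<Rightarrow> nat \<Rightarrow> (nat \<Rightarrow> real) \<Rightarrow> real" where
  "alpha_nh R K x h n T =
     (SUP i\<in>{0..n}.
        SUP (s, t)\<in>{node n T i..node n T (Suc i)} \<times> {node n T i..node n T (Suc i)}.
          gap n T i * \<bar>alpha R s * phi K x h s - alpha R t * phi K x h t\<bar>)"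

definition beta_nh ::
    "((real \<Rightarrow> real) \<Rightarrow> (real \<Rightarrow> real) \<Rightarrow> real) \<Rightarrow> (real \<Rightarrow> real \<Rightarrow> real) \<Rightarrow> (real \<Rightarrow> real) \<Rightarrow>
     real \<Rightarrow> real \<Rightarrow> nat \<Rightarrow> (nat \<Rightarrow> real) \<Rightarrow> real" where
  "beta_nh ip R K x h n T =
     (SUP t\<in>{0..1}. 1 / alpha R t * ip_norm ip (R02_section R t)) *
     (sqrt (C_const R K x h n T) / sqrt h) * (SUP j\<in>{0..n}. (gap n T j)\<^sup>2)"

end

theory Submission
  imports Defs
begin

text \<open>
  The expectation of the estimator is \<open>\<Sum>\<^sub>i m(t\<^sub>i) g(t\<^sub>i) = \<integral> \<phi> u\<close>, where \<open>u\<close> is the element of the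
  span of the sections \<open>R(\<cdot>, t\<^sub>i)\<close> that interpolates \<open>g\<close> on the design. The remainder \<open>r\<close> is the
  smoothing bias of \<open>\<integral> \<phi> g\<close> beyond its second-order term, so what has to be bounded is
  \<open>\<integral> \<phi> (g - u)\<close>.

  Integrating \<open>R\<^sup>(\<^sup>0\<^sup>,\<^sup>2\<^sup>)(s, \<cdot>)\<close> by parts against \<open>\<gamma> / \<alpha>\<close>, the jump of \<open>R\<^sup>(\<^sup>0\<^sup>,\<^sup>1\<^sup>)\<close> across the diagonal
  returns \<open>\<gamma>(s)\<close>, and (C) together with the boundedness of \<open>R\<^sup>(\<^sup>1\<^sup>,\<^sup>1\<^sup>)\<close> places every other term
  in the RKHS, except those in \<open>R\<^sup>(\<^sup>0\<^sup>,\<^sup>1\<^sup>)(\<cdot>, 0)\<close> and \<open>R\<^sup>(\<^sup>0\<^sup>,\<^sup>1\<^sup>)(\<cdot>, 1)\<close>. These two are in the RKHS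
  as well: take \<open>\<gamma> = R(\<cdot>, 0)\<close> and \<open>\<gamma> = R(\<cdot>, 1)\<close> and solve a system whose determinant is that of
  the Gram matrix of \<open>{0, 1}\<close>. Hence the RKHS contains all Lipschitz functions, and \<open>\<parallel>u\<parallel>\<close> is
  bounded uniformly over the designs.

  Let \<open>d\<close> be the largest gap of the design. Since \<open>g - u\<close> vanishes on the design, an energy estimate
  for increments over disjoint intervals gives \<open>\<integral> \<phi> (g - u) = O(d / \<surd>h)\<close>. If some section
  \<open>R\<^sup>(\<^sup>0\<^sup>,\<^sup>2\<^sup>)(\<cdot>, t)\<close> is nonzero, this is \<open>O(n \<beta>)\<close>, because \<open>n d \<ge> 1/2\<close>. Otherwise \<open>u\<close> is affine
  on every cell, with bounded slopes on the first and the last one, so that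
  \<open>\<integral> \<phi> (g - u) = O(d\<^sup>2 / h)\<close>, which is \<open>O(N d\<^sup>3 / h\<^sup>3)\<close> because \<open>2 N d \<ge> (1 - x) h\<close>.
\<close>

subsection \<open>Calculus on the real line\<close>

lemma mvt_interior_deriv:
  fixes f f' :: "real \<Rightarrow> real"
  assumes "a < b" and "continuous_on {a..b} f"
    and "\<And>t. a < t \<Longrightarrow> t < b \<Longrightarrow> (f has_real_derivative f' t) (at t)"
  obtains z where "a < z" "z < b" "f b - f a = (b - a) * f' z"
proof -
  have "(f has_derivative (\<lambda>d. f' t * d)) (at t)" if "a < t" "t < b" for t
    using assms(3)[OF that] by (simp add: has_field_derivative_def)
  from mvt[OF assms(1,2) this] obtain z where "a < z" "z < b" "f b - f a = f' z * (b - a)" .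
  then show ?thesis
    by (intro that[of z]) (simp_all add: mult.commute)
qed

text \<open>A derivative is required only in the open interval. The sections \<open>R s\<close> may
  have a kink at \<open>s\<close>, and the intervals to which this bound is applied meet such a
  point at most at an end.\<close>

lemma deriv_bound_interior:
  fixes f f' :: "real \<Rightarrow> real"
  assumes "a \<le> b" and "continuous_on {a..b} f"
    and "\<And>t. a < t \<Longrightarrow> t < b \<Longrightarrow> (f has_real_derivative f' t) (at t)"
    and "\<And>t. a < t \<Longrightarrow> t < b \<Longrightarrow> \<bar>f' t\<bar> \<le> M"
  shows "\<bar>f b - f a\<bar> \<le> M * (b - a)"
proof (cases "a < b")
  case True
  obtain z where z: "a < z" "z < b" "f b - f a = (b - a) * f' z"
    by (rule mvt_interior_deriv[OF True assms(2,3)])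
  then have "\<bar>f b - f a\<bar> = (b - a) * \<bar>f' z\<bar>"
    using True by (simp add: abs_mult)
  also have "\<dots> \<le> (b - a) * M"
    using assms(4)[OF z(1,2)] True by (intro mult_left_mono) auto
  finally show ?thesis
    by (simp add: mult.commute)
qed (use assms(1) in auto)

lemma has_integral_cells:
  fixes f :: "real \<Rightarrow> real"
  assumes "\<And>k. k < N \<Longrightarrow> \<tau> k \<le> \<tau> (Suc k)"
    and "\<And>k. k < N \<Longrightarrow> (f has_integral I k) {\<tau> k..\<tau> (Suc k)}"
  shows "(f has_integral (\<Sum>k<N. I k)) {\<tau> 0..\<tau> N} \<and> \<tau> 0 \<le> \<tau> N"
  using assms
proof (induction N)
  case (Suc N)
  then have IH: "(f has_integral (\<Sum>k<N. I k)) {\<tau> 0..\<tau> N}" "\<tau> 0 \<le> \<tau> N"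
    by auto
  then show ?case
    using has_integral_combine[OF IH(2) Suc.prems(1)[of N] IH(1) Suc.prems(2)[of N]]
      Suc.prems(1)[of N] by auto
qed auto

text \<open>The exceptional set \<open>S\<close> can absorb the point \<open>t = s\<close>, at which
  the value of \<open>pd2 R s t\<close> is not controlled.\<close>

lemma has_integral_abs_bound:
  fixes f :: "real \<Rightarrow> real"
  assumes "(f has_integral i) {a..b}" "a \<le> b" "0 \<le> B" "finite S"
    and "\<And>t. t \<in> {a..b} - S \<Longrightarrow> \<bar>f t\<bar> \<le> B"
  shows "\<bar>i\<bar> \<le> B * (b - a)"
  using has_integral_bound_real[OF assms(3,4,1)] assms(2,5) by simp

lemma integrable_on_cells:
  fixes f :: "real \<Rightarrow> real"
  assumes "\<And>k. k < N \<Longrightarrow> \<tau> k \<le> \<tau> (Suc k)" and "f integrable_on {\<tau> 0..\<tau> N}"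
  shows "integral {\<tau> 0..\<tau> N} f = (\<Sum>k<N. integral {\<tau> k..\<tau> (Suc k)} f)"
proof -
  have mono: "\<tau> i \<le> \<tau> j" if "i \<le> j" "j \<le> N" for i j
    using that
  proof (induction j)
    case (Suc j)
    then show ?case
      using assms(1)[of j] by (cases "i = Suc j") auto
  qed auto
  have "(f has_integral integral {\<tau> k..\<tau> (Suc k)} f) {\<tau> k..\<tau> (Suc k)}" if "k < N" for k
    using integrable_on_subinterval[OF assms(2)] mono[of 0 k] mono[of "Suc k" N] that
    by (intro integrable_integral) auto
  with assms(1) show ?thesis
    by (intro integral_unique has_integral_cells[THEN conjunct1])
qed

text \<open>\<open>W t\<close> is the mean over \<open>{t..t + e}\<close> of \<open>G\<close>,
  continued to the line. Its derivative is a difference quotient of a Lipschitz function and so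
  obeys the bound \<open>L\<close> for every \<open>e\<close>; this uniformity is what survives the
  limit in \<open>eval_bounded_by_parts\<close>.\<close>

lemma lipschitz_C1_approximation:
  fixes G :: "real \<Rightarrow> real"
  assumes "L-lipschitz_on {0..1} G" and "0 < e" "e \<le> 1"
  shows "\<exists>W w. (\<forall>t\<in>{0..1}. (W has_real_derivative w t) (at t)) \<and> continuous_on {0..1} w \<and>
    (\<forall>t\<in>{0..1}. \<bar>w t\<bar> \<le> L) \<and> (\<forall>t\<in>{0..1}. \<bar>W t - G t\<bar> \<le> L * e)"
proof -
  \<comment> \<open>Clamping to \<open>{0..1}\<close> continues \<open>G\<close> by constants
    without enlarging its Lipschitz constant.\<close>
  define c where "c t = max 0 (min 1 t)" for t :: real
  define E where "E t = G (c t)" for t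
  have L: "0 \<le> L"
    using assms(1) by (rule lipschitz_on_nonneg)
  have lip: "\<bar>E s - E t\<bar> \<le> L * \<bar>s - t\<bar>" for s t
  proof -
    have "dist (G (c s)) (G (c t)) \<le> L * dist (c s) (c t)"
      by (rule lipschitz_onD[OF assms(1)]) (auto simp: c_def)
    also have "\<dots> \<le> L * \<bar>s - t\<bar>"
      using L by (intro mult_left_mono) (auto simp: c_def dist_real_def)
    finally show ?thesis
      by (simp add: E_def dist_real_def)
  qed
  have "L-lipschitz_on UNIV E"
    using lip L by (auto intro!: lipschitz_onI simp: dist_real_def)
  then have cont: "continuous_on S E" for S
    using lipschitz_on_continuous_on continuous_on_subset by blast
  \<comment> \<open>For \<open>t\<close> in \<open>{0..1}\<close> both \<open>t\<close> and
    \<open>t + e\<close> lie in the interior of \<open>{-1..3}\<close>, so the derivative of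
    \<open>F\<close> is two-sided there.\<close>
  obtain F where F: "\<And>t. t \<in> {-1..3} \<Longrightarrow> (F has_vector_derivative E t) (at t within {-1..3})"
    using antiderivative_continuous[OF cont] by blast
  have F': "(F has_real_derivative E t) (at t)" if "-1 < t" "t < 3" for t
    using F[of t] that at_within_Icc_at[of "-1" t 3]
    by (simp add: has_real_derivative_iff_has_vector_derivative)
  define W where "W t = (F (t + e) - F t) / e" for t
  define w where "w t = (E (t + e) - E t) / e" for t
  have W': "(W has_real_derivative w t) (at t)" if "t \<in> {0..1}" for t
    unfolding W_def w_def
    using that assms(2,3)
    by (auto intro!: derivative_eq_intros DERIV_chain'[OF _ F', of "\<lambda>t. t + e" 1 t, simplified] F'
        simp: field_simps)
  have "continuous_on {0..1} w"
    unfolding w_def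
    using assms(2) by (auto intro!: continuous_intros continuous_on_compose2[OF cont[of UNIV]] cont)
  moreover have "\<bar>w t\<bar> \<le> L" if "t \<in> {0..1}" for t
    using lip[of "t + e" t] assms(2) by (auto simp: w_def abs_divide field_simps)
  moreover have "\<bar>W t - G t\<bar> \<le> L * e" if t: "t \<in> {0..1}" for t
  proof -
    obtain z where z: "t < z" "z < t + e" "F (t + e) - F t = (t + e - t) * E z"
      using MVT2[of t "t + e" F E] F' assms t by (auto simp: F')
    then have "W t = E z"
      using assms(2) by (simp add: W_def)
    moreover have "G t = E t"
      using t by (simp add: E_def c_def)
    moreover have "L * \<bar>z - t\<bar> \<le> L * e"
      using z L by (intro mult_left_mono) auto
    ultimately show ?thesis
      using lip[of z t] by simp
  qed
  ultimately show ?thesis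
    using W' by (intro exI[of _ W] exI[of _ w] conjI ballI)
qed

text \<open>By the mean value theorem the slope of the chord is \<open>g'\<close> at some inner
  point, so \<open>g'\<close> differs from it by at most \<open>M * (b - a)\<close>; integrating
  once more costs another factor \<open>b - a\<close>. The constant is not sharp, only the order
  matters.\<close>

lemma linear_interpolation_error:
  fixes g g' g'' :: "real \<Rightarrow> real"
  assumes g: "\<And>t. t \<in> {a..b} \<Longrightarrow> (g has_real_derivative g' t) (at t within {a..b})"
    and g': "\<And>t. t \<in> {a..b} \<Longrightarrow> (g' has_real_derivative g'' t) (at t within {a..b})"
    and M: "\<And>t. t \<in> {a..b} \<Longrightarrow> \<bar>g'' t\<bar> \<le> M"
    and ab: "a < b" and s: "s \<in> {a..b}"
  shows "\<bar>g s - (g a + (s - a) * ((g b - g a) / (b - a)))\<bar> \<le> M * (b - a)\<^sup>2"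
proof -
  define \<kappa> where "\<kappa> = (g b - g a) / (b - a)"
  have at: "(g has_real_derivative g' t) (at t)" if "a < t" "t < b" for t
    using g[of t] that at_within_Icc_at[of a t b] by simp
  have M0: "0 \<le> M"
    using M[of a] ab by force
  have "continuous_on {a..b} g"
    using g by (meson DERIV_continuous continuous_on_eq_continuous_within)
  then obtain z where z: "a < z" "z < b" "g b - g a = (b - a) * g' z"
    by (rule mvt_interior_deriv[OF ab _ at])
  then have \<kappa>: "\<kappa> = g' z"
    using ab by (simp add: \<kappa>_def)
  have bound: "\<bar>g' t - \<kappa>\<bar> \<le> M * (b - a)" if t: "t \<in> {a..b}" for t
  proof -
    have "norm (g' t - g' z) \<le> M * norm (t - z)"
      using t z by (intro field_differentiable_bound[of "{a..b}" g' g''] g') (auto simp: M)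
    also have "\<dots> \<le> M * (b - a)"
      using t z M0 by (intro mult_left_mono) auto
    finally show ?thesis
      by (simp add: \<kappa>)
  qed
  have "norm ((g s - \<kappa> * s) - (g a - \<kappa> * a)) \<le> (M * (b - a)) * norm (s - a)"
    using s ab bound
    by (intro field_differentiable_bound[of "{a..b}" "\<lambda>t. g t - \<kappa> * t" "\<lambda>t. g' t - \<kappa>"])
      (auto intro!: derivative_eq_intros g)
  also have "\<dots> \<le> (M * (b - a)) * (b - a)"
    using s ab M0 by (intro mult_left_mono) auto
  finally show ?thesis
    unfolding \<kappa>_def[symmetric] by (simp add: power2_eq_square algebra_simps)
qed

lemma real_derivative_at_interior:
  assumes "(f has_real_derivative D) (at t within {0..1})" "0 < t" "t < 1"
  shows "(f has_real_derivative D) (at t)"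
  using assms at_within_Icc_at[of 0 t 1] by simp

lemma continuous_on_extend_left:
  fixes p :: "real \<Rightarrow> real"
  assumes "a < b" and p: "continuous_on {a..<b} p" and lim: "(p \<longlongrightarrow> l) (at_left b)"
  shows "continuous_on {a..b} (p(b := l))"
  unfolding continuous_on_eq_continuous_within
proof
  fix t assume t: "t \<in> {a..b}"
  show "continuous (at t within {a..b}) (p(b := l))"
  proof (cases "t = b")
    case True
    have "((p(b := l)) \<longlongrightarrow> l) (at_left b)"
      by (rule Lim_transform_eventually[OF lim]) (auto simp: eventually_at_filter)
    then show ?thesis
      using True assms(1) by (simp add: continuous_within at_within_Icc_at_left)
  next
    case False
    have "(p \<longlongrightarrow> p t) (at t within {a..<b})"
      using p t False by (auto simp: continuous_on)
    moreover have "at t within {a..b} = at t within {a..<b}"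
      using t False by (intro at_within_nhd[of t "{..<b}"]) auto
    ultimately have "(p \<longlongrightarrow> p t) (at t within {a..b})"
      by simp
    moreover have "\<forall>\<^sub>F u in at t within {a..b}. p u = (p(b := l)) u"
      by (rule eventually_mono[OF order_tendstoD(2)[OF tendsto_ident_at, of t b "{a..b}"]])
        (use t False in auto)
    ultimately have "((p(b := l)) \<longlongrightarrow> p t) (at t within {a..b})"
      by (rule Lim_transform_eventually)
    then show ?thesis
      using False by (simp add: continuous_within)
  qed
qed

lemma continuous_on_extend_right:
  fixes p :: "real \<Rightarrow> real"
  assumes "a < b" and p: "continuous_on {a<..b} p" and lim: "(p \<longlongrightarrow> l) (at_right a)"
  shows "continuous_on {a..b} (p(a := l))"
  unfolding continuous_on_eq_continuous_within
proof
  fix t assume t: "t \<in> {a..b}"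
  show "continuous (at t within {a..b}) (p(a := l))"
  proof (cases "t = a")
    case True
    have "((p(a := l)) \<longlongrightarrow> l) (at_right a)"
      by (rule Lim_transform_eventually[OF lim]) (auto simp: eventually_at_filter)
    then show ?thesis
      using True assms(1) by (simp add: continuous_within at_within_Icc_at_right)
  next
    case False
    have "(p \<longlongrightarrow> p t) (at t within {a<..b})"
      using p t False by (auto simp: continuous_on)
    moreover have "at t within {a..b} = at t within {a<..b}"
      using t False by (intro at_within_nhd[of t "{a<..}"]) auto
    ultimately have "(p \<longlongrightarrow> p t) (at t within {a..b})"
      by simp
    moreover have "\<forall>\<^sub>F u in at t within {a..b}. p u = (p(a := l)) u"
      by (rule eventually_mono[OF order_tendstoD(1)[OF tendsto_ident_at, of a t "{a..b}"]])
        (use t False in auto)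
    ultimately have "((p(a := l)) \<longlongrightarrow> p t) (at t within {a..b})"
      by (rule Lim_transform_eventually)
    then show ?thesis
      using False by (simp add: continuous_within)
  qed
qed

subsection \<open>Reproducing kernel Hilbert spaces\<close>

locale rkhs =
  fixes D :: "'d set" and k :: "'d \<Rightarrow> 'd \<Rightarrow> real"
    and H :: "('d \<Rightarrow> real) set" and ip :: "('d \<Rightarrow> real) \<Rightarrow> ('d \<Rightarrow> real) \<Rightarrow> real"
  assumes is_rkhs: "is_rkhs D k H ip"
begin

definition ksec :: "'d \<Rightarrow> 'd \<Rightarrow> real" where
  "ksec t = on_domain D (\<lambda>s. k s t)"

abbreviation hnorm :: "('d \<Rightarrow> real) \<Rightarrow> real" where
  "hnorm \<equiv> ip_norm ip"

lemma zero_mem: "(\<lambda>_. 0) \<in> H"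
  and add_mem: "f \<in> H \<Longrightarrow> g \<in> H \<Longrightarrow> (\<lambda>s. f s + g s) \<in> H"
  and scale_mem: "f \<in> H \<Longrightarrow> (\<lambda>s. c * f s) \<in> H"
  and ip_commute: "f \<in> H \<Longrightarrow> g \<in> H \<Longrightarrow> ip f g = ip g f"
  and ip_add_left: "f \<in> H \<Longrightarrow> g \<in> H \<Longrightarrow> u \<in> H \<Longrightarrow> ip (\<lambda>s. f s + g s) u = ip f u + ip g u"
  and ip_scale_left: "f \<in> H \<Longrightarrow> u \<in> H \<Longrightarrow> ip (\<lambda>s. c * f s) u = c * ip f u"
  and ip_nonneg: "f \<in> H \<Longrightarrow> 0 \<le> ip f f"
  and ip_definite: "f \<in> H \<Longrightarrow> ip f f = 0 \<Longrightarrow> f = (\<lambda>_. 0)"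
proof -
  note rk = is_rkhs[unfolded is_rkhs_def, THEN conjunct2]
  show "(\<lambda>_. 0) \<in> H"
    using rk by (rule conjunct1)
  note rk = rk[THEN conjunct2]
  show "f \<in> H \<Longrightarrow> g \<in> H \<Longrightarrow> (\<lambda>s. f s + g s) \<in> H"
    using rk[THEN conjunct1] by simp
  note rk = rk[THEN conjunct2]
  show "f \<in> H \<Longrightarrow> (\<lambda>s. c * f s) \<in> H"
    using rk[THEN conjunct1] by simp
  note rk = rk[THEN conjunct2]
  show "f \<in> H \<Longrightarrow> g \<in> H \<Longrightarrow> ip f g = ip g f"
    by (rule rk[THEN conjunct1, rule_format])
  note rk = rk[THEN conjunct2]
  show "f \<in> H \<Longrightarrow> g \<in> H \<Longrightarrow> u \<in> H \<Longrightarrow> ip (\<lambda>s. f s + g s) u = ip f u + ip g u"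
    by (rule rk[THEN conjunct1, rule_format])
  note rk = rk[THEN conjunct2]
  show "f \<in> H \<Longrightarrow> u \<in> H \<Longrightarrow> ip (\<lambda>s. c * f s) u = c * ip f u"
    by (rule rk[THEN conjunct1, rule_format])
  note rk = rk[THEN conjunct2]
  show "f \<in> H \<Longrightarrow> 0 \<le> ip f f"
    using rk[THEN conjunct1] by simp
  show "f \<in> H \<Longrightarrow> ip f f = 0 \<Longrightarrow> f = (\<lambda>_. 0)"
    using rk[THEN conjunct1] by simp
qed

lemma ksec_mem: "t \<in> D \<Longrightarrow> ksec t \<in> H"
  and reproducing: "t \<in> D \<Longrightarrow> f \<in> H \<Longrightarrow> ip f (ksec t) = f t"
proof -
  have "\<forall>t\<in>D. ksec t \<in> H \<and> (\<forall>f\<in>H. ip f (ksec t) = f t)"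
    using is_rkhs unfolding is_rkhs_def ksec_def by (elim conjE) assumption
  then show "t \<in> D \<Longrightarrow> ksec t \<in> H" "t \<in> D \<Longrightarrow> f \<in> H \<Longrightarrow> ip f (ksec t) = f t"
    by simp_all
qed

lemma ksec_apply: "s \<in> D \<Longrightarrow> ksec t s = k s t"
  by (simp add: ksec_def on_domain_def)

lemma ip_ksec: "s \<in> D \<Longrightarrow> t \<in> D \<Longrightarrow> ip (ksec s) (ksec t) = k t s"
  by (simp add: reproducing ksec_mem ksec_apply)

lemma kernel_commute: "s \<in> D \<Longrightarrow> t \<in> D \<Longrightarrow> k s t = k t s"
  using ip_commute[OF ksec_mem ksec_mem, of s t] by (simp add: ip_ksec)

lemma hnorm_nonneg: "f \<in> H \<Longrightarrow> 0 \<le> hnorm f"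
  by (simp add: ip_norm_def ip_nonneg)

lemma hnorm_sq: "f \<in> H \<Longrightarrow> (hnorm f)\<^sup>2 = ip f f"
  by (simp add: ip_norm_def ip_nonneg)

lemma hnorm_eq_0: "f \<in> H \<Longrightarrow> hnorm f = 0 \<Longrightarrow> f = (\<lambda>_. 0)"
  by (simp add: ip_norm_def ip_definite)

lemma sum_mem:
  "finite I \<Longrightarrow> (\<And>i. i \<in> I \<Longrightarrow> f i \<in> H) \<Longrightarrow> (\<lambda>s. \<Sum>i\<in>I. c i * f i s) \<in> H"
  by (induction I rule: finite_induct) (auto intro!: zero_mem add_mem scale_mem)

lemma ip_zero_left: "u \<in> H \<Longrightarrow> ip (\<lambda>_. 0) u = 0"
  using ip_scale_left[OF zero_mem, of u 0] by simp

lemma ip_sum_left: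
  "finite I \<Longrightarrow> (\<And>i. i \<in> I \<Longrightarrow> f i \<in> H) \<Longrightarrow> u \<in> H \<Longrightarrow>
    ip (\<lambda>s. \<Sum>i\<in>I. c i * f i s) u = (\<Sum>i\<in>I. c i * ip (f i) u)"
  by (induction I rule: finite_induct)
    (auto simp: ip_zero_left ip_add_left ip_scale_left scale_mem sum_mem)

lemma ip_sum_right:
  assumes "finite I" "\<And>i. i \<in> I \<Longrightarrow> f i \<in> H" "u \<in> H"
  shows "ip u (\<lambda>s. \<Sum>i\<in>I. c i * f i s) = (\<Sum>i\<in>I. c i * ip u (f i))"
proof -
  have "ip u (\<lambda>s. \<Sum>i\<in>I. c i * f i s) = ip (\<lambda>s. \<Sum>i\<in>I. c i * f i s) u"
    using assms by (intro ip_commute sum_mem)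
  also have "\<dots> = (\<Sum>i\<in>I. c i * ip (f i) u)"
    using assms by (rule ip_sum_left)
  also have "\<dots> = (\<Sum>i\<in>I. c i * ip u (f i))"
    using assms by (intro sum.cong refl) (simp add: ip_commute)
  finally show ?thesis .
qed

lemma Cauchy_Schwarz:
  assumes "f \<in> H" "g \<in> H"
  shows "\<bar>ip f g\<bar> \<le> hnorm f * hnorm g"
proof -
  have quad: "0 \<le> ip f f + 2 * c * ip f g + c\<^sup>2 * ip g g" for c
  proof -
    define u where "u = (\<lambda>s. f s + c * g s)"
    have mem: "u \<in> H" "(\<lambda>s. c * g s) \<in> H"
      using assms by (auto simp: u_def intro: add_mem scale_mem)
    have left: "ip u v = ip f v + c * ip g v" if "v \<in> H" for v
      using assms mem that by (simp add: u_def ip_add_left ip_scale_left)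
    have "ip u u = ip f f + c * ip g f + c * (ip f g + c * ip g g)"
      using left[OF mem(1)] left[OF assms(1)] left[OF assms(2)]
        ip_commute[OF assms(1) mem(1)] ip_commute[OF assms(2) mem(1)] by simp
    then show ?thesis
      using ip_nonneg[OF mem(1)] ip_commute[OF assms]
      by (simp add: power2_eq_square algebra_simps)
  qed
  have "(ip f g)\<^sup>2 \<le> ip f f * ip g g"
  proof (cases "ip g g = 0")
    case True
    then have "g = (\<lambda>_. 0)"
      using assms ip_definite by blast
    then have "ip f g = 0"
      using assms ip_zero_left[of f] ip_commute[of f g] by simp
    then show ?thesis
      by (simp add: assms ip_nonneg)
  next
    case False
    then have pos: "0 < ip g g"
      using ip_nonneg[OF assms(2)] by simp
    \<comment> \<open>The quadratic is evaluated at its minimum.\<close>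
    have "0 \<le> ip f f - (ip f g)\<^sup>2 / ip g g"
      using quad[of "- ip f g / ip g g"] pos by (simp add: power2_eq_square field_simps)
    then show ?thesis
      using pos by (simp add: field_simps)
  qed
  then have "sqrt ((ip f g)\<^sup>2) \<le> sqrt (ip f f * ip g g)"
    by (rule real_sqrt_le_mono)
  then show ?thesis
    by (simp add: ip_norm_def real_sqrt_mult)
qed

section \<open>Finite kernel sums and functions bounded on them\<close>

definition ksum :: "'d set \<Rightarrow> ('d \<Rightarrow> real) \<Rightarrow> 'd \<Rightarrow> real" where
  "ksum S c = (\<lambda>s. \<Sum>t\<in>S. c t * ksec t s)"

lemma ksum_mem: "finite S \<Longrightarrow> S \<subseteq> D \<Longrightarrow> ksum S c \<in> H"
  unfolding ksum_def by (rule sum_mem) (auto intro: ksec_mem)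

lemma ksum_apply: "s \<in> D \<Longrightarrow> ksum S c s = (\<Sum>t\<in>S. c t * k s t)"
  by (simp add: ksum_def ksec_apply)

lemma ip_ksum:
  assumes "finite S" "S \<subseteq> D" "f \<in> H"
  shows "ip f (ksum S c) = (\<Sum>t\<in>S. c t * f t)"
  unfolding ksum_def
  using assms by (subst ip_sum_right) (auto simp: reproducing subset_iff intro!: ksec_mem sum.cong)

text \<open>On \<open>D\<close>, the functions that satisfy this for some \<open>B\<close> are those of the RKHS. The condition
  passes to pointwise limits, so it replaces integrals with values in the RKHS.\<close>

definition eval_bounded :: "real \<Rightarrow> ('d \<Rightarrow> real) \<Rightarrow> bool" where
  "eval_bounded B f \<longleftrightarrow>
     (\<forall>S c. finite S \<longrightarrow> S \<subseteq> D \<longrightarrow> \<bar>\<Sum>t\<in>S. c t * f t\<bar> \<le> B * hnorm (ksum S c))"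

lemma eval_boundedD:
  "eval_bounded B f \<Longrightarrow> finite S \<Longrightarrow> S \<subseteq> D \<Longrightarrow> \<bar>\<Sum>t\<in>S. c t * f t\<bar> \<le> B * hnorm (ksum S c)"
  unfolding eval_bounded_def by blast

lemma eval_bounded_mem: "f \<in> H \<Longrightarrow> eval_bounded (hnorm f) f"
  unfolding eval_bounded_def using Cauchy_Schwarz ip_ksum ksum_mem by metis

lemma eval_bounded_cong:
  assumes "\<And>t. t \<in> D \<Longrightarrow> f t = g t"
  shows "eval_bounded B f \<longleftrightarrow> eval_bounded B g"
proof -
  have "(\<Sum>t\<in>S. c t * f t) = (\<Sum>t\<in>S. c t * g t)" if "S \<subseteq> D" for S c
    using assms that by (intro sum.cong) auto
  then show ?thesis
    unfolding eval_bounded_def by auto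
qed

lemma eval_bounded_add:
  assumes "eval_bounded B f" "eval_bounded C g"
  shows "eval_bounded (B + C) (\<lambda>s. f s + g s)"
  unfolding eval_bounded_def
proof (intro allI impI)
  fix S c assume S: "finite S" "S \<subseteq> D"
  show "\<bar>\<Sum>t\<in>S. c t * (f t + g t)\<bar> \<le> (B + C) * hnorm (ksum S c)"
    using eval_boundedD[OF assms(1) S, of c] eval_boundedD[OF assms(2) S, of c]
    by (simp add: distrib_left distrib_right sum.distrib)
qed

lemma eval_bounded_scale:
  assumes "eval_bounded B f"
  shows "eval_bounded (\<bar>a\<bar> * B) (\<lambda>s. a * f s)"
  unfolding eval_bounded_def
proof (intro allI impI)
  fix S c assume S: "finite S" "S \<subseteq> D"
  have "(\<Sum>t\<in>S. c t * (a * f t)) = a * (\<Sum>t\<in>S. c t * f t)"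
    by (simp add: sum_distrib_left mult_ac)
  then show "\<bar>\<Sum>t\<in>S. c t * (a * f t)\<bar> \<le> \<bar>a\<bar> * B * hnorm (ksum S c)"
    using mult_left_mono[OF eval_boundedD[OF assms S, of c] abs_ge_zero[of a]]
    by (simp add: abs_mult mult.assoc)
qed

lemma eval_bounded_limit:
  assumes "\<And>n. eval_bounded B (F n)" and "\<And>s. s \<in> D \<Longrightarrow> (\<lambda>n :: nat. F n s) \<longlonglongrightarrow> f s"
  shows "eval_bounded B f"
  unfolding eval_bounded_def
proof (intro allI impI)
  fix S c assume S: "finite S" "S \<subseteq> D"
  have "(\<lambda>n. \<bar>\<Sum>t\<in>S. c t * F n t\<bar>) \<longlonglongrightarrow> \<bar>\<Sum>t\<in>S. c t * f t\<bar>"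
    using S by (intro tendsto_rabs tendsto_sum tendsto_mult tendsto_const assms(2)) auto
  then show "\<bar>\<Sum>t\<in>S. c t * f t\<bar> \<le> B * hnorm (ksum S c)"
    by (rule LIMSEQ_le_const2) (use eval_boundedD[OF assms(1) S] in auto)
qed

text \<open>By the reproducing property the squared norm of the interpolant is
  \<open>\<Sum>t\<in>S. c t * f t\<close>, which the hypothesis on \<open>f\<close> bounds by
  \<open>B\<close> times the norm itself. The result does not depend on \<open>S\<close>, so it is
  uniform over all designs.\<close>

lemma hnorm_interpolant_le:
  assumes S: "finite S" "S \<subseteq> D" and interp: "\<And>t. t \<in> S \<Longrightarrow> ksum S c t = f t"
    and f: "eval_bounded B f" and B: "0 \<le> B"
  shows "hnorm (ksum S c) \<le> B"
proof -
  have "(hnorm (ksum S c))\<^sup>2 = (\<Sum>t\<in>S. c t * f t)"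
    using S interp by (simp add: hnorm_sq ksum_mem ip_ksum cong: sum.cong)
  also have "\<dots> \<le> B * hnorm (ksum S c)"
    using eval_boundedD[OF f S, of c] by linarith
  finally show ?thesis
    using B hnorm_nonneg[OF ksum_mem[OF S], of c]
    by (metis mult_right_le_imp_le order_le_less power2_eq_square)
qed

end

subsection \<open>Gram matrices and projection weights\<close>

lemma gram_mat_carrier: "gram_mat R ts \<in> carrier_mat (length ts) (length ts)"
  by (simp add: gram_mat_def)

text \<open>The columns of a right inverse of the Gram matrix solve the system for unit data.
  \<open>ix\<close> passes from the points of \<open>S\<close> to matrix indices.\<close>

lemma gram_solve:
  assumes inv: "invertible_mat (gram_mat R (sorted_list_of_set S))" and S: "finite S"
  shows "\<exists>c. \<forall>t\<in>S. (\<Sum>s\<in>S. c s * R t s) = f t"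
proof -
  define ts where "ts = sorted_list_of_set S"
  define n where "n = length ts"
  have bij: "bij_betw (\<lambda>i. ts ! i) {..<n} S"
    by (rule bij_betw_nth) (use S in \<open>auto simp: ts_def n_def\<close>)
  define ix where "ix = inv_into {..<n} (\<lambda>i. ts ! i)"
  have ix: "ix (ts ! i) = i" if "i < n" for i
    unfolding ix_def using bij that by (intro inv_into_f_f) (auto simp: bij_betw_def)
  obtain B where B: "gram_mat R ts * B = 1\<^sub>m n" "B \<in> carrier_mat n n"
  proof -
    obtain B where AB: "gram_mat R ts * B = 1\<^sub>m n" "B * gram_mat R ts = 1\<^sub>m (dim_row B)"
      using inv gram_mat_carrier[of R ts]
      by (auto simp: invertible_mat_def inverts_mat_def ts_def n_def)
    \<comment> \<open>\<open>invertible_mat\<close> does not state the size of the inverse; it is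
      recovered from the two products.\<close>
    have "dim_col B = n"
      using arg_cong[OF AB(1), of dim_col] by simp
    moreover have "dim_row B = n"
      using arg_cong[OF AB(2), of dim_col] gram_mat_carrier[of R ts] by (simp add: n_def)
    ultimately show thesis
      using that AB(1) by blast
  qed
  have AB: "(\<Sum>k<n. R (ts ! i) (ts ! k) * B $$ (k, j)) = (if i = j then 1 else 0)"
    if ij: "i < n" "j < n" for i j
  proof -
    have "(gram_mat R ts * B) $$ (i, j) = (\<Sum>k<n. R (ts ! i) (ts ! k) * B $$ (k, j))"
      using ij B(2) gram_mat_carrier[of R ts]
      by (auto simp: scalar_prod_def gram_mat_def n_def atLeast0LessThan intro!: sum.cong)
    then show ?thesis
      using B(1) ij by simp
  qed
  define c where "c s = (\<Sum>j<n. B $$ (ix s, j) * f (ts ! j))" for s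
  have "(\<Sum>s\<in>S. c s * R t s) = f t" if "t \<in> S" for t
  proof -
    obtain i where i: "i < n" "t = ts ! i"
      using \<open>t \<in> S\<close> bij by (auto simp: bij_betw_def)
    have "(\<Sum>s\<in>S. c s * R t s) = (\<Sum>k<n. c (ts ! k) * R t (ts ! k))"
      by (rule sum.reindex_bij_betw[OF bij, symmetric])
    also have "\<dots> = (\<Sum>k<n. \<Sum>j<n. f (ts ! j) * (R (ts ! i) (ts ! k) * B $$ (k, j)))"
      unfolding c_def sum_distrib_right by (intro sum.cong refl) (simp add: ix i(2))
    also have "\<dots> = (\<Sum>j<n. f (ts ! j) * (\<Sum>k<n. R (ts ! i) (ts ! k) * B $$ (k, j)))"
      unfolding sum_distrib_left by (rule sum.swap)
    also have "\<dots> = (\<Sum>j<n. if i = j then f (ts ! j) else 0)"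
      using i(1) by (intro sum.cong refl) (simp add: AB)
    also have "\<dots> = f t"
      using i by simp
    finally show ?thesis .
  qed
  then show ?thesis
    by blast
qed

text \<open>\<open>nonsingular_kernel\<close> speaks of sets listed in increasing order, the
  estimator of the list of design values. This makes their Gram matrices the same.\<close>

lemma sorted_design:
  assumes "design n T"
  shows "sorted_list_of_set (T ` {1..n}) = design_list n T"
proof -
  have mono: "strict_mono_on {1..n} T"
    using assms by (simp add: design_def)
  have "sorted_wrt (\<lambda>i j. T i \<le> T j) [1..<Suc n]"
    by (rule sorted_wrt_mono_rel[OF _ sorted_wrt_upt])
      (use strict_mono_onD[OF mono] in \<open>auto intro!: less_imp_le\<close>)
  then have "sorted (design_list n T)"
    by (simp add: sorted_wrt_map)
  moreover have "distinct (design_list n T)"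
    using strict_mono_on_imp_inj_on[OF mono]
    by (simp add: distinct_map atLeastLessThanSuc_atLeastAtMost del: upt_Suc)
  moreover have "set (design_list n T) = T ` {1..n}"
    by (simp add: atLeastLessThanSuc_atLeastAtMost del: upt_Suc)
  ultimately show ?thesis
    using sorted_list_of_set.idem_if_sorted_distinct by metis
qed

text \<open>The weights are the row \<open>F\<close> of smoothed covariances times the inverse of
  the Gram matrix, so multiplying them by the Gram matrix returns \<open>F\<close>.\<close>

lemma weight_normal_equations:
  assumes inv: "invertible_mat (gram_mat R (design_list n T))" and j: "j \<in> {1..n}"
  shows "(\<Sum>i = 1..n. weight R K x h n T i * R (T i) (T j)) = smoothed_cov R K x h (T j)"
proof -
  define A where "A = gram_mat R (design_list n T)"
  define F where "F = Matrix.mat 1 n (\<lambda>(_ :: nat, k). smoothed_cov R K x h (T (Suc k)))"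
  have A: "A \<in> carrier_mat n n"
    using gram_mat_carrier[of R "design_list n T"] by (simp add: A_def del: upt_Suc)
  have F: "F \<in> carrier_mat 1 n"
    by (simp add: F_def)
  obtain B where B: "mat_inverse A = Some B"
  proof (cases "mat_inverse A")
    \<comment> \<open>An invertible matrix is a unit of the matrix ring, for which
      \<open>mat_inverse\<close> does not return \<open>None\<close>. Hence \<open>the\<close> in
      \<open>weight_row\<close> is applied to a genuine inverse.\<close>
    case None
    obtain C where C: "A * C = 1\<^sub>m n" "C * A = 1\<^sub>m (dim_row C)"
      using inv A unfolding A_def[symmetric] by (auto simp: invertible_mat_def inverts_mat_def)
    have "dim_col C = n"
      using arg_cong[OF C(1), of dim_col] by simp
    moreover have "dim_row C = n"
      using arg_cong[OF C(2), of dim_col] A by simp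
    ultimately have "A \<in> Units (ring_mat TYPE(real) n ())"
      using A C unfolding Units_def ring_mat_def by (auto intro!: bexI[of _ C])
    then show thesis
      using mat_inverse(1)[OF A None, of "()"] by simp
  qed auto
  then have BA: "B * A = 1\<^sub>m n" "B \<in> carrier_mat n n"
    using mat_inverse(2)[OF A B] by auto
  have row: "weight_row R K x h n T = F * B"
    unfolding weight_row_def F_def A_def[symmetric] by (simp add: B)
  have WA: "weight_row R K x h n T * A = F"
    unfolding row using assoc_mult_mat[OF F BA(2) A] BA F by simp
  have dims: "weight_row R K x h n T \<in> carrier_mat 1 n"
    unfolding row using F BA by simp
  have "smoothed_cov R K x h (T j) = (weight_row R K x h n T * A) $$ (0, j - 1)"
    unfolding WA F_def using j by auto
  also have "\<dots> = (\<Sum>k<n. weight_row R K x h n T $$ (0, k) * A $$ (k, j - 1))"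
    using dims A j by (auto simp: scalar_prod_def atLeast0LessThan intro!: sum.cong)
  also have "\<dots> = (\<Sum>k<n. weight R K x h n T (Suc k) * R (T (Suc k)) (T j))"
    using j by (intro sum.cong refl) (auto simp: weight_def A_def gram_mat_def simp del: upt_Suc)
  also have "\<dots> = (\<Sum>i = 1..n. weight R K x h n T i * R (T i) (T j))"
    by (rule sum.reindex_bij_witness[of _ "\<lambda>i. i - 1" Suc]) auto
  finally show ?thesis
    by simp
qed

subsection \<open>Covariance kernels with a jump on the diagonal\<close>

text \<open>\<open>R11_finite\<close> says that \<open>R11_sup\<close> is a genuine supremum: (A)
  asks for continuity of the mixed derivative off the diagonal only, which does not bound it near
  the diagonal.\<close>

locale covariance = rkhs "{0..1}" R H ip
  for R :: "real \<Rightarrow> real \<Rightarrow> real" and H :: "(real \<Rightarrow> real) set"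
    and ip :: "(real \<Rightarrow> real) \<Rightarrow> (real \<Rightarrow> real) \<Rightarrow> real" +
  assumes A: "assumption_A R" and B: "assumption_B R" and C: "assumption_C R H ip"
    and R11_finite: "bdd_above (abs_R11_values R)"
    and nonsingular: "nonsingular_kernel R"
begin

lemma has_pds:
  assumes "s \<in> {0..1}" "t \<in> {0..1}" "s \<noteq> t"
  shows "(R s has_real_derivative pd2 R s t) (at t within {0..1})"
    and "(pd2 R s has_real_derivative pd2 (pd2 R) s t) (at t within {0..1})"
    and "((\<lambda>u. pd2 R u t) has_real_derivative pd1 (pd2 R) s t) (at s within {0..1})"
proof -
  have "has_pds_at R s t" "has_pds_at (pd2 R) s t"
    using A assms unfolding assumption_A_def off_diag_def by auto
  then show "(R s has_real_derivative pd2 R s t) (at t within {0..1})"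
    and "(pd2 R s has_real_derivative pd2 (pd2 R) s t) (at t within {0..1})"
    and "((\<lambda>u. pd2 R u t) has_real_derivative pd1 (pd2 R) s t) (at s within {0..1})"
    unfolding has_pds_at_def has_real_derivative_iff_has_vector_derivative vector_derivative_works
      pd1_def[of "pd2 R"] pd2_def[of "pd2 R"] pd2_def[of R s t] by simp_all
qed

lemma R_continuous: "continuous_on ({0..1} \<times> {0..1}) (\<lambda>(s, t). R s t)"
  using A by (simp add: assumption_A_def)

lemma R_continuous_snd:
  assumes "s \<in> {0..1}"
  shows "continuous_on {0..1} (R s)"
proof -
  have "continuous_on {0..1} ((\<lambda>(s, t). R s t) \<circ> (\<lambda>t. (s, t)))"
    using assms by (intro continuous_on_compose continuous_intros continuous_on_subset[OF R_continuous]) auto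
  then show ?thesis
    by (simp add: o_def)
qed

abbreviation R1 :: real where
  "R1 \<equiv> R11_sup R"

abbreviation R2 :: real where
  "R2 \<equiv> R02_sup R"

section \<open>Bounds on the kernel and its derivatives\<close>

definition C2 :: real where
  "C2 = (SUP t\<in>{0..1}. hnorm (R02_section R t))"

text \<open>The corners \<open>(1, 0)\<close> and \<open>(0, 1)\<close> are reference points, one in
  each of the two triangles cut out by the diagonal.\<close>

definition M1 :: real where
  "M1 = \<bar>pd2 R 1 0\<bar> + \<bar>pd2 R 0 1\<bar> + R1 + R2"

lemma R11_bound: "s \<in> {0..1} \<Longrightarrow> t \<in> {0..1} \<Longrightarrow> s \<noteq> t \<Longrightarrow> \<bar>pd1 (pd2 R) s t\<bar> \<le> R1"
  unfolding R11_sup_def by (rule cSup_upper[OF _ R11_finite]) (auto simp: abs_R11_values_def off_diag_def)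

lemma R1_nonneg: "0 \<le> R1"
  using R11_bound[of 0 1] by simp

lemma section_mem: "t \<in> {0..1} \<Longrightarrow> R02_section R t \<in> H"
  using C by (simp add: assumption_C_def)

lemma section_norm: "t \<in> {0..1} \<Longrightarrow> hnorm (R02_section R t) \<le> C2"
  unfolding C2_def using C by (intro cSUP_upper) (auto simp: assumption_C_def)

lemma C2_nonneg: "0 \<le> C2"
  using section_norm[of 0] hnorm_nonneg[OF section_mem, of 0] by simp

text \<open>A function of the RKHS is bounded at \<open>s\<close> by its norm times
  \<open>sqrt (R s s)\<close>. The norms of the sections are bounded by (C), and
  \<open>R s s\<close> by continuity.\<close>

lemma R02_bdd: "bdd_above ((\<lambda>(s, t). \<bar>R02p R s t\<bar>) ` ({0..1} \<times> {0..1}))"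
proof -
  have "continuous_on {0..1} ((\<lambda>(s, t). R s t) \<circ> (\<lambda>t. (t, t)))"
    by (intro continuous_on_compose continuous_intros continuous_on_subset[OF R_continuous]) auto
  then have "continuous_on {0..1} (\<lambda>t. R t t)"
    by (simp add: o_def)
  then have "bounded ((\<lambda>t. R t t) ` {0..1})"
    by (intro compact_imp_bounded compact_continuous_image) auto
  then obtain b where b: "\<And>t. t \<in> {0..1} \<Longrightarrow> \<bar>R t t\<bar> \<le> b"
    unfolding bounded_iff by (metis imageI real_norm_def)
  have "\<bar>R02p R s t\<bar> \<le> C2 * sqrt b" if st: "s \<in> {0..1}" "t \<in> {0..1}" for s t
  proof -
    have "\<bar>R02p R s t\<bar> = \<bar>ip (R02_section R t) (ksec s)\<bar>"
      using reproducing[OF st(1) section_mem[OF st(2)]] st by (simp add: on_domain_def)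
    also have "\<dots> \<le> hnorm (R02_section R t) * hnorm (ksec s)"
      by (rule Cauchy_Schwarz[OF section_mem[OF st(2)] ksec_mem[OF st(1)]])
    also have "\<dots> \<le> C2 * sqrt b"
      using st b[of s] C2_nonneg
      by (intro mult_mono section_norm hnorm_nonneg ksec_mem) (auto simp: ip_norm_def ip_ksec)
    finally show ?thesis .
  qed
  then show ?thesis
    by (intro bdd_aboveI[of _ "C2 * sqrt b"]) auto
qed

lemma R02p_bound: "s \<in> {0..1} \<Longrightarrow> t \<in> {0..1} \<Longrightarrow> \<bar>R02p R s t\<bar> \<le> R2"
  unfolding R02_sup_def using cSUP_upper[OF _ R02_bdd, of "(s, t)"] by simp

lemma R2_nonneg: "0 \<le> R2"
  using R02p_bound[of 0 0] by simp

lemma M1_nonneg: "0 \<le> M1"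
  unfolding M1_def using R1_nonneg R2_nonneg by simp

text \<open>A path joins \<open>(s, t)\<close> to the corner of its triangle without meeting the
  diagonal: first \<open>t\<close> moves to the edge at cost \<open>R2\<close>, then
  \<open>s\<close> moves along the edge at cost \<open>R1\<close>.\<close>

lemma pd2_bound:
  assumes "s \<in> {0..1}" "t \<in> {0..1}" "s \<noteq> t"
  shows "\<bar>pd2 R s t\<bar> \<le> M1"
proof -
  have second: "\<bar>pd2 R s b - pd2 R s a\<bar> \<le> R2" if ab: "0 \<le> a" "a \<le> b" "b \<le> 1" "s \<notin> {a..b}" for a b
  proof -
    have "norm (pd2 R s b - pd2 R s a) \<le> R2 * norm (b - a)"
    proof (rule field_differentiable_bound[of "{a..b}" _ "pd2 (pd2 R) s"])
      fix z assume z: "z \<in> {a..b}"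
      then have "(pd2 R s has_real_derivative pd2 (pd2 R) s z) (at z within {0..1})"
        using ab assms(1) by (intro has_pds) auto
      then show "(pd2 R s has_real_derivative pd2 (pd2 R) s z) (at z within {a..b})"
        by (rule has_field_derivative_subset) (use ab in auto)
      show "norm (pd2 (pd2 R) s z) \<le> R2"
        using R02p_bound[of s z] z ab assms(1) by (auto simp: R02p_def split: if_splits)
    qed (use ab in auto)
    also have "\<dots> \<le> R2 * 1"
      using ab R2_nonneg by (intro mult_left_mono) auto
    finally show ?thesis by simp
  qed
  have first: "\<bar>pd2 R b u - pd2 R a u\<bar> \<le> R1"
    if ab: "0 \<le> a" "a \<le> b" "b \<le> 1" "u \<notin> {a..b}" "u \<in> {0..1}" for a b u
  proof -
    have "norm (pd2 R b u - pd2 R a u) \<le> R1 * norm (b - a)"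
    proof (rule field_differentiable_bound[of "{a..b}" _ "\<lambda>z. pd1 (pd2 R) z u"])
      fix z assume z: "z \<in> {a..b}"
      then have "((\<lambda>z. pd2 R z u) has_real_derivative pd1 (pd2 R) z u) (at z within {0..1})"
        using ab by (intro has_pds) auto
      then show "((\<lambda>z. pd2 R z u) has_real_derivative pd1 (pd2 R) z u) (at z within {a..b})"
        by (rule has_field_derivative_subset) (use ab in auto)
      show "norm (pd1 (pd2 R) z u) \<le> R1"
        using R11_bound[of z u] z ab by auto
    qed (use ab in auto)
    also have "\<dots> \<le> R1 * 1"
      using ab R1_nonneg by (intro mult_left_mono) auto
    finally show ?thesis by simp
  qed
  show ?thesis
  proof (cases "t < s")
    case True
    then show ?thesis
      using second[of 0 t] first[of s 1 0] assms unfolding M1_def by auto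
  next
    case False
    then show ?thesis
      using second[of t 1] first[of 0 s 1] assms unfolding M1_def by auto
  qed
qed

text \<open>The kink of \<open>R s\<close> at \<open>s\<close> is harmless because
  \<open>R s\<close> is continuous: an interval around \<open>s\<close> is split there.\<close>

lemma R_lipschitz_snd:
  assumes s: "s \<in> {0..1}" and t: "t \<in> {0..1}" "t' \<in> {0..1}"
  shows "\<bar>R s t - R s t'\<bar> \<le> M1 * \<bar>t - t'\<bar>"
proof -
  have outside: "\<bar>R s b - R s a\<bar> \<le> M1 * (b - a)"
    if "0 \<le> a" "a \<le> b" "b \<le> 1" "s \<notin> {a<..<b}" for a b
  proof (rule deriv_bound_interior[where f' = "pd2 R s"])
    show "continuous_on {a..b} (R s)"
      by (rule continuous_on_subset[OF R_continuous_snd[OF s]]) (use that in auto)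
    fix z assume "a < z" "z < b"
    then show "(R s has_real_derivative pd2 R s z) (at z)" "\<bar>pd2 R s z\<bar> \<le> M1"
      using that s by (auto intro!: real_derivative_at_interior has_pds pd2_bound)
  qed (use that in auto)
  have ordered: "\<bar>R s b - R s a\<bar> \<le> M1 * (b - a)" if ab: "0 \<le> a" "a \<le> b" "b \<le> 1" for a b
  proof (cases "s \<in> {a<..<b}")
    case True
    then have "\<bar>R s s - R s a\<bar> \<le> M1 * (s - a)" "\<bar>R s b - R s s\<bar> \<le> M1 * (b - s)"
      using outside[of a s] outside[of s b] ab by auto
    then show ?thesis
      by (simp add: algebra_simps)
  qed (use outside[OF ab] in auto)
  show ?thesis
    using ordered[of t t'] ordered[of t' t] t by (cases "t \<le> t'") (auto simp: abs_minus_commute)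
qed

text \<open>The condition \<open>b \<le> c\<close> keeps the rectangle with sides
  \<open>{a..b}\<close> and \<open>{c..d}\<close> on one side of the diagonal, so the double
  difference can be differentiated in the second variable and then in the first. No jump enters, and
  the bound is of second order.\<close>

lemma mixed_difference_bound:
  assumes "0 \<le> a" "a \<le> b" "b \<le> c" "c \<le> d" "d \<le> 1"
  shows "\<bar>R b d - R a d - R b c + R a c\<bar> \<le> R1 * (b - a) * (d - c)"
proof -
  have "\<bar>(R b d - R a d) - (R b c - R a c)\<bar> \<le> (R1 * (b - a)) * (d - c)"
  proof (rule deriv_bound_interior[where f = "\<lambda>t. R b t - R a t" and f' = "\<lambda>t. pd2 R b t - pd2 R a t"])
    show "continuous_on {c..d} (\<lambda>t. R b t - R a t)"
      using assms by (intro continuous_intros continuous_on_subset[OF R_continuous_snd]) auto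
    fix t assume t: "c < t" "t < d"
    then show "((\<lambda>t. R b t - R a t) has_real_derivative pd2 R b t - pd2 R a t) (at t)"
      using assms by (intro DERIV_diff real_derivative_at_interior has_pds) auto
    have "norm (pd2 R b t - pd2 R a t) \<le> R1 * norm (b - a)"
    proof (rule field_differentiable_bound[of "{a..b}" _ "\<lambda>z. pd1 (pd2 R) z t"])
      fix z assume z: "z \<in> {a..b}"
      then have "((\<lambda>z. pd2 R z t) has_real_derivative pd1 (pd2 R) z t) (at z within {0..1})"
        using assms t by (intro has_pds) auto
      then show "((\<lambda>z. pd2 R z t) has_real_derivative pd1 (pd2 R) z t) (at z within {a..b})"
        by (rule has_field_derivative_subset) (use assms in auto)
      show "norm (pd1 (pd2 R) z t) \<le> R1"
        using R11_bound[of z t] z assms t by auto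
    qed (use assms in auto)
    then show "\<bar>pd2 R b t - pd2 R a t\<bar> \<le> R1 * (b - a)"
      using assms by simp
  qed (use assms in auto)
  then show ?thesis
    by (simp add: algebra_simps)
qed

section \<open>Increments over disjoint intervals\<close>

definition kdiff :: "real \<Rightarrow> real \<Rightarrow> real \<Rightarrow> real" where
  "kdiff a b = (\<lambda>s. ksec b s + (-1) * ksec a s)"

lemma kdiff_mem: "a \<in> {0..1} \<Longrightarrow> b \<in> {0..1} \<Longrightarrow> kdiff a b \<in> H"
  unfolding kdiff_def by (intro add_mem scale_mem ksec_mem)

lemma ip_kdiff:
  assumes "a \<in> {0..1}" "b \<in> {0..1}" "u \<in> H"
  shows "ip u (kdiff a b) = u b - u a"
proof -
  have "ip u (kdiff a b) = ip (kdiff a b) u"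
    using assms by (intro ip_commute kdiff_mem)
  also have "\<dots> = ip (ksec b) u + (-1) * ip (ksec a) u"
    unfolding kdiff_def using assms
    by (subst ip_add_left) (auto simp only: ksec_mem scale_mem ip_scale_left)
  also have "\<dots> = u b - u a"
    using assms by (simp add: ip_commute[of "ksec _" u] ksec_mem reproducing)
  finally show ?thesis .
qed

lemma ip_kdiff_kdiff:
  assumes "a \<in> {0..1}" "b \<in> {0..1}" "c \<in> {0..1}" "d \<in> {0..1}"
  shows "ip (kdiff a b) (kdiff c d) = R d b - R d a - R c b + R c a"
  using assms by (simp add: ip_kdiff kdiff_mem) (simp add: kdiff_def ksec_apply)

text \<open>The combination of increments of \<open>u\<close> is \<open>ip u v\<close> for a
  combination \<open>v\<close> of kernel increments, so the norm of \<open>v\<close> has to be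
  bounded. In \<open>ip v v\<close> two different intervals interact through a double difference off
  the diagonal, of second order; only an interval with itself gives a term of first order in its
  length. That is why the second sum has squared weights but lengths to the first power.\<close>

lemma increment_combination_bound:
  fixes lo hi w :: "nat \<Rightarrow> real"
  assumes cell: "\<And>i. i < N \<Longrightarrow> 0 \<le> lo i \<and> lo i \<le> hi i \<and> hi i \<le> 1"
    and ord: "\<And>i j. i < j \<Longrightarrow> j < N \<Longrightarrow> hi i \<le> lo j" and u: "u \<in> H"
  shows "\<bar>\<Sum>i<N. w i * (u (hi i) - u (lo i))\<bar> \<le>
    hnorm u * sqrt (R1 * (\<Sum>i<N. \<bar>w i\<bar> * (hi i - lo i))\<^sup>2 + 2 * M1 * (\<Sum>i<N. (w i)\<^sup>2 * (hi i - lo i)))"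
proof -
  define v where "v = (\<lambda>s. \<Sum>i<N. w i * kdiff (lo i) (hi i) s)"
  define \<delta> where "\<delta> i = hi i - lo i" for i
  have mem: "kdiff (lo i) (hi i) \<in> H" if "i \<in> {..<N}" for i
    using cell[of i] that by (intro kdiff_mem) auto
  have v: "v \<in> H"
    unfolding v_def by (intro sum_mem mem) auto
  have pair: "\<bar>ip (kdiff (lo i) (hi i)) (kdiff (lo j) (hi j))\<bar> \<le>
      R1 * \<delta> i * \<delta> j + (if i = j then 2 * M1 * \<delta> i else 0)" if ij: "i < N" "j < N" for i j
  proof -
    have "lo i \<in> {0..1}" "hi i \<in> {0..1}" "lo j \<in> {0..1}" "hi j \<in> {0..1}"
      using cell[OF ij(1)] cell[OF ij(2)] by auto
    note ends = this
    have eq: "ip (kdiff (lo i) (hi i)) (kdiff (lo j) (hi j)) =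
        R (hi j) (hi i) - R (hi j) (lo i) - R (lo j) (hi i) + R (lo j) (lo i)"
      by (rule ip_kdiff_kdiff[OF ends])
    consider "i = j" | "i < j" | "j < i"
      by linarith
    then show ?thesis
    proof cases
      case 1
      \<comment> \<open>The square over this interval is cut by the diagonal, so the Lipschitz bound
        on two sections replaces the bound on the double difference.\<close>
      have "\<bar>R (hi i) (hi i) - R (hi i) (lo i)\<bar> \<le> M1 * \<delta> i" "\<bar>R (lo i) (lo i) - R (lo i) (hi i)\<bar> \<le> M1 * \<delta> i"
        using R_lipschitz_snd[OF ends(2) ends(2) ends(1)] R_lipschitz_snd[OF ends(1) ends(1) ends(2)]
          cell[OF ij(1)] by (auto simp: \<delta>_def)
      moreover have "0 \<le> R1 * \<delta> i * \<delta> i"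
        using R1_nonneg by (simp add: mult.assoc)
      ultimately show ?thesis
        using 1 eq by simp
    next
      case 2
      have "\<bar>R (hi i) (hi j) - R (lo i) (hi j) - R (hi i) (lo j) + R (lo i) (lo j)\<bar> \<le> R1 * \<delta> i * \<delta> j"
        using mixed_difference_bound[of "lo i" "hi i" "lo j" "hi j"] cell[OF ij(1)] cell[OF ij(2)]
          ord[OF 2 ij(2)] by (simp add: \<delta>_def)
      then show ?thesis
        using 2 eq kernel_commute ends by simp
    next
      case 3
      have "\<bar>R (hi j) (hi i) - R (lo j) (hi i) - R (hi j) (lo i) + R (lo j) (lo i)\<bar> \<le> R1 * \<delta> j * \<delta> i"
        using mixed_difference_bound[of "lo j" "hi j" "lo i" "hi i"] cell[OF ij(1)] cell[OF ij(2)]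
          ord[OF 3 ij(1)] by (simp add: \<delta>_def)
      then show ?thesis
        using 3 eq by (simp add: algebra_simps)
    qed
  qed
  have summand: "w i * (w j * ip (kdiff (lo i) (hi i)) (kdiff (lo j) (hi j))) \<le>
      R1 * ((\<bar>w i\<bar> * \<delta> i) * (\<bar>w j\<bar> * \<delta> j)) + (if i = j then 2 * M1 * ((w i)\<^sup>2 * \<delta> i) else 0)"
    if ij: "i < N" "j < N" for i j
  proof -
    have "w i * (w j * ip (kdiff (lo i) (hi i)) (kdiff (lo j) (hi j))) \<le>
        (\<bar>w i\<bar> * \<bar>w j\<bar>) * \<bar>ip (kdiff (lo i) (hi i)) (kdiff (lo j) (hi j))\<bar>"
      by (metis abs_ge_self abs_mult mult.assoc)
    also have "\<dots> \<le> (\<bar>w i\<bar> * \<bar>w j\<bar>) * (R1 * \<delta> i * \<delta> j + (if i = j then 2 * M1 * \<delta> i else 0))"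
      by (intro mult_left_mono pair ij) auto
    also have "\<dots> = R1 * ((\<bar>w i\<bar> * \<delta> i) * (\<bar>w j\<bar> * \<delta> j)) + (if i = j then 2 * M1 * ((w i)\<^sup>2 * \<delta> i) else 0)"
      by (auto simp: algebra_simps power2_eq_square)
    finally show ?thesis .
  qed
  have "ip v v = (\<Sum>i<N. w i * ip (kdiff (lo i) (hi i)) v)"
    using ip_sum_left[of "{..<N}" "\<lambda>i. kdiff (lo i) (hi i)" v w] mem v by (simp add: v_def[symmetric])
  also have "\<dots> = (\<Sum>i<N. \<Sum>j<N. w i * (w j * ip (kdiff (lo i) (hi i)) (kdiff (lo j) (hi j))))"
    unfolding v_def
    by (intro sum.cong refl, subst ip_sum_right) (auto simp: mem sum_distrib_left)
  also have "\<dots> \<le> (\<Sum>i<N. \<Sum>j<N. R1 * ((\<bar>w i\<bar> * \<delta> i) * (\<bar>w j\<bar> * \<delta> j)) +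
      (if i = j then 2 * M1 * ((w i)\<^sup>2 * \<delta> i) else 0))"
    by (intro sum_mono summand) auto
  also have "\<dots> = R1 * (\<Sum>i<N. \<bar>w i\<bar> * \<delta> i)\<^sup>2 + 2 * M1 * (\<Sum>i<N. (w i)\<^sup>2 * \<delta> i)"
    unfolding power2_eq_square[of "sum _ _"] sum_product
    by (simp add: sum.distrib sum_distrib_left)
  finally have "hnorm v \<le> sqrt (R1 * (\<Sum>i<N. \<bar>w i\<bar> * \<delta> i)\<^sup>2 + 2 * M1 * (\<Sum>i<N. (w i)\<^sup>2 * \<delta> i))"
    unfolding ip_norm_def by (rule real_sqrt_le_mono)
  moreover have "(\<Sum>i<N. w i * (u (hi i) - u (lo i))) = ip u v"
  proof -
    have "ip u v = (\<Sum>i<N. w i * ip u (kdiff (lo i) (hi i)))"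
      unfolding v_def by (rule ip_sum_right) (use mem u in auto)
    also have "\<dots> = (\<Sum>i<N. w i * (u (hi i) - u (lo i)))"
    proof (intro sum.cong refl)
      fix i assume "i \<in> {..<N}"
      then have "lo i \<in> {0..1}" "hi i \<in> {0..1}"
        using cell[of i] by auto
      then show "w i * ip u (kdiff (lo i) (hi i)) = w i * (u (hi i) - u (lo i))"
        by (simp add: ip_kdiff u)
    qed
    finally show ?thesis by simp
  qed
  ultimately show ?thesis
    unfolding \<delta>_def
    by (metis (no_types, lifting) Cauchy_Schwarz[OF u v] mult_left_mono[OF _ hnorm_nonneg[OF u]] order_trans)
qed

section \<open>One-sided limits on the diagonal and integration by parts\<close>

lemma diag_limits:
  shows diag_left_tendsto: "s \<in> {0<..1} \<Longrightarrow> (pd2 R s \<longlongrightarrow> diag_left (pd2 R) s) (at_left s)"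
    and diag_right_tendsto: "s \<in> {0..<1} \<Longrightarrow> (pd2 R s \<longlongrightarrow> diag_right (pd2 R) s) (at_right s)"
proof -
  have "continuous_diag_limits (pd2 R)"
    using A by (simp add: assumption_A_def)
  then have left: "\<forall>t\<in>{0<..1}. \<exists>l. (pd2 R t \<longlongrightarrow> l) (at_left t)"
    and right: "\<forall>t\<in>{0..<1}. \<exists>l. (pd2 R t \<longlongrightarrow> l) (at_right t)"
    unfolding continuous_diag_limits_def by - (elim conjE, assumption)+
  show "(pd2 R s \<longlongrightarrow> diag_left (pd2 R) s) (at_left s)" if s: "s \<in> {0<..1}"
  proof -
    obtain l where "(pd2 R s \<longlongrightarrow> l) (at_left s)"
      using bspec[OF left s] by (rule exE)
    moreover from this have "diag_left (pd2 R) s = l"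
      unfolding diag_left_def by (intro tendsto_Lim) auto
    ultimately show ?thesis by simp
  qed
  show "(pd2 R s \<longlongrightarrow> diag_right (pd2 R) s) (at_right s)" if s: "s \<in> {0..<1}"
  proof -
    obtain l where "(pd2 R s \<longlongrightarrow> l) (at_right s)"
      using bspec[OF right s] by (rule exE)
    moreover from this have "diag_right (pd2 R) s = l"
      unfolding diag_right_def by (intro tendsto_Lim) auto
    ultimately show ?thesis by simp
  qed
qed

lemma pd2_continuous_off_diag:
  assumes "s \<in> {0..1}" "S \<subseteq> {0..1} - {s}"
  shows "continuous_on S (pd2 R s)"
proof (rule DERIV_continuous_on)
  fix t assume "t \<in> S"
  then have "(pd2 R s has_real_derivative pd2 (pd2 R) s t) (at t within {0..1})"
    using assms by (intro has_pds) auto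
  then show "(pd2 R s has_real_derivative pd2 (pd2 R) s t) (at t within S)"
    by (rule has_field_derivative_subset) (use assms in auto)
qed

text \<open>The value \<open>pd2 R s s\<close> is replaced by the one-sided limit, since
  \<open>R s\<close> need not be differentiable at \<open>s\<close>.\<close>

lemma pd2_continuous_left:
  assumes "s \<in> {0<..1}"
  shows "continuous_on {0..s} ((pd2 R s)(s := diag_left (pd2 R) s))"
  using assms by (intro continuous_on_extend_left diag_left_tendsto pd2_continuous_off_diag) auto

lemma pd2_continuous_right:
  assumes "s \<in> {0..<1}"
  shows "continuous_on {s..1} ((pd2 R s)(s := diag_right (pd2 R) s))"
  using assms by (intro continuous_on_extend_right diag_right_tendsto pd2_continuous_off_diag) auto

lemma pd2_times_integrable:
  assumes s: "s \<in> {0..1}" and w: "continuous_on {0..1} w"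
  shows "(\<lambda>t. pd2 R s t * w t) integrable_on {0..1}"
proof (rule Henstock_Kurzweil_Integration.integrable_combine[of 0 s])
  show "(\<lambda>t. pd2 R s t * w t) integrable_on {0..s}"
  proof (cases "s = 0")
    case False
    then have "continuous_on {0..s} (\<lambda>t. ((pd2 R s)(s := diag_left (pd2 R) s)) t * w t)"
      using s by (intro continuous_intros pd2_continuous_left continuous_on_subset[OF w]) auto
    then have "(\<lambda>t. ((pd2 R s)(s := diag_left (pd2 R) s)) t * w t) integrable_on {0..s}"
      by (rule integrable_continuous_real)
    then show ?thesis
      by (rule integrable_spike_finite[of "{s}", rotated 2]) auto
  qed (use integrable_on_refl[of _ s] in simp)
  show "(\<lambda>t. pd2 R s t * w t) integrable_on {s..1}"
  proof (cases "s = 1")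
    case False
    then have "continuous_on {s..1} (\<lambda>t. ((pd2 R s)(s := diag_right (pd2 R) s)) t * w t)"
      using s by (intro continuous_intros pd2_continuous_right continuous_on_subset[OF w]) auto
    then have "(\<lambda>t. ((pd2 R s)(s := diag_right (pd2 R) s)) t * w t) integrable_on {s..1}"
      by (rule integrable_continuous_real)
    then show ?thesis
      by (rule integrable_spike_finite[of "{s}", rotated 2]) auto
  qed (use integrable_on_refl[of _ s] in simp)
qed (use s in auto)

lemma pd2_has_integral:
  assumes "s \<in> {0..1}" "0 \<le> a" "a \<le> b" "b \<le> 1"
  shows "(pd2 R s has_integral (R s b - R s a)) {a..b}"
proof (rule fundamental_theorem_of_calculus_interior_strong[of "{s}"])
  show "continuous_on {a..b} (R s)"
    by (rule continuous_on_subset[OF R_continuous_snd]) (use assms in auto)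
  show "(R s has_vector_derivative pd2 R s t) (at t)" if "t \<in> {a<..<b} - {s}" for t
    using that assms
    by (auto simp: has_real_derivative_iff_has_vector_derivative[symmetric]
        intro!: real_derivative_at_interior has_pds)
qed (use assms in auto)

lemma R02p_off_diag: "s \<noteq> t \<Longrightarrow> R02p R s t = pd2 (pd2 R) s t"
  by (simp add: R02p_def)

context
  fixes W w :: "real \<Rightarrow> real"
  assumes W: "\<And>t. t \<in> {0..1} \<Longrightarrow> (W has_real_derivative w t) (at t)"
    and w: "continuous_on {0..1} w"
begin

lemma W_continuous: "continuous_on {0..1} W"
  using W by (meson DERIV_isCont continuous_at_imp_continuous_on)

text \<open>The value \<open>l\<close> is arbitrary because only \<open>t \<noteq> s\<close> is
  considered; the formula serves the left and the right limit alike.\<close>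

lemma product_deriv:
  assumes s: "s \<in> {0..1}" and t: "t \<in> {0<..<1}" "t \<noteq> s"
  shows "((\<lambda>t. ((pd2 R s)(s := l)) t * W t) has_vector_derivative
    R02p R s t * W t + pd2 R s t * w t) (at t)"
proof -
  have "(pd2 R s has_real_derivative pd2 (pd2 R) s t) (at t)"
    using s t by (intro real_derivative_at_interior has_pds) auto
  then have "((pd2 R s)(s := l) has_real_derivative pd2 (pd2 R) s t) (at t)"
    by (rule has_field_derivative_transform_within_open[of _ _ _ "- {s}"]) (use t in auto)
  then have "((\<lambda>t. ((pd2 R s)(s := l)) t * W t) has_real_derivative
      pd2 (pd2 R) s t * W t + w t * ((pd2 R s)(s := l)) t) (at t)"
    by (rule DERIV_mult) (use W t in auto)
  then show ?thesis
    using t by (simp add: R02p_off_diag has_real_derivative_iff_has_vector_derivative mult.commute)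
qed

lemma by_parts_left:
  assumes "s \<in> {0<..1}"
  shows "((\<lambda>t. R02p R s t * W t + pd2 R s t * w t) has_integral
    (diag_left (pd2 R) s * W s - pd2 R s 0 * W 0)) {0..s}"
proof -
  let ?f = "\<lambda>t. ((pd2 R s)(s := diag_left (pd2 R) s)) t * W t"
  have "((\<lambda>t. R02p R s t * W t + pd2 R s t * w t) has_integral (?f s - ?f 0)) {0..s}"
  proof (rule fundamental_theorem_of_calculus_interior_strong[of "{}"])
    show "continuous_on {0..s} ?f"
      using assms by (intro continuous_intros pd2_continuous_left continuous_on_subset[OF W_continuous]) auto
    show "(?f has_vector_derivative R02p R s t * W t + pd2 R s t * w t) (at t)"
      if "t \<in> {0<..<s} - {}" for t
      using that assms by (intro product_deriv) auto
  qed (use assms in auto)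
  then show ?thesis
    using assms by simp
qed

lemma by_parts_right:
  assumes "s \<in> {0..<1}"
  shows "((\<lambda>t. R02p R s t * W t + pd2 R s t * w t) has_integral
    (pd2 R s 1 * W 1 - diag_right (pd2 R) s * W s)) {s..1}"
proof -
  let ?f = "\<lambda>t. ((pd2 R s)(s := diag_right (pd2 R) s)) t * W t"
  have "((\<lambda>t. R02p R s t * W t + pd2 R s t * w t) has_integral (?f 1 - ?f s)) {s..1}"
  proof (rule fundamental_theorem_of_calculus_interior_strong[of "{}"])
    show "continuous_on {s..1} ?f"
      using assms by (intro continuous_intros pd2_continuous_right continuous_on_subset[OF W_continuous]) auto
    show "(?f has_vector_derivative R02p R s t * W t + pd2 R s t * w t) (at t)"
      if "t \<in> {s<..<1} - {}" for t
      using that assms by (intro product_deriv) auto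
  qed (use assms in auto)
  then show ?thesis
    using assms by simp
qed

end

text \<open>\<open>R\<^sup>(\<^sup>0\<^sup>,\<^sup>1\<^sup>)(\<cdot>, 0)\<close> and \<open>R\<^sup>(\<^sup>0\<^sup>,\<^sup>1\<^sup>)(\<cdot>, 1)\<close>, with the value at the corner that lets one formula
  for integration by parts hold up to the end points.\<close>

definition edge0 :: "real \<Rightarrow> real" where
  "edge0 s = (if s = 0 then diag_right (pd2 R) 0 + alpha R 0 else pd2 R s 0)"

definition edge1 :: "real \<Rightarrow> real" where
  "edge1 s = (if s = 1 then diag_left (pd2 R) 1 - alpha R 1 else pd2 R s 1)"

text \<open>The halves \<open>{0..s}\<close> and \<open>{s..1}\<close> contribute boundary terms at
  \<open>s\<close> with different one-sided limits of \<open>pd2 R s\<close>, and the difference of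
  these limits is \<open>alpha R s\<close>. If \<open>s\<close> is 0 or 1, only one half exists, and
  the corner value of \<open>edge0\<close> or \<open>edge1\<close> cancels the term in
  \<open>alpha R s\<close>.\<close>

lemma by_parts:
  assumes W: "\<And>t. t \<in> {0..1} \<Longrightarrow> (W has_real_derivative w t) (at t)"
    and w: "continuous_on {0..1} w" and s: "s \<in> {0..1}"
  shows "((\<lambda>t. R02p R s t * W t + pd2 R s t * w t) has_integral
    (alpha R s * W s + edge1 s * W 1 - edge0 s * W 0)) {0..1}"
proof -
  consider "s = 0" | "s = 1" | "0 < s" "s < 1"
    using s by fastforce
  then show ?thesis
  proof cases
    case 1
    then show ?thesis
      using by_parts_right[OF W w, of 0] by (simp add: edge0_def edge1_def algebra_simps)
  next
    case 2
    then show ?thesis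
      using by_parts_left[OF W w, of 1] by (simp add: edge0_def edge1_def algebra_simps)
  next
    case 3
    then have "((\<lambda>t. R02p R s t * W t + pd2 R s t * w t) has_integral
      ((diag_left (pd2 R) s * W s - pd2 R s 0 * W 0) +
       (pd2 R s 1 * W 1 - diag_right (pd2 R) s * W s))) {0..1}"
      by (intro has_integral_combine[of 0 s] by_parts_left by_parts_right W w) auto
    then show ?thesis
      using 3 by (simp add: alpha_def jump_def edge0_def edge1_def algebra_simps)
  qed
qed

section \<open>Integrals that are bounded on kernel sums\<close>

text \<open>These are Stieltjes sums of \<open>w\<close> against \<open>R s\<close>, whose
  derivative is \<open>pd2 R s\<close>. They express the integral through increments of the kernel,
  to which \<open>increment_combination_bound\<close> applies.\<close>

lemma pd2_Riemann_sums:
  assumes s: "s \<in> {0..1}" and w: "continuous_on {0..1} w"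
  shows "(\<lambda>n. \<Sum>i<Suc n. w (real i / real (Suc n)) *
      (R s (real (Suc i) / real (Suc n)) - R s (real i / real (Suc n))))
    \<longlonglongrightarrow> integral {0..1} (\<lambda>t. pd2 R s t * w t)"
proof (rule LIMSEQ_I)
  fix e :: real assume e: "0 < e"
  \<comment> \<open>Chosen so that \<open>M1 * e' < e\<close>, also when
    \<open>M1 = 0\<close>.\<close>
  define e' where "e' = e / (2 * (M1 + 1))"
  have e': "0 < e'"
    using e M1_nonneg by (simp add: e'_def)
  have "uniformly_continuous_on {0..1} w"
    using w by (rule compact_uniformly_continuous) simp
  then obtain d where d: "0 < d"
    "\<And>a b. a \<in> {0..1} \<Longrightarrow> b \<in> {0..1} \<Longrightarrow> dist b a < d \<Longrightarrow> dist (w b) (w a) < e'"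
    unfolding uniformly_continuous_on_def using e' by meson
  obtain n0 where n0: "inverse (real (Suc n0)) < d"
    using reals_Archimedean[OF d(1)] by blast
  show "\<exists>no. \<forall>n\<ge>no. norm ((\<Sum>i<Suc n. w (real i / real (Suc n)) *
      (R s (real (Suc i) / real (Suc n)) - R s (real i / real (Suc n))))
      - integral {0..1} (\<lambda>t. pd2 R s t * w t)) < e"
  proof (intro exI allI impI)
    fix n assume n: "n0 \<le> n"
    define N where "N = Suc n"
    define \<tau> where "\<tau> i = real i / real N" for i
    have N: "0 < real N"
      by (simp add: N_def)
    have step: "\<tau> (Suc i) - \<tau> i = 1 / real N" for i
      by (simp add: \<tau>_def diff_divide_distrib[symmetric])
    have "1 / real N \<le> 1 / real (Suc n0)"
      using n by (simp add: N_def frac_le)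
    then have small: "1 / real N < d"
      using n0 by (simp add: inverse_eq_divide)
    have mono: "\<tau> i \<le> \<tau> (Suc i)" for i
      using step[of i] N by (smt (verit) divide_nonneg_nonneg)
    have ends: "\<tau> 0 = 0" "\<tau> N = 1"
      using N by (auto simp: \<tau>_def)
    have range: "0 \<le> \<tau> i" "i \<le> N \<Longrightarrow> \<tau> i \<le> 1" for i
      using N by (auto simp: \<tau>_def)
    have int: "(\<lambda>t. pd2 R s t * w t) integrable_on {0..1}"
      by (rule pd2_times_integrable[OF s w])
    have split: "integral {0..1} (\<lambda>t. pd2 R s t * w t) =
        (\<Sum>i<N. integral {\<tau> i..\<tau> (Suc i)} (\<lambda>t. pd2 R s t * w t))"
      using integrable_on_cells[of N \<tau> "\<lambda>t. pd2 R s t * w t"] mono int ends by simp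
    have cell: "\<bar>w (\<tau> i) * (R s (\<tau> (Suc i)) - R s (\<tau> i)) -
        integral {\<tau> i..\<tau> (Suc i)} (\<lambda>t. pd2 R s t * w t)\<bar> \<le> M1 * e' * (1 / real N)" if i: "i < N" for i
    proof -
      have r: "0 \<le> \<tau> i" "\<tau> (Suc i) \<le> 1"
        using range[of i] range[of "Suc i"] i by auto
      have "((\<lambda>t. w (\<tau> i) * pd2 R s t) has_integral w (\<tau> i) * (R s (\<tau> (Suc i)) - R s (\<tau> i)))
          {\<tau> i..\<tau> (Suc i)}"
        using r mono[of i] s by (intro has_integral_mult_right pd2_has_integral)
      moreover have "((\<lambda>t. pd2 R s t * w t) has_integral
          integral {\<tau> i..\<tau> (Suc i)} (\<lambda>t. pd2 R s t * w t)) {\<tau> i..\<tau> (Suc i)}"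
        using r by (intro integrable_integral integrable_on_subinterval[OF int]) auto
      ultimately have "((\<lambda>t. w (\<tau> i) * pd2 R s t - pd2 R s t * w t) has_integral
          (w (\<tau> i) * (R s (\<tau> (Suc i)) - R s (\<tau> i)) -
           integral {\<tau> i..\<tau> (Suc i)} (\<lambda>t. pd2 R s t * w t))) {\<tau> i..\<tau> (Suc i)}"
        by (rule has_integral_diff)
      then have "\<bar>w (\<tau> i) * (R s (\<tau> (Suc i)) - R s (\<tau> i)) -
           integral {\<tau> i..\<tau> (Suc i)} (\<lambda>t. pd2 R s t * w t)\<bar> \<le> (M1 * e') * (\<tau> (Suc i) - \<tau> i)"
      proof (rule has_integral_abs_bound[where S = "{s}"])
        fix t assume t: "t \<in> {\<tau> i..\<tau> (Suc i)} - {s}"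
        have "dist (w (\<tau> i)) (w t) < e'"
          using t r step[of i] small by (intro d(2)) (auto simp: dist_real_def)
        then have "\<bar>pd2 R s t\<bar> * \<bar>w (\<tau> i) - w t\<bar> \<le> M1 * e'"
          using t r s M1_nonneg by (intro mult_mono pd2_bound) (auto simp: dist_real_def)
        then show "\<bar>w (\<tau> i) * pd2 R s t - pd2 R s t * w t\<bar> \<le> M1 * e'"
          by (simp add: abs_mult[symmetric] algebra_simps)
      qed (use M1_nonneg e' mono[of i] in auto)
      then show ?thesis
        by (simp add: step)
    qed
    have "\<bar>(\<Sum>i<N. w (\<tau> i) * (R s (\<tau> (Suc i)) - R s (\<tau> i))) -
        integral {0..1} (\<lambda>t. pd2 R s t * w t)\<bar> \<le> (\<Sum>i<N. M1 * e' * (1 / real N))"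
      unfolding split sum_subtractf[symmetric]
      by (intro order.trans[OF sum_abs] sum_mono cell) auto
    also have "\<dots> = M1 * e'"
      using N by simp
    also have "\<dots> < e"
      using e M1_nonneg unfolding e'_def by (simp add: field_simps add_nonneg_pos)
    finally show "norm ((\<Sum>i<Suc n. w (real i / real (Suc n)) *
      (R s (real (Suc i) / real (Suc n)) - R s (real i / real (Suc n))))
      - integral {0..1} (\<lambda>t. pd2 R s t * w t)) < e"
      by (simp add: \<tau>_def N_def)
  qed
qed

lemma ksum_apply': "t \<in> {0..1} \<Longrightarrow> S \<subseteq> {0..1} \<Longrightarrow> ksum S c t = (\<Sum>s\<in>S. c s * R s t)"
  unfolding ksum_apply by (intro sum.cong refl) (auto simp: kernel_commute[of t])

text \<open>Summed against coefficients \<open>c\<close>, a Stieltjes sum becomes a combination of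
  increments of \<open>ksum S c\<close> with weights \<open>w (\<tau> i)\<close>. On the uniform
  grid the squared sum and the sum of squares both stay below \<open>L\<^sup>2\<close>, whatever the
  number of cells, so the bound passes to the integral.\<close>

lemma eval_bounded_pd2_integral:
  assumes w: "continuous_on {0..1} w" and L: "\<And>t. t \<in> {0..1} \<Longrightarrow> \<bar>w t\<bar> \<le> L"
  shows "eval_bounded (sqrt ((R1 + 2 * M1) * L\<^sup>2)) (\<lambda>s. integral {0..1} (\<lambda>t. pd2 R s t * w t))"
proof (rule eval_bounded_limit[OF _ pd2_Riemann_sums[OF _ w]])
  fix n
  define N where "N = Suc n"
  define \<tau> where "\<tau> i = real i / real N" for i
  have N: "0 < real N"
    by (simp add: N_def)
  have step: "\<tau> (Suc i) - \<tau> i = 1 / real N" for i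
    by (simp add: \<tau>_def diff_divide_distrib[symmetric])
  have range: "0 \<le> \<tau> i" "i \<le> N \<Longrightarrow> \<tau> i \<le> 1" for i
    using N by (auto simp: \<tau>_def)
  have mono: "i \<le> j \<Longrightarrow> \<tau> i \<le> \<tau> j" for i j
    using N by (simp add: \<tau>_def divide_right_mono)
  have L0: "0 \<le> L"
    using L[of 0] by force
  have "(\<Sum>i<N. \<bar>w (\<tau> i)\<bar> * (\<tau> (Suc i) - \<tau> i)) \<le> (\<Sum>i<N. L * (1 / real N))"
    unfolding step using range by (intro sum_mono mult_right_mono L) auto
  then have "(\<Sum>i<N. \<bar>w (\<tau> i)\<bar> * (\<tau> (Suc i) - \<tau> i))\<^sup>2 \<le> L\<^sup>2"
    using N by (intro power_mono sum_nonneg) (auto simp: step)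
  then have 1: "R1 * (\<Sum>i<N. \<bar>w (\<tau> i)\<bar> * (\<tau> (Suc i) - \<tau> i))\<^sup>2 \<le> R1 * L\<^sup>2"
    using R1_nonneg by (intro mult_left_mono) auto
  have "(\<Sum>i<N. (w (\<tau> i))\<^sup>2 * (\<tau> (Suc i) - \<tau> i)) \<le> (\<Sum>i<N. L\<^sup>2 * (1 / real N))"
    unfolding step using range L0
    by (intro sum_mono mult_right_mono) (auto simp: L abs_le_square_iff[symmetric])
  then have 2: "2 * M1 * (\<Sum>i<N. (w (\<tau> i))\<^sup>2 * (\<tau> (Suc i) - \<tau> i)) \<le> 2 * M1 * L\<^sup>2"
    using M1_nonneg N by (intro mult_left_mono) auto
  have main: "\<bar>\<Sum>i<N. w (\<tau> i) * (u (\<tau> (Suc i)) - u (\<tau> i))\<bar> \<le> sqrt ((R1 + 2 * M1) * L\<^sup>2) * hnorm u"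
    if u: "u \<in> H" for u
  proof -
    have "\<bar>\<Sum>i<N. w (\<tau> i) * (u (\<tau> (Suc i)) - u (\<tau> i))\<bar> \<le>
        hnorm u * sqrt (R1 * (\<Sum>i<N. \<bar>w (\<tau> i)\<bar> * (\<tau> (Suc i) - \<tau> i))\<^sup>2 +
          2 * M1 * (\<Sum>i<N. (w (\<tau> i))\<^sup>2 * (\<tau> (Suc i) - \<tau> i)))"
      using range mono u
      by (intro increment_combination_bound[where hi = "\<lambda>i. \<tau> (Suc i)" and w = "\<lambda>i. w (\<tau> i)"]) auto
    also have "\<dots> \<le> hnorm u * sqrt ((R1 + 2 * M1) * L\<^sup>2)"
      using 1 2 u by (intro mult_left_mono real_sqrt_le_mono hnorm_nonneg) (auto simp: algebra_simps)
    finally show ?thesis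
      by (simp add: mult.commute)
  qed
  show "eval_bounded (sqrt ((R1 + 2 * M1) * L\<^sup>2)) (\<lambda>s. \<Sum>i<Suc n. w (real i / real (Suc n)) *
      (R s (real (Suc i) / real (Suc n)) - R s (real i / real (Suc n))))"
    unfolding eval_bounded_def N_def[symmetric] \<tau>_def[symmetric]
  proof (intro allI impI)
    fix S c assume S: "finite S" "S \<subseteq> {0..1::real}"
    have "(\<Sum>s\<in>S. c s * (\<Sum>i<N. w (\<tau> i) * (R s (\<tau> (Suc i)) - R s (\<tau> i)))) =
        (\<Sum>i<N. w (\<tau> i) * (\<Sum>s\<in>S. c s * (R s (\<tau> (Suc i)) - R s (\<tau> i))))"
      unfolding sum_distrib_left by (subst sum.swap) (simp add: mult_ac)
    also have "\<dots> = (\<Sum>i<N. w (\<tau> i) * (ksum S c (\<tau> (Suc i)) - ksum S c (\<tau> i)))"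
      using range S
      by (intro sum.cong refl) (simp add: ksum_apply' sum_subtractf[symmetric] right_diff_distrib)
    finally show "\<bar>\<Sum>s\<in>S. c s * (\<Sum>i<N. w (\<tau> i) * (R s (\<tau> (Suc i)) - R s (\<tau> i)))\<bar> \<le>
        sqrt ((R1 + 2 * M1) * L\<^sup>2) * hnorm (ksum S c)"
      using main[OF ksum_mem[OF S], of c] by simp
  qed
qed

text \<open>For fixed \<open>c\<close> the finite sum moves under the integral. For each
  \<open>t\<close> it is then \<open>W t\<close> times the inner product of the section at
  \<open>t\<close> with \<open>ksum S c\<close>, which (C) controls uniformly in
  \<open>t\<close>.\<close>

lemma eval_bounded_R02_integral:
  assumes int: "\<And>s. s \<in> {0..1} \<Longrightarrow> (\<lambda>t. R02p R s t * W t) integrable_on {0..1}"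
    and W: "\<And>t. t \<in> {0..1} \<Longrightarrow> \<bar>W t\<bar> \<le> b"
  shows "eval_bounded (C2 * b) (\<lambda>s. integral {0..1} (\<lambda>t. R02p R s t * W t))"
  unfolding eval_bounded_def
proof (intro allI impI)
  fix S c assume S: "finite S" "S \<subseteq> {0..1::real}"
  have b: "0 \<le> b"
    using W[of 0] by force
  have "((\<lambda>t. \<Sum>s\<in>S. c s * (R02p R s t * W t)) has_integral
      (\<Sum>s\<in>S. c s * integral {0..1} (\<lambda>t. R02p R s t * W t))) {0..1}"
    using S by (intro has_integral_sum has_integral_mult_right integrable_integral int) auto
  then have "\<bar>\<Sum>s\<in>S. c s * integral {0..1} (\<lambda>t. R02p R s t * W t)\<bar> \<le>
      (C2 * b * hnorm (ksum S c)) * (1 - 0)"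
  proof (rule has_integral_abs_bound[where S = "{}"])
    show "0 \<le> C2 * b * hnorm (ksum S c)"
      using b C2_nonneg hnorm_nonneg[OF ksum_mem[OF S]] by simp
    fix t :: real assume "t \<in> {0..1} - {}"
    then have t: "t \<in> {0..1}"
      by simp
    have "(\<Sum>s\<in>S. c s * (R02p R s t * W t)) = (\<Sum>s\<in>S. c s * R02_section R t s) * W t"
      unfolding sum_distrib_right using S by (intro sum.cong) (auto simp: on_domain_def)
    also have "\<dots> = ip (R02_section R t) (ksum S c) * W t"
      using ip_ksum[OF S section_mem[OF t]] by simp
    finally have "\<bar>\<Sum>s\<in>S. c s * (R02p R s t * W t)\<bar> =
        \<bar>ip (R02_section R t) (ksum S c)\<bar> * \<bar>W t\<bar>"
      by (simp add: abs_mult)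
    also have "\<dots> \<le> (C2 * hnorm (ksum S c)) * b"
    proof (intro mult_mono W t)
      have "\<bar>ip (R02_section R t) (ksum S c)\<bar> \<le> hnorm (R02_section R t) * hnorm (ksum S c)"
        by (rule Cauchy_Schwarz[OF section_mem[OF t] ksum_mem[OF S]])
      also have "\<dots> \<le> C2 * hnorm (ksum S c)"
        using t S by (intro mult_right_mono section_norm hnorm_nonneg ksum_mem)
      finally show "\<bar>ip (R02_section R t) (ksum S c)\<bar> \<le> C2 * hnorm (ksum S c)" .
    qed (use C2_nonneg hnorm_nonneg[OF ksum_mem[OF S]] in auto)
    finally show "\<bar>\<Sum>s\<in>S. c s * (R02p R s t * W t)\<bar> \<le> C2 * b * hnorm (ksum S c)"
      by (simp add: mult_ac)
  qed auto
  then show "\<bar>\<Sum>s\<in>S. c s * integral {0..1} (\<lambda>t. R02p R s t * W t)\<bar> \<le> C2 * b * hnorm (ksum S c)"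
    by simp
qed

text \<open>For a smooth \<open>W\<close> in place of \<open>G\<close>, \<open>by_parts\<close>
  writes the function as a sum of the two integrals bounded above. The smooth approximations of
  \<open>G\<close> all have derivatives bounded by \<open>L\<close>, so one constant serves them all
  and survives the pointwise limit.\<close>

lemma eval_bounded_by_parts:
  assumes G: "L-lipschitz_on {0..1} G" and b: "\<And>t. t \<in> {0..1} \<Longrightarrow> \<bar>G t\<bar> \<le> b"
  shows "eval_bounded (C2 * (b + L) + sqrt ((R1 + 2 * M1) * L\<^sup>2))
    (\<lambda>s. alpha R s * G s + edge1 s * G 1 - edge0 s * G 0)"
proof -
  have L: "0 \<le> L"
    using G by (rule lipschitz_on_nonneg)
  have "\<exists>W w. (\<forall>t\<in>{0..1}. (W has_real_derivative w t) (at t)) \<and> continuous_on {0..1} w \<and>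
      (\<forall>t\<in>{0..1}. \<bar>w t\<bar> \<le> L) \<and> (\<forall>t\<in>{0..1}. \<bar>W t - G t\<bar> \<le> L * inverse (real (Suc n)))" for n
  proof -
    have "0 < inverse (real (Suc n))" "inverse (real (Suc n)) \<le> 1"
      by (auto simp: field_simps)
    from lipschitz_C1_approximation[OF G this] show ?thesis .
  qed
  then obtain W w where W: "\<And>n t. t \<in> {0..1} \<Longrightarrow> (W n has_real_derivative w n t) (at t)"
    and w: "\<And>n. continuous_on {0..1} (w n)" "\<And>n t. t \<in> {0..1} \<Longrightarrow> \<bar>w n t\<bar> \<le> L"
    and near: "\<And>n t. t \<in> {0..1} \<Longrightarrow> \<bar>W n t - G t\<bar> \<le> L * inverse (real (Suc n))"
    by metis
  have conv: "(\<lambda>n. W n t) \<longlonglongrightarrow> G t" if "t \<in> {0..1}" for t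
  proof (rule LIMSEQ_I)
    fix r :: real assume r: "0 < r"
    then obtain n0 where n0: "inverse (real (Suc n0)) < r / (L + 1)"
      using L reals_Archimedean[of "r / (L + 1)"] by auto
    have "norm (W n t - G t) < r" if "n0 \<le> n" for n
    proof -
      have "inverse (real (Suc n)) \<le> inverse (real (Suc n0))"
        using that by (simp add: field_simps)
      then have "L * inverse (real (Suc n)) \<le> L * (r / (L + 1))"
        using L n0 by (intro mult_left_mono order.trans[OF _ less_imp_le[OF n0]])
      also have "\<dots> < r"
        using L r by (simp add: field_simps)
      finally show ?thesis
        using near[of t n] \<open>t \<in> {0..1}\<close> by simp
    qed
    then show "\<exists>n0. \<forall>n\<ge>n0. norm (W n t - G t) < r"
      by blast
  qed
  show ?thesis
  proof (rule eval_bounded_limit)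
    fix n
    \<comment> \<open>The summand \<open>L\<close> is the largest distance between \<open>G\<close>
      and its approximations.\<close>
    have Wb: "\<bar>W n t\<bar> \<le> b + L" if t: "t \<in> {0..1}" for t
    proof -
      have "L * inverse (real (Suc n)) \<le> L * 1"
        using L by (intro mult_left_mono) (auto simp: field_simps)
      then show ?thesis
        using near[OF t, of n] b[OF t] by simp
    qed
    have parts: "((\<lambda>t. R02p R s t * W n t + pd2 R s t * w n t) has_integral
        (alpha R s * W n s + edge1 s * W n 1 - edge0 s * W n 0)) {0..1}" if "s \<in> {0..1}" for s
      using that by (intro by_parts W w)
    have pd2: "((\<lambda>t. pd2 R s t * w n t) has_integral integral {0..1} (\<lambda>t. pd2 R s t * w n t)) {0..1}"
      if "s \<in> {0..1}" for s
      using that by (intro integrable_integral pd2_times_integrable w)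
    \<comment> \<open>Integrability of the term in \<open>R02p\<close> comes from subtracting one
      integrable function from another, not from regularity of \<open>R02p\<close> in
      \<open>t\<close>.\<close>
    have R02: "((\<lambda>t. R02p R s t * W n t) has_integral
        (alpha R s * W n s + edge1 s * W n 1 - edge0 s * W n 0) -
        integral {0..1} (\<lambda>t. pd2 R s t * w n t)) {0..1}" if "s \<in> {0..1}" for s
      using has_integral_diff[OF parts[OF that] pd2[OF that]] by simp
    have bounded: "eval_bounded (C2 * (b + L) + sqrt ((R1 + 2 * M1) * L\<^sup>2))
      (\<lambda>s. integral {0..1} (\<lambda>t. R02p R s t * W n t) + integral {0..1} (\<lambda>t. pd2 R s t * w n t))"
      using R02 Wb by (intro eval_bounded_add eval_bounded_R02_integral eval_bounded_pd2_integral w)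
        (auto simp: integrable_on_def)
    have eq: "integral {0..1} (\<lambda>t. R02p R s t * W n t) + integral {0..1} (\<lambda>t. pd2 R s t * w n t) =
        alpha R s * W n s + edge1 s * W n 1 - edge0 s * W n 0" if "s \<in> {0..1}" for s
      using integral_unique[OF R02[OF that]] by simp
    show "eval_bounded (C2 * (b + L) + sqrt ((R1 + 2 * M1) * L\<^sup>2))
        (\<lambda>s. alpha R s * W n s + edge1 s * W n 1 - edge0 s * W n 0)"
      by (rule iffD1[OF eval_bounded_cong[OF eq] bounded])
  next
    fix s :: real assume "s \<in> {0..1}"
    then show "(\<lambda>n. alpha R s * W n s + edge1 s * W n 1 - edge0 s * W n 0) \<longlonglongrightarrow>
        alpha R s * G s + edge1 s * G 1 - edge0 s * G 0"
      by (intro tendsto_intros conv) auto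
  qed
qed

section \<open>Interpolation, edge functions and Lipschitz functions\<close>

lemma gram_interpolation:
  assumes "finite S" "S \<subseteq> {0..1}"
  shows "\<exists>c. \<forall>t\<in>S. ksum S c t = f t"
proof -
  have "invertible_mat (gram_mat R (sorted_list_of_set S))"
    using nonsingular assms by (auto simp: nonsingular_kernel_def)
  then obtain c where "\<forall>t\<in>S. (\<Sum>s\<in>S. c s * R t s) = f t"
    using gram_solve assms(1) by blast
  then show ?thesis
    using assms(2) by (intro exI[of _ c]) (auto simp: ksum_apply)
qed

text \<open>Interpolating the data \<open>(1, 0)\<close> and \<open>(0, 1)\<close> on
  \<open>{0, 1}\<close> gives the columns of a right inverse, and the determinant is
  multiplicative.\<close>

lemma corner_det: "R 0 0 * R 1 1 - R 0 1 * R 1 0 \<noteq> 0"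
proof -
  have solve: "\<exists>c :: real \<Rightarrow> real. R 0 0 * c 0 + R 0 1 * c 1 = f 0 \<and> R 1 0 * c 0 + R 1 1 * c 1 = f 1"
    for f :: "real \<Rightarrow> real"
    using gram_interpolation[of "{0, 1}" f] by (simp add: ksum_apply mult.commute)
  obtain c :: "real \<Rightarrow> real" where c: "R 0 0 * c 0 + R 0 1 * c 1 = 1" "R 1 0 * c 0 + R 1 1 * c 1 = 0"
    using solve[of "\<lambda>t. 1 - t"] by auto
  obtain d :: "real \<Rightarrow> real" where d: "R 0 0 * d 0 + R 0 1 * d 1 = 0" "R 1 0 * d 0 + R 1 1 * d 1 = 1"
    using solve[of "\<lambda>t. t"] by auto
  have "(R 0 0 * R 1 1 - R 0 1 * R 1 0) * (c 0 * d 1 - c 1 * d 0) =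
      (R 0 0 * c 0 + R 0 1 * c 1) * (R 1 0 * d 0 + R 1 1 * d 1) -
      (R 0 0 * d 0 + R 0 1 * d 1) * (R 1 0 * c 0 + R 1 1 * c 1)"
    by (simp add: algebra_simps)
  then show ?thesis
    unfolding c d by auto
qed

text \<open>A Lipschitz function on the open interval has a Lipschitz extension \<open>G\<close> to
  the closure. The end values of \<open>G\<close> are the limits by which \<open>alpha\<close> is
  defined at 0 and 1, so \<open>alpha R\<close> equals \<open>G\<close> on \<open>{0..1}\<close>,
  and the lower bound in (B) extends by continuity.\<close>

lemma alpha_lipschitz: "\<exists>L. L-lipschitz_on {0..1} (alpha R)"
  and alpha_lower: "\<exists>a>0. \<forall>t\<in>{0..1}. a \<le> alpha R t"
proof -
  obtain L where L: "L-lipschitz_on {0<..<1} (alpha R)"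
    using B by (auto simp: assumption_B_def)
  obtain G where G: "L-lipschitz_on (closure {0<..<1}) G" "\<forall>t\<in>{0<..<1}. G t = alpha R t"
    using lipschitz_extend_closure[OF L] by blast
  have cl: "closure {0<..<1} = {0..1::real}"
    by simp
  have cont: "continuous_on {0..1} G"
    using lipschitz_on_continuous_on[OF G(1)] by (simp add: cl)
  have jump: "jump R t = G t" if "0 < t" "t < 1" for t
    using G(2) that by (simp add: alpha_def)
  have "(G \<longlongrightarrow> G 0) (at_right 0)" "(G \<longlongrightarrow> G 1) (at_left 1)"
    using cont continuous_on_Icc_at_rightD[of 0 1 G] continuous_on_Icc_at_leftD[of 0 1 G] by auto
  moreover have "\<forall>\<^sub>F t in at_right 0. G t = jump R t"
    by (rule eventually_at_rightI[of 0 1]) (auto simp: jump)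
  moreover have "\<forall>\<^sub>F t in at_left 1. G t = jump R t"
    by (rule eventually_at_leftI[of 0 1]) (auto simp: jump)
  ultimately have "(jump R \<longlongrightarrow> G 0) (at_right 0)" "(jump R \<longlongrightarrow> G 1) (at_left 1)"
    by (auto elim: Lim_transform_eventually)
  then have "Lim (at_right 0) (jump R) = G 0" "Lim (at_left 1) (jump R) = G 1"
    by (auto intro!: tendsto_Lim)
  then have eq: "alpha R t = G t" if "t \<in> {0..1}" for t
    using that jump by (auto simp: alpha_def)
  show "\<exists>L. L-lipschitz_on {0..1} (alpha R)"
    using lipschitz_onD[OF G(1)] lipschitz_on_nonneg[OF G(1)]
    by (intro exI[of _ L] lipschitz_onI) (auto simp: eq cl)
  define a where "a = (INF t\<in>{0<..<1}. alpha R t)"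
  have "bounded (G ` {0..1})"
    using cont by (intro compact_imp_bounded compact_continuous_image) auto
  then have "bdd_below (G ` {0<..<1})"
    by (rule bdd_below_mono[OF bounded_imp_bdd_below]) auto
  moreover have "alpha R ` {0<..<1} = G ` {0<..<1}"
    using G(2) by (intro image_cong) auto
  ultimately have "bdd_below (alpha R ` {0<..<1})"
    by simp
  then have "a \<le> G t" if "t \<in> {0<..<1}" for t
    unfolding a_def using that G(2) cINF_lower[of "alpha R" "{0<..<1}" t] by auto
  then have "a \<le> G t" if "t \<in> {0..1}" for t
    using continuous_ge_on_closure[of "{0<..<1}" G t a] cont that by (simp add: cl)
  then show "\<exists>a>0. \<forall>t\<in>{0..1}. a \<le> alpha R t"
    using B eq by (intro exI[of _ a]) (auto simp: assumption_B_def a_def)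
qed

lemma alpha_pos: "t \<in> {0..1} \<Longrightarrow> 0 < alpha R t"
  using alpha_lower by force

text \<open>Integration by parts is applied to \<open>\<gamma> / alpha R\<close>, so that the factor
  \<open>alpha R s\<close> produced by the jump cancels.\<close>

lemma eval_bounded_edges_combination:
  assumes \<gamma>: "L-lipschitz_on {0..1} \<gamma>"
  shows "\<exists>B. eval_bounded B (\<lambda>s. \<gamma> s + edge1 s * (\<gamma> 1 / alpha R 1) - edge0 s * (\<gamma> 0 / alpha R 0))"
proof -
  obtain a where a: "0 < a" "\<And>t. t \<in> {0..1} \<Longrightarrow> a \<le> alpha R t"
    using alpha_lower by blast
  obtain La where La: "La-lipschitz_on {0..1} (alpha R)"
    using alpha_lipschitz by blast
  have bnd: "\<exists>b\<ge>0. \<forall>t\<in>{0..1}. \<bar>f t\<bar> \<le> b" if f: "l-lipschitz_on {0..1} f" for l and f :: "real \<Rightarrow> real"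
  proof -
    have "\<bar>f t\<bar> \<le> \<bar>f 0\<bar> + l" if t: "t \<in> {0..1}" for t
    proof -
      have "\<bar>f t - f 0\<bar> \<le> l * \<bar>t - 0\<bar>"
        using lipschitz_onD[OF f, of t 0] t by (simp add: dist_real_def)
      also have "\<dots> \<le> l * 1"
        using t lipschitz_on_nonneg[OF f] by (intro mult_left_mono) auto
      finally show ?thesis
        by linarith
    qed
    then show ?thesis
      using lipschitz_on_nonneg[OF f] by (intro exI[of _ "\<bar>f 0\<bar> + l"]) auto
  qed
  obtain ba where ba: "0 \<le> ba" "\<And>t. t \<in> {0..1} \<Longrightarrow> \<bar>alpha R t\<bar> \<le> ba"
    using bnd[OF La] by blast
  obtain bg where bg: "0 \<le> bg" "\<And>t. t \<in> {0..1} \<Longrightarrow> \<bar>\<gamma> t\<bar> \<le> bg"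
    using bnd[OF \<gamma>] by blast
  have L0: "0 \<le> L" "0 \<le> La"
    using \<gamma> La by (auto intro: lipschitz_on_nonneg)
  \<comment> \<open>The Lipschitz constant of a quotient with bounds \<open>bg\<close> and
    \<open>ba\<close> on numerator and denominator and lower bound \<open>a\<close> for the
    denominator.\<close>
  define l where "l = (ba * L + bg * La) / a\<^sup>2"
  have G: "l-lipschitz_on {0..1} (\<lambda>t. \<gamma> t / alpha R t)"
  proof (rule lipschitz_onI)
    show "0 \<le> l"
      using L0 ba bg by (simp add: l_def)
    fix s t :: real assume st: "s \<in> {0..1}" "t \<in> {0..1}"
    have pos: "0 < alpha R s" "0 < alpha R t"
      using st by (auto intro: alpha_pos)
    have "\<gamma> s / alpha R s - \<gamma> t / alpha R t =
        (alpha R t * (\<gamma> s - \<gamma> t) + \<gamma> t * (alpha R t - alpha R s)) / (alpha R s * alpha R t)"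
      using pos by (simp add: field_simps)
    then have "\<bar>\<gamma> s / alpha R s - \<gamma> t / alpha R t\<bar> =
        \<bar>alpha R t * (\<gamma> s - \<gamma> t) + \<gamma> t * (alpha R t - alpha R s)\<bar> / (alpha R s * alpha R t)"
      using pos by (simp add: abs_mult)
    also have "\<dots> \<le> ((ba * L + bg * La) * \<bar>s - t\<bar>) / a\<^sup>2"
    proof (rule frac_le)
      have "\<bar>alpha R t\<bar> * \<bar>\<gamma> s - \<gamma> t\<bar> \<le> ba * (L * \<bar>s - t\<bar>)"
        using st lipschitz_onD[OF \<gamma>, of s t] ba by (intro mult_mono) (auto simp: dist_real_def)
      moreover have "\<bar>\<gamma> t\<bar> * \<bar>alpha R t - alpha R s\<bar> \<le> bg * (La * \<bar>s - t\<bar>)"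
        using st lipschitz_onD[OF La, of t s] bg
        by (intro mult_mono) (auto simp: dist_real_def abs_minus_commute)
      ultimately show "\<bar>alpha R t * (\<gamma> s - \<gamma> t) + \<gamma> t * (alpha R t - alpha R s)\<bar> \<le> (ba * L + bg * La) * \<bar>s - t\<bar>"
        using abs_triangle_ineq[of "alpha R t * (\<gamma> s - \<gamma> t)" "\<gamma> t * (alpha R t - alpha R s)"]
        unfolding abs_mult distrib_right mult.assoc by linarith
      show "a\<^sup>2 \<le> alpha R s * alpha R t"
        unfolding power2_eq_square using a st pos by (intro mult_mono) auto
    qed (use a L0 ba bg in auto)
    finally show "dist (\<gamma> s / alpha R s) (\<gamma> t / alpha R t) \<le> l * dist s t"
      by (simp add: dist_real_def l_def)
  qed
  obtain bG where "\<And>t. t \<in> {0..1} \<Longrightarrow> \<bar>\<gamma> t / alpha R t\<bar> \<le> bG"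
    using bnd[OF G] by blast
  from eval_bounded_by_parts[OF G this]
  have bounded: "eval_bounded (C2 * (bG + l) + sqrt ((R1 + 2 * M1) * l\<^sup>2))
      (\<lambda>s. alpha R s * (\<gamma> s / alpha R s) + edge1 s * (\<gamma> 1 / alpha R 1) - edge0 s * (\<gamma> 0 / alpha R 0))" .
  have eq: "alpha R s * (\<gamma> s / alpha R s) + edge1 s * (\<gamma> 1 / alpha R 1) - edge0 s * (\<gamma> 0 / alpha R 0) =
      \<gamma> s + edge1 s * (\<gamma> 1 / alpha R 1) - edge0 s * (\<gamma> 0 / alpha R 0)" if "s \<in> {0..1}" for s
    using alpha_pos[OF that] by simp
  show ?thesis
    by (rule exI, rule iffD1[OF eval_bounded_cong[OF eq] bounded])
qed

lemma eval_bounded_lincomb: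
  assumes "\<exists>B. eval_bounded B f" "\<exists>B. eval_bounded B g"
  shows "\<exists>B. eval_bounded B (\<lambda>s. a * f s + b * g s)"
  using assms eval_bounded_add[OF eval_bounded_scale eval_bounded_scale] by metis

lemma kernel_section_lipschitz: "t \<in> {0..1} \<Longrightarrow> M1-lipschitz_on {0..1} (\<lambda>s. R s t)"
  using R_lipschitz_snd[of t] M1_nonneg
  by (auto intro!: lipschitz_onI simp: dist_real_def kernel_commute[of _ t])

lemma kernel_section_eval_bounded:
  assumes "t \<in> {0..1}"
  shows "\<exists>B. eval_bounded B (\<lambda>s. R s t)"
proof -
  have eq: "ksec t s = R s t" if "s \<in> {0..1}" for s
    using that by (rule ksec_apply)
  show ?thesis
    by (rule exI, rule iffD1[OF eval_bounded_cong[OF eq] eval_bounded_mem[OF ksec_mem[OF assms]]])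
qed

text \<open>If \<open>\<gamma>\<close> is a kernel section, it is itself in the RKHS on
  \<open>{0..1}\<close> and can be removed from the combination of
  \<open>eval_bounded_edges_combination\<close>. What is left involves only the two edge
  functions.\<close>

lemma edges_eval_bounded:
  shows edge0_eval_bounded: "\<exists>B. eval_bounded B edge0"
    and edge1_eval_bounded: "\<exists>B. eval_bounded B edge1"
proof -
  define a0 where "a0 t = R 0 t / alpha R 0" for t
  define a1 where "a1 t = R 1 t / alpha R 1" for t
  have X: "\<exists>B. eval_bounded B (\<lambda>s. edge1 s * a1 t - edge0 s * a0 t)" if "t \<in> {0..1}" for t
    using eval_bounded_lincomb[OF eval_bounded_edges_combination[OF kernel_section_lipschitz[OF that]]
        kernel_section_eval_bounded[OF that], of 1 "-1"]
    by (simp add: a0_def a1_def)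
  \<comment> \<open>Up to sign, the determinant of the two equations obtained from the sections at 0
    and at 1.\<close>
  define d where "d = a1 0 * a0 1 - a1 1 * a0 0"
  have pos: "0 < alpha R 0" "0 < alpha R 1"
    by (auto intro: alpha_pos)
  have "d = - (R 0 0 * R 1 1 - R 0 1 * R 1 0) / (alpha R 0 * alpha R 1)"
    using pos by (simp add: d_def a0_def a1_def field_simps)
  then have d: "d \<noteq> 0"
    using corner_det pos by simp
  \<comment> \<open>Cramer's rule: these coefficients eliminate \<open>edge0\<close>, and the pair
    used further below eliminates \<open>edge1\<close>.\<close>
  have "(\<lambda>s. (a0 1 / d) * (edge1 s * a1 0 - edge0 s * a0 0) +
      (- a0 0 / d) * (edge1 s * a1 1 - edge0 s * a0 1)) = edge1"
  proof
    fix s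
    have "(a0 1 / d) * (edge1 s * a1 0 - edge0 s * a0 0) + (- a0 0 / d) * (edge1 s * a1 1 - edge0 s * a0 1) =
        edge1 s * (a1 0 * a0 1 - a1 1 * a0 0) / d"
      using d by (simp add: field_simps)
    then show "(a0 1 / d) * (edge1 s * a1 0 - edge0 s * a0 0) +
      (- a0 0 / d) * (edge1 s * a1 1 - edge0 s * a0 1) = edge1 s"
      using d by (simp add: d_def[symmetric])
  qed
  then show "\<exists>B. eval_bounded B edge1"
    using eval_bounded_lincomb[OF X[of 0] X[of 1], of "a0 1 / d" "- a0 0 / d"] by simp
  have "(\<lambda>s. (a1 1 / d) * (edge1 s * a1 0 - edge0 s * a0 0) +
      (- a1 0 / d) * (edge1 s * a1 1 - edge0 s * a0 1)) = edge0"
  proof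
    fix s
    have "(a1 1 / d) * (edge1 s * a1 0 - edge0 s * a0 0) + (- a1 0 / d) * (edge1 s * a1 1 - edge0 s * a0 1) =
        edge0 s * (a1 0 * a0 1 - a1 1 * a0 0) / d"
      using d by (simp add: field_simps)
    then show "(a1 1 / d) * (edge1 s * a1 0 - edge0 s * a0 0) +
      (- a1 0 / d) * (edge1 s * a1 1 - edge0 s * a0 1) = edge0 s"
      using d by (simp add: d_def[symmetric])
  qed
  then show "\<exists>B. eval_bounded B edge0"
    using eval_bounded_lincomb[OF X[of 0] X[of 1], of "a1 1 / d" "- a1 0 / d"] by simp
qed

lemma eval_bounded_nonneg:
  assumes "\<exists>B. eval_bounded B f"
  shows "\<exists>B\<ge>0. eval_bounded B f"
proof -
  obtain B where B: "eval_bounded B f"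
    using assms by blast
  have "eval_bounded \<bar>B\<bar> f"
    unfolding eval_bounded_def
  proof (intro allI impI)
    fix S c assume S: "finite S" "S \<subseteq> {0..1::real}"
    have "B * hnorm (ksum S c) \<le> \<bar>B\<bar> * hnorm (ksum S c)"
      using S by (intro mult_right_mono hnorm_nonneg ksum_mem) auto
    then show "\<bar>\<Sum>t\<in>S. c t * f t\<bar> \<le> \<bar>B\<bar> * hnorm (ksum S c)"
      using eval_boundedD[OF B S, of c] by linarith
  qed
  then show ?thesis
    by (intro exI[of _ "\<bar>B\<bar>"]) simp
qed

text \<open>With both edges bounded, their terms can be removed and \<open>\<gamma>\<close> alone
  remains. Applied to \<open>g\<close>, this gives the constant that bounds the norm of every
  interpolant of \<open>g\<close>.\<close>

lemma lipschitz_eval_bounded: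
  assumes "L-lipschitz_on {0..1} \<gamma>"
  shows "\<exists>B\<ge>0. eval_bounded B \<gamma>"
proof (rule eval_bounded_nonneg)
  have edges: "\<exists>B. eval_bounded B (\<lambda>s. (\<gamma> 1 / alpha R 1) * edge1 s + (- \<gamma> 0 / alpha R 0) * edge0 s)"
    by (rule eval_bounded_lincomb[OF edge1_eval_bounded edge0_eval_bounded])
  show "\<exists>B. eval_bounded B \<gamma>"
    using eval_bounded_lincomb[OF eval_bounded_edges_combination[OF assms] edges, of 1 "-1"]
    by (simp add: algebra_simps)
qed

section \<open>Kernels whose second derivative vanishes off the diagonal\<close>

text \<open>The slope of \<open>R s\<close> is constant on each side of \<open>s\<close>, so it may
  be read off at any \<open>e\<close> on the same side as the interval. The interval may end at
  \<open>s\<close>, but \<open>e\<close> must differ from \<open>s\<close>, since the slope is known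
  only off the diagonal.\<close>

lemma kernel_affine:
  assumes flat: "\<And>s t. s \<in> {0..1} \<Longrightarrow> t \<in> {0..1} \<Longrightarrow> s \<noteq> t \<Longrightarrow> pd2 (pd2 R) s t = 0"
    and s: "s \<in> {0..1}" and ab: "0 \<le> a" "a \<le> b" "b \<le> 1" and e: "e \<in> {0..1}"
    and side: "(b \<le> s \<and> e < s) \<or> (s \<le> a \<and> s < e)"
  shows "R s b - R s a = (b - a) * pd2 R s e"
proof -
  have slope: "pd2 R s z = pd2 R s e" if z: "a < z" "z < b" for z
  proof -
    have "norm (pd2 R s z - pd2 R s e) \<le> 0 * norm (z - e)"
    proof (rule field_differentiable_bound[of "{min z e..max z e}" _ "pd2 (pd2 R) s"])
      fix y assume y: "y \<in> {min z e..max z e}"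
      then have y': "y \<in> {0..1}" "s \<noteq> y"
        using z ab e side by auto
      then have "(pd2 R s has_real_derivative pd2 (pd2 R) s y) (at y within {0..1})"
        using s by (intro has_pds)
      then show "(pd2 R s has_real_derivative pd2 (pd2 R) s y) (at y within {min z e..max z e})"
        by (rule has_field_derivative_subset) (use z ab e in auto)
      show "norm (pd2 (pd2 R) s y) \<le> 0"
        using flat[OF s y'] by simp
    qed auto
    then show ?thesis
      by simp
  qed
  have "\<bar>(R s b - b * pd2 R s e) - (R s a - a * pd2 R s e)\<bar> \<le> 0 * (b - a)"
  proof (rule deriv_bound_interior[where f = "\<lambda>t. R s t - t * pd2 R s e" and f' = "\<lambda>t. pd2 R s t - pd2 R s e"])
    show "continuous_on {a..b} (\<lambda>t. R s t - t * pd2 R s e)"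
      using ab by (intro continuous_intros continuous_on_subset[OF R_continuous_snd[OF s]]) auto
    fix t assume t: "a < t" "t < b"
    have "(R s has_real_derivative pd2 R s t) (at t)"
      using t ab s side by (intro real_derivative_at_interior has_pds) auto
    then show "((\<lambda>t. R s t - t * pd2 R s e) has_real_derivative pd2 R s t - pd2 R s e) (at t)"
      by (auto intro!: derivative_eq_intros)
    show "\<bar>pd2 R s t - pd2 R s e\<bar> \<le> 0"
      using slope[OF t] by simp
  qed (use ab in auto)
  then show ?thesis
    by (simp add: algebra_simps)
qed

section \<open>Constants in the error bound\<close>

text \<open>This is the first factor of \<open>beta_nh\<close>, which does not depend on the
  design.\<close>

definition section_sup :: real where
  "section_sup = (SUP t\<in>{0..1}. 1 / alpha R t * hnorm (R02_section R t))"

lemma section_sup_ge: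
  assumes "t \<in> {0..1}"
  shows "1 / alpha R t * hnorm (R02_section R t) \<le> section_sup"
  unfolding section_sup_def
proof (rule cSUP_upper[OF assms])
  obtain a where a: "0 < a" "\<And>t. t \<in> {0..1} \<Longrightarrow> a \<le> alpha R t"
    using alpha_lower by blast
  have "1 / alpha R t * hnorm (R02_section R t) \<le> 1 / a * C2" if "t \<in> {0..1}" for t
    using a(1) a(2)[OF that] section_norm[OF that] hnorm_nonneg[OF section_mem[OF that]]
    by (intro mult_mono) (auto intro!: divide_left_mono mult_pos_pos)
  then show "bdd_above ((\<lambda>t. 1 / alpha R t * hnorm (R02_section R t)) ` {0..1})"
    by (intro bdd_aboveI[of _ "1 / a * C2"]) auto
qed

lemma section_sup_nonneg: "0 \<le> section_sup"
proof -
  have "0 \<le> 1 / alpha R 0 * hnorm (R02_section R 0)"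
    using alpha_pos[of 0] hnorm_nonneg[OF section_mem, of 0] by simp
  also have "\<dots> \<le> section_sup"
    by (rule section_sup_ge) simp
  finally show ?thesis .
qed

lemma alpha_sup_pos: "0 < alpha_sup R"
proof -
  have "alpha R (1 / 2) \<le> alpha_sup R"
    unfolding alpha_sup_def using B by (intro cSUP_upper) (auto simp: assumption_B_def)
  then show ?thesis
    using alpha_pos[of "1 / 2"] by simp
qed

text \<open>The term in \<open>alpha_sup R\<close> occurs in both cases of \<open>C_const\<close>
  with a factor of at least 4/3, and the other terms are nonnegative. The lower bound no longer
  depends on the design.\<close>

lemma C_const_ge: "(K_sup K)\<^sup>2 * (4 / 3 * alpha_sup R) \<le> C_const R K x h n T"
proof (cases "x - h \<in> T ` {1..n} \<and> x + h \<in> T ` {1..n}")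
  case True
  show ?thesis
    unfolding C_const_def if_P[OF True]
    using alpha_sup_pos R1_nonneg R2_nonneg by (intro mult_left_mono) auto
next
  case False
  show ?thesis
    unfolding C_const_def if_not_P[OF False]
    using alpha_sup_pos R1_nonneg R2_nonneg by (intro mult_left_mono) auto
qed

lemma flat_if_sections_zero:
  assumes zero: "\<And>t. t \<in> {0..1} \<Longrightarrow> hnorm (R02_section R t) = 0"
    and st: "s \<in> {0..1}" "t \<in> {0..1}" "s \<noteq> t"
  shows "pd2 (pd2 R) s t = 0"
proof -
  have "R02_section R t = (\<lambda>_. 0)"
    using hnorm_eq_0[OF section_mem[OF st(2)] zero[OF st(2)]] .
  from fun_cong[OF this, of s] show ?thesis
    using st by (simp add: on_domain_def R02p_off_diag)
qed

end

subsection \<open>Designs and kernel weights\<close>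

locale design_cells =
  fixes n :: nat and T :: "nat \<Rightarrow> real"
  assumes design: "design n T" and n: "1 \<le> n"
begin

lemma node_simps: "node n T 0 = 0" "node n T (Suc n) = 1" "1 \<le> i \<Longrightarrow> i \<le> n \<Longrightarrow> node n T i = T i"
  by (auto simp: node_def)

lemma node_range: "0 \<le> node n T i" "node n T i \<le> 1"
proof -
  have "T i \<in> {0..1}" if "1 \<le> i" "i \<le> n"
  proof -
    have "T i \<in> T ` {1..n}"
      using that by simp
    then show ?thesis
      using design unfolding design_def by (rule_tac subsetD) auto
  qed
  then show "0 \<le> node n T i" "node n T i \<le> 1"
    by (auto simp: node_def)
qed

lemma node_Suc: "node n T i \<le> node n T (Suc i)"
proof (cases "1 \<le> i \<and> Suc i \<le> n")
  case True
  have "strict_mono_on {1..n} T"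
    using design by (simp add: design_def)
  then have "T i < T (Suc i)"
    by (rule strict_mono_onD) (use True in auto)
  then show ?thesis
    using True by (simp add: node_def)
next
  case False
  then show ?thesis
    using node_range[of i] node_range[of "Suc i"] by (auto simp: node_def)
qed

lemma node_mono: "i \<le> j \<Longrightarrow> node n T i \<le> node n T j"
  by (rule lift_Suc_mono_le) (rule node_Suc)

definition mesh :: real where
  "mesh = Max (gap n T ` {0..n})"

lemma gap_nonneg: "0 \<le> gap n T i"
  using node_Suc by (simp add: gap_def)

lemma gap_le_mesh: "i \<le> n \<Longrightarrow> gap n T i \<le> mesh"
  by (simp add: mesh_def)

lemma mesh_attained: "\<exists>j\<in>{0..n}. gap n T j = mesh"
proof -
  have "mesh \<in> gap n T ` {0..n}"
    unfolding mesh_def by (rule Max_in) auto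
  then show ?thesis
    by auto
qed

lemma mesh_nonneg: "0 \<le> mesh"
  using gap_le_mesh[of 0] gap_nonneg[of 0] by simp

lemma sum_gap: "(\<Sum>i<Suc n. gap n T i) = 1"
  unfolding gap_def using sum_lessThan_telescope[of "node n T" "Suc n"]
  by (simp add: node_simps del: sum.lessThan_Suc)

text \<open>The \<open>n + 1\<close> gaps sum to 1 and are at most \<open>mesh\<close>, and
  \<open>n + 1 \<le> 2 * n\<close>.\<close>

lemma n_mesh_ge: "1 / 2 \<le> real n * mesh"
proof -
  have "1 \<le> (\<Sum>i<Suc n. mesh)"
    unfolding sum_gap[symmetric] by (intro sum_mono gap_le_mesh) auto
  also have "\<dots> = (real n + 1) * mesh"
    by (simp add: algebra_simps)
  also have "\<dots> \<le> (2 * real n) * mesh"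
    using n mesh_nonneg by (intro mult_right_mono) auto
  finally show ?thesis
    by simp
qed

lemma sup_gap_power_ge: "mesh ^ p \<le> (SUP j\<in>{0..n}. gap n T j ^ p)"
proof -
  obtain j where "j \<in> {0..n}" "gap n T j = mesh"
    using mesh_attained by blast
  then show ?thesis
    using cSUP_upper[of j "{0..n}" "\<lambda>j. gap n T j ^ p"] by (simp add: bdd_above_finite)
qed

text \<open>The segment of length \<open>h * (1 - x)\<close> that starts at \<open>x\<close> lies in
  the window and in \<open>{0..1}\<close>. It is covered by the intervals that
  \<open>N_design\<close> counts, and each of them is at most two gaps long.\<close>

lemma N_mesh_ge:
  assumes h: "0 < h" "h < 1" and x: "0 < x" "x < 1"
  shows "h * (1 - x) / 2 \<le> real (N_design x h n T) * mesh"
proof -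
  define A where "A = {i\<in>{1..n}. {node n T (i - 1)..node n T (i + 1)} \<inter> {x - h<..<x + h} \<noteq> {}}"
  have fin: "finite A"
    by (simp add: A_def)
  have hx: "h * (1 - x) < h" "x + h * (1 - x) < 1" "0 < h * (1 - x)"
    using h x mult_strict_right_mono[of h 1 "1 - x"] by (auto simp: algebra_simps)
  have cover: "{x..<x + h * (1 - x)} \<subseteq> (\<Union>i\<in>A. {node n T (i - 1)..node n T (i + 1)})"
  proof
    fix y assume y: "y \<in> {x..<x + h * (1 - x)}"
    then have y01: "0 \<le> y" "y \<le> 1" and yh: "y \<in> {x - h<..<x + h}"
      using hx x h order.strict_trans[of y "x + h * (1 - x)" "x + h"] by auto
    \<comment> \<open>The last node, up to the index \<open>n\<close>, that does not exceed
      \<open>y\<close>; hence \<open>y\<close> lies in the cell with index \<open>i\<close>.\<close>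
    define i where "i = (GREATEST i. i \<le> n \<and> node n T i \<le> y)"
    have ex: "0 \<le> n \<and> node n T 0 \<le> y"
      using y01 by (simp add: node_simps)
    have i: "i \<le> n \<and> node n T i \<le> y"
      unfolding i_def by (rule GreatestI_nat[where P = "\<lambda>i. i \<le> n \<and> node n T i \<le> y" and k = 0 and b = n])
        (use ex in auto)
    have "y \<le> node n T (Suc i)"
    proof (cases "i = n")
      case False
      then have "\<not> node n T (Suc i) \<le> y"
        using i Greatest_le_nat[of "\<lambda>i. i \<le> n \<and> node n T i \<le> y" "Suc i" n] by (auto simp: i_def[symmetric])
      then show ?thesis by simp
    qed (use y01 node_simps in simp)
    then have cell: "node n T i \<le> y" "y \<le> node n T (Suc i)"
      using i by auto
    \<comment> \<open>\<open>N_design\<close> counts from 1, so the cell with index 0 is assigned to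
      the interval around the first design point.\<close>
    define j where "j = max 1 i"
    have "j - 1 \<le> i" "Suc i \<le> j + 1"
      by (auto simp: j_def)
    then have "y \<in> {node n T (j - 1)..node n T (j + 1)}"
      using cell node_mono[of "j - 1" i] node_mono[of "Suc i" "j + 1"] by auto
    moreover have "j \<in> A"
      using calculation yh i n unfolding A_def j_def by auto
    ultimately show "y \<in> (\<Union>i\<in>A. {node n T (i - 1)..node n T (i + 1)})"
      by blast
  qed
  have "h * (1 - x) = measure lborel {x..<x + h * (1 - x)}"
    using hx by simp
  also have "\<dots> \<le> measure lborel (\<Union>i\<in>A. {node n T (i - 1)..node n T (i + 1)})"
    using cover fin by (intro measure_mono_fmeasurable fmeasurable_compact compact_UN) auto
  also have "\<dots> \<le> (\<Sum>i\<in>A. measure lborel {node n T (i - 1)..node n T (i + 1)})"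
    using fin by (intro measure_UNION_le) auto
  also have "\<dots> \<le> (\<Sum>i\<in>A. 2 * mesh)"
  proof (rule sum_mono)
    fix i assume i: "i \<in> A"
    then have "gap n T (i - 1) \<le> mesh" "gap n T i \<le> mesh" "1 \<le> i"
      by (auto simp: A_def intro!: gap_le_mesh)
    then show "measure lborel {node n T (i - 1)..node n T (i + 1)} \<le> 2 * mesh"
      using node_mono[of "i - 1" "i + 1"] by (simp add: gap_def)
  qed
  also have "\<dots> = 2 * (real (N_design x h n T) * mesh)"
    by (simp add: A_def N_design_def)
  finally show ?thesis
    by simp
qed

end

locale kernel_weight =
  fixes K :: "real \<Rightarrow> real" and Ks x h :: real
  assumes K_cont: "continuous_on UNIV K" and K_bound: "\<And>t. \<bar>K t\<bar> \<le> Ks"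
    and K_support: "\<And>t. t \<notin> {-1..1} \<Longrightarrow> K t = 0"
    and h: "0 < h" "h < 1"
begin

lemma Ks_nonneg: "0 \<le> Ks"
  using K_bound[of 0] by simp

lemma phi_continuous: "continuous_on S (phi K x h)"
  unfolding phi_def using h
  by (intro continuous_intros continuous_on_compose2[OF K_cont]) auto

lemma phi_bound: "\<bar>phi K x h s\<bar> \<le> Ks / h"
  using K_bound[of "(x - s) / h"] h by (simp add: phi_def abs_mult divide_right_mono)

lemma phi_support:
  assumes "s \<notin> {x - h..x + h}"
  shows "phi K x h s = 0"
proof -
  have "(x - s) / h \<notin> {-1..1}"
    using assms h by (auto simp: field_simps)
  then show ?thesis
    by (simp add: phi_def K_support)
qed

text \<open>The height is at most \<open>Ks / h\<close> and the window has length
  \<open>2 * h\<close>, so \<open>h\<close> cancels.\<close>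

lemma phi_abs_integral_le: "integral {0..1} (\<lambda>s. \<bar>phi K x h s\<bar>) \<le> 2 * Ks"
proof -
  define i where "i = integral {x - h..x + h} (\<lambda>s. \<bar>phi K x h s\<bar>)"
  have cont: "continuous_on S (\<lambda>s. \<bar>phi K x h s\<bar>)" for S
    by (intro continuous_intros phi_continuous)
  have i: "((\<lambda>s. \<bar>phi K x h s\<bar>) has_integral i) {x - h..x + h}"
    unfolding i_def by (intro integrable_integral integrable_continuous_real cont)
  have "\<bar>i\<bar> \<le> Ks / h * (x + h - (x - h))"
    using h Ks_nonneg phi_bound by (intro has_integral_abs_bound[OF i, where S = "{}"]) auto
  also have "\<dots> = 2 * Ks"
    using h by simp
  finally have "i \<le> 2 * Ks"
    by simp
  have "((\<lambda>s. \<bar>phi K x h s\<bar>) has_integral i) UNIV"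
    by (rule has_integral_on_superset[OF i]) (use phi_support in auto)
  then have "integral {0..1} (\<lambda>s. \<bar>phi K x h s\<bar>) \<le> i"
    by (intro has_integral_subset_le[OF _ integrable_integral[OF integrable_continuous_real[OF cont]]]) auto
  then show ?thesis
    using \<open>i \<le> 2 * Ks\<close> by simp
qed

end

locale weighted_cells = design_cells n T + kernel_weight K Ks x h
  for n T K Ks x h
begin

definition cell_weight :: "nat \<Rightarrow> real" where
  "cell_weight i = integral {node n T i..node n T (Suc i)} (\<lambda>s. \<bar>phi K x h s\<bar>)"

lemma cell_weight_has_integral:
  "((\<lambda>s. \<bar>phi K x h s\<bar>) has_integral cell_weight i) {node n T i..node n T (Suc i)}"
  unfolding cell_weight_def
  by (intro integrable_integral integrable_continuous_real continuous_intros phi_continuous)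

lemma cell_weight_nonneg: "0 \<le> cell_weight i"
  using cell_weight_has_integral by (rule has_integral_nonneg) auto

lemma cell_weight_le: "cell_weight i \<le> Ks / h * gap n T i"
  using has_integral_abs_bound[OF cell_weight_has_integral[of i] node_Suc[of i], of "Ks / h" "{}"]
    phi_bound h Ks_nonneg by (simp add: gap_def)

lemma sum_cell_weight_le: "(\<Sum>i<Suc n. cell_weight i) \<le> 2 * Ks"
proof -
  have "(\<lambda>s. \<bar>phi K x h s\<bar>) integrable_on {node n T 0..node n T (Suc n)}"
    by (intro integrable_continuous_real continuous_intros phi_continuous)
  then have "integral {node n T 0..node n T (Suc n)} (\<lambda>s. \<bar>phi K x h s\<bar>) = (\<Sum>i<Suc n. cell_weight i)"
    unfolding cell_weight_def by (intro integrable_on_cells node_Suc)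
  then show ?thesis
    using phi_abs_integral_le by (simp add: node_simps)
qed

text \<open>\<open>s i\<close> is a point of its cell at which the absolute value of
  \<open>v\<close> is largest. This replaces the integral by finitely many point values, which can
  be related to increments of the interpolant.\<close>

lemma weighted_integral_le:
  assumes v: "continuous_on {0..1} v"
  shows "\<exists>s. (\<forall>i. s i \<in> {node n T i..node n T (Suc i)}) \<and>
    \<bar>integral {0..1} (\<lambda>t. phi K x h t * v t)\<bar> \<le> (\<Sum>i<Suc n. cell_weight i * \<bar>v (s i)\<bar>)"
proof -
  have sub: "{node n T i..node n T (Suc i)} \<subseteq> {0..1}" for i
    using node_range by auto
  have "\<exists>s\<in>{node n T i..node n T (Suc i)}. \<forall>t\<in>{node n T i..node n T (Suc i)}. \<bar>v t\<bar> \<le> \<bar>v s\<bar>" for i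
    using node_Suc[of i]
    by (intro continuous_attains_sup continuous_intros continuous_on_subset[OF v sub]) auto
  then obtain s where s: "\<And>i. s i \<in> {node n T i..node n T (Suc i)}"
    "\<And>i t. t \<in> {node n T i..node n T (Suc i)} \<Longrightarrow> \<bar>v t\<bar> \<le> \<bar>v (s i)\<bar>"
    by metis
  have cont: "continuous_on {0..1} (\<lambda>t. phi K x h t * v t)"
    by (intro continuous_intros phi_continuous v)
  have "integral {0..1} (\<lambda>t. phi K x h t * v t) =
      (\<Sum>i<Suc n. integral {node n T i..node n T (Suc i)} (\<lambda>t. phi K x h t * v t))"
    using integrable_on_cells[of "Suc n" "node n T" "\<lambda>t. phi K x h t * v t", OF node_Suc]
      integrable_continuous_real[OF cont] by (simp only: node_simps)
  also have "\<bar>\<dots>\<bar> \<le> (\<Sum>i<Suc n. cell_weight i * \<bar>v (s i)\<bar>)"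
  proof (intro order.trans[OF sum_abs] sum_mono)
    fix i
    have "norm (integral {node n T i..node n T (Suc i)} (\<lambda>t. phi K x h t * v t)) \<le>
        integral {node n T i..node n T (Suc i)} (\<lambda>t. \<bar>phi K x h t\<bar> * \<bar>v (s i)\<bar>)"
    proof (rule integral_norm_bound_integral)
      show "(\<lambda>t. phi K x h t * v t) integrable_on {node n T i..node n T (Suc i)}"
        by (intro integrable_continuous_real continuous_on_subset[OF cont sub])
      show "(\<lambda>t. \<bar>phi K x h t\<bar> * \<bar>v (s i)\<bar>) integrable_on {node n T i..node n T (Suc i)}"
        by (intro integrable_continuous_real continuous_intros phi_continuous)
      show "norm (phi K x h t * v t) \<le> \<bar>phi K x h t\<bar> * \<bar>v (s i)\<bar>"
        if "t \<in> {node n T i..node n T (Suc i)}" for t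
        using s(2)[OF that] by (simp add: abs_mult mult_left_mono)
    qed
    then show "\<bar>integral {node n T i..node n T (Suc i)} (\<lambda>t. phi K x h t * v t)\<bar> \<le> cell_weight i * \<bar>v (s i)\<bar>"
      by (simp add: cell_weight_def)
  qed
  finally show ?thesis
    using s(1) by blast
qed

end

locale covariance_cells = covariance R H ip + weighted_cells n T K Ks x h
  for R H ip n T K Ks x h
begin

text \<open>The product of \<open>alpha R\<close> and \<open>phi\<close> is continuous, hence
  bounded on \<open>{0..1}\<close>, so the suprema dominate their members; the choice
  \<open>s = t\<close> contributes 0.\<close>

lemma alpha_nh_nonneg: "0 \<le> alpha_nh R K x h n T"
proof -
  define F where "F s = alpha R s * phi K x h s" for s
  define I where "I i = (SUP (s, t)\<in>{node n T i..node n T (Suc i)} \<times> {node n T i..node n T (Suc i)}.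
      gap n T i * \<bar>F s - F t\<bar>)" for i
  obtain L where L: "L-lipschitz_on {0..1} (alpha R)"
    using alpha_lipschitz by blast
  have "continuous_on {0..1} F"
    unfolding F_def by (intro continuous_intros phi_continuous lipschitz_on_continuous_on[OF L])
  then have "bounded (F ` {0..1})"
    by (intro compact_imp_bounded compact_continuous_image) auto
  then obtain b where b: "\<And>s. s \<in> {0..1} \<Longrightarrow> \<bar>F s\<bar> \<le> b"
    unfolding bounded_iff by (metis imageI real_norm_def)
  have "gap n T 0 * \<bar>F s - F t\<bar> \<le> gap n T 0 * (2 * b)" if "s \<in> {0..1}" "t \<in> {0..1}" for s t
    using b[OF that(1)] b[OF that(2)] gap_nonneg by (intro mult_left_mono) auto
  then have bdd: "bdd_above ((\<lambda>(s, t). gap n T 0 * \<bar>F s - F t\<bar>) `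
      ({node n T 0..node n T (Suc 0)} \<times> {node n T 0..node n T (Suc 0)}))"
    using node_range[of 0] node_range[of "Suc 0"] by (intro bdd_aboveI[of _ "gap n T 0 * (2 * b)"]) auto
  have "(node n T 0, node n T 0) \<in> {node n T 0..node n T (Suc 0)} \<times> {node n T 0..node n T (Suc 0)}"
    using node_Suc[of 0] by auto
  from cSUP_upper[OF this bdd] have "0 \<le> I 0"
    by (simp add: I_def)
  also have "\<dots> \<le> (SUP i\<in>{0..n}. I i)"
    by (rule cSUP_upper) (auto simp: bdd_above_finite)
  finally show ?thesis
    unfolding alpha_nh_def I_def F_def .
qed

lemma beta_nh_ge:
  "section_sup * (sqrt ((K_sup K)\<^sup>2 * (4 / 3 * alpha_sup R)) / sqrt h) * mesh\<^sup>2 \<le> beta_nh ip R K x h n T"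
proof -
  define Cm where "Cm = (K_sup K)\<^sup>2 * (4 / 3 * alpha_sup R)"
  have Cm: "0 \<le> Cm" "Cm \<le> C_const R K x h n T"
    using alpha_sup_pos C_const_ge by (auto simp: Cm_def)
  have "section_sup * (sqrt Cm / sqrt h) * mesh\<^sup>2 \<le>
      section_sup * (sqrt (C_const R K x h n T) / sqrt h) * (SUP j\<in>{0..n}. (gap n T j)\<^sup>2)"
  proof (intro mult_mono mult_left_mono divide_right_mono real_sqrt_le_mono)
    show "mesh\<^sup>2 \<le> (SUP j\<in>{0..n}. (gap n T j)\<^sup>2)"
      by (rule sup_gap_power_ge)
    show "0 \<le> section_sup * (sqrt (C_const R K x h n T) / sqrt h)"
      using section_sup_nonneg Cm h by simp
  qed (use section_sup_nonneg Cm h in auto)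
  then show ?thesis
    unfolding beta_nh_def section_sup_def[symmetric] Cm_def .
qed

text \<open>One of the two factors \<open>mesh\<close> absorbs \<open>n\<close>. What remains has
  the order \<open>mesh / sqrt h\<close> of the bound in \<open>error_le\<close>.\<close>

lemma n_beta_nh_ge:
  "section_sup * sqrt ((K_sup K)\<^sup>2 * (4 / 3 * alpha_sup R)) / 2 * (mesh / sqrt h) \<le>
    real n * beta_nh ip R K x h n T"
proof -
  define q where "q = section_sup * (sqrt ((K_sup K)\<^sup>2 * (4 / 3 * alpha_sup R)) / sqrt h) * mesh"
  have "0 \<le> q"
    unfolding q_def using section_sup_nonneg alpha_sup_pos h mesh_nonneg by auto
  then have "q * (1 / 2) \<le> q * (real n * mesh)"
    using n_mesh_ge by (intro mult_left_mono)
  also have "\<dots> = real n * (section_sup * (sqrt ((K_sup K)\<^sup>2 * (4 / 3 * alpha_sup R)) / sqrt h) * mesh\<^sup>2)"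
    by (simp add: q_def power2_eq_square mult_ac)
  also have "\<dots> \<le> real n * beta_nh ip R K x h n T"
    by (intro mult_left_mono beta_nh_ge) auto
  finally show ?thesis
    by (simp add: q_def mult_ac)
qed

text \<open>One of the three factors \<open>mesh\<close> absorbs the count \<open>N_design\<close>
  at the price of one power of \<open>h\<close>. Since \<open>h < 1\<close>, what remains dominates
  the order \<open>mesh\<^sup>2 / h\<close> of the bound in \<open>flat_error_le\<close>.\<close>

lemma cubic_term_ge:
  assumes x: "0 < x" "x < 1"
  shows "(1 - x) / 2 * (mesh\<^sup>2 / h) \<le>
    real (N_design x h n T) / h ^ 3 * (SUP j\<in>{0..n}. gap n T j ^ 3)"
proof -
  have "(1 - x) / 2 * (mesh\<^sup>2 / h) \<le> (1 - x) / 2 * (mesh\<^sup>2 / h\<^sup>2)"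
  proof (intro mult_left_mono divide_left_mono)
    show "h\<^sup>2 \<le> h"
      using h by (simp add: power2_eq_square mult_left_le)
  qed (use h x in auto)
  also have "\<dots> = (h * (1 - x) / 2) * (mesh\<^sup>2 / h ^ 3)"
    using h by (simp add: field_simps power2_eq_square power3_eq_cube)
  also have "\<dots> \<le> (real (N_design x h n T) * mesh) * (mesh\<^sup>2 / h ^ 3)"
    using N_mesh_ge[OF h x] h by (intro mult_right_mono) auto
  also have "\<dots> = real (N_design x h n T) / h ^ 3 * mesh ^ 3"
    by (simp add: power2_eq_square power3_eq_cube)
  also have "\<dots> \<le> real (N_design x h n T) / h ^ 3 * (SUP j\<in>{0..n}. gap n T j ^ 3)"
    using h by (intro mult_left_mono sup_gap_power_ge) auto
  finally show ?thesis .
qed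

lemma remainder_terms_nonneg:
  assumes x: "0 < x" "x < 1"
  shows "0 \<le> real (N_design x h n T) / h ^ 3 * (SUP j\<in>{0..n}. gap n T j ^ 3)"
    and "0 \<le> real (N_design x h n T) * alpha_nh R K x h n T"
    and "0 \<le> real n * beta_nh ip R K x h n T"
proof -
  show "0 \<le> real (N_design x h n T) / h ^ 3 * (SUP j\<in>{0..n}. gap n T j ^ 3)"
  proof -
    have "0 \<le> (1 - x) / 2 * (mesh\<^sup>2 / h)"
      using x h by simp
    then show ?thesis
      using cubic_term_ge[OF x] by linarith
  qed
  show "0 \<le> real (N_design x h n T) * alpha_nh R K x h n T"
    using alpha_nh_nonneg by simp
  show "0 \<le> real n * beta_nh ip R K x h n T"
  proof -
    have "0 \<le> section_sup * sqrt ((K_sup K)\<^sup>2 * (4 / 3 * alpha_sup R)) / 2 * (mesh / sqrt h)"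
      using section_sup_nonneg alpha_sup_pos h mesh_nonneg by simp
    then show ?thesis
      using n_beta_nh_ge by linarith
  qed
qed

end

subsection \<open>The interpolation error\<close>

text \<open>The function \<open>c\<close> holds the coefficients of the interpolant. The bounds
  \<open>Lg\<close>, \<open>G2\<close> and \<open>Bg\<close> are parameters, so that they can be
  fixed before the design.\<close>

locale interpolation_error = covariance_cells R H ip n T K Ks x h
  for R H ip n T K Ks x h +
  fixes g g' g'' c :: "real \<Rightarrow> real" and Lg G2 Bg :: real
  assumes g_lipschitz: "Lg-lipschitz_on {0..1} g"
    and g_bounded: "eval_bounded Bg g" "0 \<le> Bg"
    and g_deriv: "\<And>t. t \<in> {0..1} \<Longrightarrow> (g has_real_derivative g' t) (at t within {0..1})"
    and g'_deriv: "\<And>t. t \<in> {0..1} \<Longrightarrow> (g' has_real_derivative g'' t) (at t within {0..1})"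
    and g''_bound: "\<And>t. t \<in> {0..1} \<Longrightarrow> \<bar>g'' t\<bar> \<le> G2"
    and interp: "\<And>t. t \<in> T ` {1..n} \<Longrightarrow> ksum (T ` {1..n}) c t = g t"
begin

definition u :: "real \<Rightarrow> real" where
  "u = ksum (T ` {1..n}) c"

lemma points: "finite (T ` {1..n})" "T ` {1..n} \<subseteq> {0..1}"
  using design by (auto simp: design_def)

lemma u_mem: "u \<in> H"
  unfolding u_def by (rule ksum_mem[OF points])

lemma u_norm: "hnorm u \<le> Bg"
  unfolding u_def by (rule hnorm_interpolant_le[OF points interp g_bounded])

lemma u_node: "1 \<le> i \<Longrightarrow> i \<le> n \<Longrightarrow> u (node n T i) = g (node n T i)"
  unfolding u_def using interp[of "T i"] by (simp add: node_simps)

lemma u_apply: "t \<in> {0..1} \<Longrightarrow> u t = (\<Sum>s\<in>T ` {1..n}. c s * R s t)"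
  unfolding u_def using points by (rule_tac ksum_apply')

lemma u_continuous: "continuous_on {0..1} u"
proof -
  have "continuous_on {0..1} (\<lambda>t. \<Sum>s\<in>T ` {1..n}. c s * R s t)"
    using points by (intro continuous_intros R_continuous_snd) auto
  then show ?thesis
    by (rule continuous_on_eq) (simp add: u_apply)
qed

lemma error_continuous: "continuous_on {0..1} (\<lambda>t. g t - u t)"
  by (intro continuous_intros u_continuous lipschitz_on_continuous_on[OF g_lipschitz])

lemma Lg_nonneg: "0 \<le> Lg"
  using g_lipschitz by (rule lipschitz_on_nonneg)

lemma g_increment: "s \<in> {0..1} \<Longrightarrow> t \<in> {0..1} \<Longrightarrow> \<bar>g s - g t\<bar> \<le> Lg * \<bar>s - t\<bar>"
  using lipschitz_onD[OF g_lipschitz] by (simp add: dist_real_def)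

text \<open>Each value \<open>u (s i)\<close> is compared with a node of its cell at which
  \<open>u = g\<close>. The Lipschitz bound handles the change of \<open>g\<close>, the estimate for
  increments that of \<open>u\<close>. One cell has weight at most \<open>Ks / h * mesh\<close> and
  all cells together at most \<open>2 * Ks\<close>; the root of a product of these bounds is the
  source of \<open>sqrt h\<close>.\<close>

lemma error_le:
  "\<bar>integral {0..1} (\<lambda>t. phi K x h t * (g t - u t))\<bar> \<le>
    (2 * Ks * Lg + 2 * Ks * Bg * sqrt (R1 + M1)) * (mesh / sqrt h)"
proof -
  obtain s where s: "\<And>i. s i \<in> {node n T i..node n T (Suc i)}"
    and le: "\<bar>integral {0..1} (\<lambda>t. phi K x h t * (g t - u t))\<bar> \<le>
      (\<Sum>i<Suc n. cell_weight i * \<bar>g (s i) - u (s i)\<bar>)"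
    using weighted_integral_le[OF error_continuous] by blast
  \<comment> \<open>The intervals join \<open>s i\<close> to a design point. The cell with index 0
    need not start at a design point, so it is anchored at its right end, all others at their left
    end.\<close>
  define lo where "lo i = (if i = 0 then s 0 else node n T i)" for i
  define hi where "hi i = (if i = 0 then node n T 1 else s i)" for i
  have lohi: "0 \<le> lo i \<and> lo i \<le> hi i \<and> hi i \<le> 1" for i
    using s[of i] node_range[of i] node_range[of "Suc i"] by (auto simp: lo_def hi_def)
  have len: "hi i - lo i \<le> mesh" if "i < Suc n" for i
    using s[of i] gap_le_mesh[of i] that by (auto simp: lo_def hi_def gap_def)
  have ord: "hi i \<le> lo j" if "i < j" "j < Suc n" for i j
    using s[of i] node_mono[of "Suc i" j] that by (auto simp: lo_def hi_def)
  have cell: "\<bar>g (s i) - u (s i)\<bar> \<le> Lg * mesh + \<bar>u (hi i) - u (lo i)\<bar>" if i: "i < Suc n" for i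
  proof -
    define a where "a = (if i = 0 then node n T 1 else node n T i)"
    have "g a = u a"
      using u_node[of 1] u_node[of i] n i by (auto simp: a_def)
    moreover have "\<bar>u (s i) - u a\<bar> = \<bar>u (hi i) - u (lo i)\<bar>"
      by (auto simp: a_def lo_def hi_def)
    moreover have "\<bar>g (s i) - g a\<bar> \<le> Lg * \<bar>s i - a\<bar>"
      using s[of i] node_range[of i] node_range[of "Suc i"] by (intro g_increment) (auto simp: a_def)
    moreover have "Lg * \<bar>s i - a\<bar> \<le> Lg * mesh"
      using s[of i] gap_le_mesh[of i] i Lg_nonneg by (intro mult_left_mono) (auto simp: a_def gap_def)
    ultimately show ?thesis
      by linarith
  qed
  \<comment> \<open>The signs turn the sum of absolute values into a linear combination of
    increments.\<close>
  define w where "w i = sgn (u (hi i) - u (lo i)) * cell_weight i" for i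
  have wabs: "\<bar>w i\<bar> \<le> cell_weight i" "(w i)\<^sup>2 \<le> (cell_weight i)\<^sup>2" for i
    using cell_weight_nonneg[of i] by (auto simp: w_def abs_mult power_mult_distrib sgn_if)
  have "(\<Sum>i<Suc n. cell_weight i * \<bar>u (hi i) - u (lo i)\<bar>) = (\<Sum>i<Suc n. w i * (u (hi i) - u (lo i)))"
    by (intro sum.cong refl) (auto simp: w_def sgn_if)
  also have "\<dots> \<le> hnorm u * sqrt (R1 * (\<Sum>i<Suc n. \<bar>w i\<bar> * (hi i - lo i))\<^sup>2 +
      2 * M1 * (\<Sum>i<Suc n. (w i)\<^sup>2 * (hi i - lo i)))"
    using increment_combination_bound[of "Suc n" lo hi u w] lohi ord u_mem by fastforce
  also have "\<dots> \<le> Bg * (2 * Ks * sqrt (R1 + M1) * (mesh / sqrt h))"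
  proof (intro mult_mono u_norm)
    have "(\<Sum>i<Suc n. \<bar>w i\<bar> * (hi i - lo i)) \<le> (\<Sum>i<Suc n. cell_weight i * mesh)"
      using lohi len wabs cell_weight_nonneg by (intro sum_mono mult_mono) auto
    also have "\<dots> \<le> 2 * Ks * mesh"
      unfolding sum_distrib_right[symmetric] using sum_cell_weight_le mesh_nonneg by (rule mult_right_mono)
    finally have "(\<Sum>i<Suc n. \<bar>w i\<bar> * (hi i - lo i))\<^sup>2 \<le> (2 * Ks * mesh)\<^sup>2"
      using lohi by (intro power_mono sum_nonneg) auto
    \<comment> \<open>The factor \<open>1 / h\<close> exceeds 1 and brings this sum to the scale of
      the second one.\<close>
    also have "\<dots> \<le> (2 * Ks * mesh)\<^sup>2 / h"
      using h mult_right_mono[of h 1 "(2 * Ks * mesh)\<^sup>2"] by (simp add: field_simps)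
    finally have 1: "R1 * (\<Sum>i<Suc n. \<bar>w i\<bar> * (hi i - lo i))\<^sup>2 \<le> R1 * ((2 * Ks * mesh)\<^sup>2 / h)"
      using R1_nonneg by (rule mult_left_mono)
    have "(\<Sum>i<Suc n. (w i)\<^sup>2 * (hi i - lo i)) \<le> (\<Sum>i<Suc n. cell_weight i * (Ks / h * mesh * mesh))"
    proof (rule sum_mono)
      fix i assume i: "i \<in> {..<Suc n}"
      have "cell_weight i \<le> Ks / h * mesh"
        using cell_weight_le[of i] mult_left_mono[OF gap_le_mesh[of i], of "Ks / h"] i h Ks_nonneg by auto
      then have "cell_weight i * cell_weight i \<le> cell_weight i * (Ks / h * mesh)"
        using cell_weight_nonneg by (intro mult_left_mono) auto
      then have "(w i)\<^sup>2 \<le> cell_weight i * (Ks / h * mesh)"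
        using wabs(2)[of i] by (simp add: power2_eq_square)
      then have "(w i)\<^sup>2 * (hi i - lo i) \<le> (cell_weight i * (Ks / h * mesh)) * mesh"
        using i lohi[of i] len[of i] cell_weight_nonneg[of i] h Ks_nonneg mesh_nonneg
        by (intro mult_mono) auto
      then show "(w i)\<^sup>2 * (hi i - lo i) \<le> cell_weight i * (Ks / h * mesh * mesh)"
        by (simp add: mult_ac)
    qed
    also have "\<dots> \<le> 2 * Ks * (Ks / h * mesh * mesh)"
      unfolding sum_distrib_right[symmetric]
      using sum_cell_weight_le h Ks_nonneg mesh_nonneg by (intro mult_right_mono) auto
    finally have 2: "2 * M1 * (\<Sum>i<Suc n. (w i)\<^sup>2 * (hi i - lo i)) \<le> 2 * M1 * (2 * Ks * (Ks / h * mesh * mesh))"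
      using M1_nonneg by (intro mult_left_mono) auto
    have "R1 * (\<Sum>i<Suc n. \<bar>w i\<bar> * (hi i - lo i))\<^sup>2 + 2 * M1 * (\<Sum>i<Suc n. (w i)\<^sup>2 * (hi i - lo i)) \<le>
        (2 * Ks)\<^sup>2 * (R1 + M1) * (mesh\<^sup>2 / h)"
      using add_mono[OF 1 2] by (simp add: power2_eq_square algebra_simps)
    then have "sqrt (R1 * (\<Sum>i<Suc n. \<bar>w i\<bar> * (hi i - lo i))\<^sup>2 + 2 * M1 * (\<Sum>i<Suc n. (w i)\<^sup>2 * (hi i - lo i))) \<le>
        sqrt ((2 * Ks)\<^sup>2 * (R1 + M1) * (mesh\<^sup>2 / h))"
      by (rule real_sqrt_le_mono)
    also have "\<dots> = 2 * Ks * sqrt (R1 + M1) * (mesh / sqrt h)"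
      using Ks_nonneg mesh_nonneg by (simp add: real_sqrt_mult real_sqrt_divide)
    finally show "sqrt (R1 * (\<Sum>i<Suc n. \<bar>w i\<bar> * (hi i - lo i))\<^sup>2 + 2 * M1 * (\<Sum>i<Suc n. (w i)\<^sup>2 * (hi i - lo i))) \<le>
        2 * Ks * sqrt (R1 + M1) * (mesh / sqrt h)" .
    have "0 \<le> (\<Sum>i<Suc n. (w i)\<^sup>2 * (hi i - lo i))"
      using lohi by (intro sum_nonneg) auto
    then show "0 \<le> sqrt (R1 * (\<Sum>i<Suc n. \<bar>w i\<bar> * (hi i - lo i))\<^sup>2 + 2 * M1 * (\<Sum>i<Suc n. (w i)\<^sup>2 * (hi i - lo i)))"
      using R1_nonneg M1_nonneg by simp
  qed (use g_bounded in auto)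
  finally have U: "(\<Sum>i<Suc n. cell_weight i * \<bar>u (hi i) - u (lo i)\<bar>) \<le>
      2 * Ks * Bg * sqrt (R1 + M1) * (mesh / sqrt h)"
    by (simp add: mult_ac)
  have "sqrt h \<le> 1"
    using h by simp
  then have root: "mesh \<le> mesh / sqrt h"
    using h mesh_nonneg mult_right_mono[of "sqrt h" 1 mesh] by (simp add: field_simps)
  have "(\<Sum>i<Suc n. cell_weight i * (Lg * mesh)) \<le> 2 * Ks * (Lg * mesh)"
    unfolding sum_distrib_right[symmetric]
    using sum_cell_weight_le Lg_nonneg mesh_nonneg by (intro mult_right_mono) auto
  also have "\<dots> \<le> 2 * Ks * (Lg * (mesh / sqrt h))"
    using root Ks_nonneg Lg_nonneg by (intro mult_left_mono) auto
  finally have G: "(\<Sum>i<Suc n. cell_weight i * (Lg * mesh)) \<le> 2 * Ks * Lg * (mesh / sqrt h)"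
    by (simp add: mult_ac)
  have "(\<Sum>i<Suc n. cell_weight i * \<bar>g (s i) - u (s i)\<bar>) \<le>
      (\<Sum>i<Suc n. cell_weight i * (Lg * mesh + \<bar>u (hi i) - u (lo i)\<bar>))"
    by (intro sum_mono mult_left_mono cell cell_weight_nonneg) auto
  also have "\<dots> = (\<Sum>i<Suc n. cell_weight i * (Lg * mesh)) + (\<Sum>i<Suc n. cell_weight i * \<bar>u (hi i) - u (lo i)\<bar>)"
    unfolding distrib_left sum.distrib ..
  also have "\<dots> \<le> (2 * Ks * Lg + 2 * Ks * Bg * sqrt (R1 + M1)) * (mesh / sqrt h)"
    using add_mono[OF G U] by (simp only: distrib_right)
  finally show ?thesis
    using le by linarith
qed

text \<open>By the normal equations the weights reproduce the integral of \<open>phi\<close> against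
  each kernel section at a design point. By linearity they do so for \<open>u\<close>, which agrees
  with \<open>g\<close> on the design.\<close>

lemma weighted_values:
  "(\<Sum>i = 1..n. weight R K x h n T i * g (T i)) = integral {0..1} (\<lambda>t. phi K x h t * u t)"
proof -
  let ?S = "T ` {1..n}"
  have inv: "invertible_mat (gram_mat R (design_list n T))"
    using nonsingular points sorted_design[OF design] unfolding nonsingular_kernel_def by metis
  have T01: "T i \<in> {0..1}" if "i \<in> {1..n}" for i
    using points that by blast
  have u_eq: "u t = (\<Sum>s\<in>?S. c s * R t s)" if "t \<in> {0..1}" for t
    unfolding u_def by (rule ksum_apply[OF that])
  have "(\<Sum>i = 1..n. weight R K x h n T i * g (T i)) = (\<Sum>i = 1..n. weight R K x h n T i * u (T i))"
    using interp by (intro sum.cong refl) (simp add: u_def)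
  also have "\<dots> = (\<Sum>i = 1..n. \<Sum>s\<in>?S. c s * (weight R K x h n T i * R (T i) s))"
    by (intro sum.cong refl) (simp add: u_eq[OF T01] sum_distrib_left mult_ac)
  also have "\<dots> = (\<Sum>s\<in>?S. c s * (\<Sum>i = 1..n. weight R K x h n T i * R (T i) s))"
    unfolding sum_distrib_left by (rule sum.swap)
  also have "\<dots> = (\<Sum>s\<in>?S. c s * smoothed_cov R K x h s)"
    by (intro sum.cong refl) (auto simp: weight_normal_equations[OF inv, simplified])
  also have "\<dots> = integral {0..1} (\<lambda>t. phi K x h t * u t)"
  proof -
    have "((\<lambda>t. R t s * phi K x h t) has_integral smoothed_cov R K x h s) {0..1}" if "s \<in> ?S" for s
    proof -
      have "s \<in> {0..1}"
        using that points by blast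
      then have "continuous_on {0..1} (\<lambda>t. R t s)"
        using kernel_section_lipschitz lipschitz_on_continuous_on by blast
      then show ?thesis
        unfolding smoothed_cov_def
        by (intro integrable_integral integrable_continuous_real continuous_intros phi_continuous)
    qed
    then have "((\<lambda>t. \<Sum>s\<in>?S. c s * (R t s * phi K x h t)) has_integral
        (\<Sum>s\<in>?S. c s * smoothed_cov R K x h s)) {0..1}"
      by (intro has_integral_sum has_integral_mult_right) auto
    then have "((\<lambda>t. phi K x h t * u t) has_integral (\<Sum>s\<in>?S. c s * smoothed_cov R K x h s)) {0..1}"
      by (rule has_integral_eq[rotated]) (simp add: u_eq sum_distrib_left mult_ac)
    then show ?thesis
      by (simp add: integral_unique)
  qed
  finally show ?thesis .
qed

lemma estimator_error:
  "(\<Sum>i = 1..n. weight R K x h n T i * g (T i)) - integral {0..1} (\<lambda>t. phi K x h t * g t) =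
    - integral {0..1} (\<lambda>t. phi K x h t * (g t - u t))"
proof -
  have "integral {0..1} (\<lambda>t. phi K x h t * (g t - u t)) =
      integral {0..1} (\<lambda>t. phi K x h t * g t) - integral {0..1} (\<lambda>t. phi K x h t * u t)"
    unfolding right_diff_distrib
    by (intro Henstock_Kurzweil_Integration.integral_diff integrable_continuous_real continuous_intros
        phi_continuous u_continuous lipschitz_on_continuous_on[OF g_lipschitz])
  then show ?thesis
    unfolding weighted_values by simp
qed

section \<open>The error when the second derivative of the kernel vanishes off the diagonal\<close>

context
  fixes B0 B1 :: real
  assumes flat: "\<And>s t. s \<in> {0..1} \<Longrightarrow> t \<in> {0..1} \<Longrightarrow> s \<noteq> t \<Longrightarrow> pd2 (pd2 R) s t = 0"
    and B0: "eval_bounded B0 edge0" "0 \<le> B0" and B1: "eval_bounded B1 edge1" "0 \<le> B1"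
begin

lemma T_mono: "1 \<le> i \<Longrightarrow> i \<le> j \<Longrightarrow> j \<le> n \<Longrightarrow> T i \<le> T j"
  using node_mono[of i j] by (simp add: node_simps)

lemma u_difference:
  assumes "a \<in> {0..1}" "b \<in> {0..1}" and "\<And>s. s \<in> T ` {1..n} \<Longrightarrow> R s b - R s a = (b - a) * p s"
  shows "u b - u a = (b - a) * (\<Sum>s\<in>T ` {1..n}. c s * p s)"
proof -
  have "u b - u a = (\<Sum>s\<in>T ` {1..n}. c s * (R s b - R s a))"
    using assms(1,2) by (simp add: u_apply sum_subtractf right_diff_distrib)
  also have "\<dots> = (\<Sum>s\<in>T ` {1..n}. c s * ((b - a) * p s))"
    using assms(3) by (intro sum.cong refl) simp
  also have "\<dots> = (b - a) * (\<Sum>s\<in>T ` {1..n}. c s * p s)"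
    by (simp add: sum_distrib_left mult_ac)
  finally show ?thesis .
qed

text \<open>No design point lies to the left of \<open>T 1\<close>, so \<open>u\<close> is affine on
  this cell, and its slope combines the values of \<open>edge0\<close> with the coefficients of
  \<open>u\<close>. Such a combination is at most \<open>B0\<close> times the norm of
  \<open>u\<close>.\<close>

lemma error_first_cell:
  assumes t: "t \<in> {node n T 0..node n T 1}"
  shows "\<bar>g t - u t\<bar> \<le> (Lg + B0 * Bg) * mesh"
proof -
  have t01: "t \<in> {0..1}" "T 1 \<in> {0..1}" "t \<le> T 1"
    using t node_range[of 1] n by (auto simp: node_simps)
  have T1: "g (T 1) = u (T 1)"
    using u_node[of 1] n by (simp add: node_simps)
  have dist: "0 \<le> T 1 - t" "T 1 - t \<le> mesh"
    using t gap_le_mesh[of 0] n by (auto simp: gap_def node_simps)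
  have "\<bar>u (T 1) - u t\<bar> \<le> (T 1 - t) * (B0 * Bg)"
  \<comment> \<open>If \<open>T 1 = 0\<close>, the cell is a single point. Otherwise every design
    point is positive, so the special corner value of \<open>edge0\<close> does not occur.\<close>
  proof (cases "T 1 = 0")
    case False
    have pos: "0 < s" "T 1 \<le> s" "s \<le> 1" if "s \<in> T ` {1..n}" for s
      using that False t01 points T_mono[of 1] by (force, force, force)
    have "u (T 1) - u t = (T 1 - t) * (\<Sum>s\<in>T ` {1..n}. c s * edge0 s)"
    proof (rule u_difference)
      fix s assume s: "s \<in> T ` {1..n}"
      have "R s (T 1) - R s t = (T 1 - t) * pd2 R s 0"
        using pos[OF s] t01 by (intro kernel_affine flat) auto
      then show "R s (T 1) - R s t = (T 1 - t) * edge0 s"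
        using pos[OF s] by (simp add: edge0_def)
    qed (use t01 in auto)
    then have "\<bar>u (T 1) - u t\<bar> = (T 1 - t) * \<bar>\<Sum>s\<in>T ` {1..n}. c s * edge0 s\<bar>"
      using dist by (simp add: abs_mult)
    also have "\<dots> \<le> (T 1 - t) * (B0 * Bg)"
    proof (rule mult_left_mono)
      have "\<bar>\<Sum>s\<in>T ` {1..n}. c s * edge0 s\<bar> \<le> B0 * hnorm u"
        unfolding u_def by (rule eval_boundedD[OF B0(1) points])
      also have "\<dots> \<le> B0 * Bg"
        using B0(2) u_norm by (rule mult_left_mono[rotated])
      finally show "\<bar>\<Sum>s\<in>T ` {1..n}. c s * edge0 s\<bar> \<le> B0 * Bg" .
    qed (use dist in auto)
    finally show ?thesis .
  qed (use t01 in auto)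
  moreover have "\<bar>g t - g (T 1)\<bar> \<le> Lg * (T 1 - t)"
    using g_increment[of t "T 1"] t01 by simp
  moreover have "Lg * (T 1 - t) + (T 1 - t) * (B0 * Bg) \<le> (Lg + B0 * Bg) * mesh"
    using mult_left_mono[OF dist(2), of "Lg + B0 * Bg"] Lg_nonneg B0 g_bounded
    by (simp add: algebra_simps)
  ultimately show ?thesis
    using T1 by linarith
qed

text \<open>The mirror image of the first cell, with the slope given by
  \<open>edge1\<close>.\<close>

lemma error_last_cell:
  assumes t: "t \<in> {node n T n..node n T (Suc n)}"
  shows "\<bar>g t - u t\<bar> \<le> (Lg + B1 * Bg) * mesh"
proof -
  have t01: "t \<in> {0..1}" "T n \<in> {0..1}" "T n \<le> t"
    using t node_range[of n] n by (auto simp: node_simps)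
  have Tn: "g (T n) = u (T n)"
    using u_node[of n] n by (simp add: node_simps)
  have dist: "0 \<le> t - T n" "t - T n \<le> mesh"
    using t gap_le_mesh[of n] n by (auto simp: gap_def node_simps)
  have "\<bar>u t - u (T n)\<bar> \<le> (t - T n) * (B1 * Bg)"
  proof (cases "T n = 1")
    case False
    have pos: "0 \<le> s" "s \<le> T n" "s < 1" if "s \<in> T ` {1..n}" for s
      using that False t01 points T_mono[of _ n] by (force, force, force)
    have "u t - u (T n) = (t - T n) * (\<Sum>s\<in>T ` {1..n}. c s * edge1 s)"
    proof (rule u_difference)
      fix s assume s: "s \<in> T ` {1..n}"
      have "R s t - R s (T n) = (t - T n) * pd2 R s 1"
        using pos[OF s] t01 by (intro kernel_affine flat) auto
      then show "R s t - R s (T n) = (t - T n) * edge1 s"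
        using pos[OF s] by (simp add: edge1_def)
    qed (use t01 in auto)
    then have "\<bar>u t - u (T n)\<bar> = (t - T n) * \<bar>\<Sum>s\<in>T ` {1..n}. c s * edge1 s\<bar>"
      using dist by (simp add: abs_mult)
    also have "\<dots> \<le> (t - T n) * (B1 * Bg)"
    proof (rule mult_left_mono)
      have "\<bar>\<Sum>s\<in>T ` {1..n}. c s * edge1 s\<bar> \<le> B1 * hnorm u"
        unfolding u_def by (rule eval_boundedD[OF B1(1) points])
      also have "\<dots> \<le> B1 * Bg"
        using B1(2) u_norm by (rule mult_left_mono[rotated])
      finally show "\<bar>\<Sum>s\<in>T ` {1..n}. c s * edge1 s\<bar> \<le> B1 * Bg" .
    qed (use dist in auto)
    finally show ?thesis .
  qed (use t01 in auto)
  moreover have "\<bar>g t - g (T n)\<bar> \<le> Lg * (t - T n)"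
    using g_increment[of t "T n"] t01 by simp
  moreover have "Lg * (t - T n) + (t - T n) * (B1 * Bg) \<le> (Lg + B1 * Bg) * mesh"
    using mult_left_mono[OF dist(2), of "Lg + B1 * Bg"] Lg_nonneg B1 g_bounded
    by (simp add: algebra_simps)
  ultimately show ?thesis
    using Tn by linarith
qed

lemma G2_nonneg: "0 \<le> G2"
  using g''_bound[of 0] by force

text \<open>No design point lies strictly between two consecutive ones, so all kernel sections in
  \<open>u\<close> are affine on the cell. Hence \<open>u\<close> is the linear interpolant of
  \<open>g\<close> there.\<close>

lemma error_inner_cell:
  assumes i: "1 \<le> i" "i < n" and t: "t \<in> {node n T i..node n T (Suc i)}"
  shows "\<bar>g t - u t\<bar> \<le> G2 * mesh\<^sup>2"
proof -
  define a where "a = T i"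
  define b where "b = T (Suc i)"
  have nodes: "node n T i = a" "node n T (Suc i) = b"
    using i by (auto simp: node_simps a_def b_def)
  have "strict_mono_on {1..n} T"
    using design by (simp add: design_def)
  then have ab: "a < b"
    unfolding a_def b_def by (rule strict_mono_onD) (use i in auto)
  have range: "0 \<le> a" "b \<le> 1"
    using node_range[of i] node_range[of "Suc i"] by (auto simp: nodes)
  have tab: "t \<in> {a..b}"
    using t by (simp add: nodes)
  \<comment> \<open>The slope is read off at the end of the cell that is farther from
    \<open>s\<close>, which is never \<open>s\<close> itself.\<close>
  define p where "p s = (if b \<le> s then pd2 R s a else pd2 R s b)" for s
  have affine: "R s y - R s a = (y - a) * p s" if s: "s \<in> T ` {1..n}" and y: "y \<in> {a..b}" for s y
  proof (cases "b \<le> s")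
    case True
    then show ?thesis
      using s y points ab range unfolding p_def by (auto intro!: kernel_affine flat)
  next
    case False
    obtain j where j: "s = T j" "1 \<le> j" "j \<le> n"
      using s by auto
    have "j < Suc i"
      using False T_mono[of "Suc i" j] j i by (force simp: b_def)
    then have "s \<le> a"
      using T_mono[of j i] j i by (auto simp: a_def)
    then have "R s y - R s a = (y - a) * pd2 R s b"
      using s y points ab range by (intro kernel_affine flat) auto
    then show ?thesis
      using False by (simp add: p_def)
  qed
  define \<kappa> where "\<kappa> = (\<Sum>s\<in>T ` {1..n}. c s * p s)"
  have u: "u y - u a = (y - a) * \<kappa>" if "y \<in> {a..b}" for y
    unfolding \<kappa>_def using that ab range by (intro u_difference affine) auto
  have ends: "u a = g a" "u b = g b"
    using u_node[of i] u_node[of "Suc i"] i by (auto simp: nodes)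
  have "(b - a) * \<kappa> = g b - g a"
    using u[of b] ab ends by simp
  then have "\<kappa> = (g b - g a) / (b - a)"
    using ab by (simp add: field_simps)
  then have "u t = g a + (t - a) * ((g b - g a) / (b - a))"
    using u[OF tab] ends by simp
  moreover have "\<bar>g t - (g a + (t - a) * ((g b - g a) / (b - a)))\<bar> \<le> G2 * (b - a)\<^sup>2"
  proof (rule linear_interpolation_error[OF _ _ _ ab tab])
    fix y assume y: "y \<in> {a..b}"
    then have y01: "y \<in> {0..1}"
      using range by auto
    show "(g has_real_derivative g' y) (at y within {a..b})"
      by (rule has_field_derivative_subset[OF g_deriv[OF y01]]) (use range in auto)
    show "(g' has_real_derivative g'' y) (at y within {a..b})"
      by (rule has_field_derivative_subset[OF g'_deriv[OF y01]]) (use range in auto)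
    show "\<bar>g'' y\<bar> \<le> G2"
      by (rule g''_bound[OF y01])
  qed
  moreover have "(b - a)\<^sup>2 \<le> mesh\<^sup>2"
    using gap_le_mesh[of i] i ab by (intro power_mono) (auto simp: gap_def nodes)
  then have "G2 * (b - a)\<^sup>2 \<le> G2 * mesh\<^sup>2"
    using G2_nonneg by (rule mult_left_mono)
  ultimately show ?thesis
    by simp
qed

text \<open>On the inner cells the error is of order \<open>mesh\<^sup>2\<close> and the lengths sum
  to at most 1. On the first and the last cell it is only of order \<open>mesh\<close>, but these
  cells have length at most \<open>mesh\<close>. The factor \<open>Ks / h\<close> bounds the height
  of \<open>phi\<close>.\<close>

lemma flat_error_le:
  "\<bar>integral {0..1} (\<lambda>t. phi K x h t * (g t - u t))\<bar> \<le>
    Ks * (G2 + 2 * (Lg + (B0 + B1) * Bg)) * (mesh\<^sup>2 / h)"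
proof -
  obtain s where s: "\<And>i. s i \<in> {node n T i..node n T (Suc i)}"
    and le: "\<bar>integral {0..1} (\<lambda>t. phi K x h t * (g t - u t))\<bar> \<le>
      (\<Sum>i<Suc n. cell_weight i * \<bar>g (s i) - u (s i)\<bar>)"
    using weighted_integral_le[OF error_continuous] by blast
  define b where "b = Lg + (B0 + B1) * Bg"
  have b: "0 \<le> b" "Lg + B0 * Bg \<le> b" "Lg + B1 * Bg \<le> b"
    using Lg_nonneg B0 B1 g_bounded by (auto simp: b_def distrib_right)
  have Kh: "0 \<le> Ks / h"
    using Ks_nonneg h by simp
  \<comment> \<open>This collects the contributions of the first and the last cell.\<close>
  define q where "q i = (if i = 0 then b * mesh\<^sup>2 else 0) + (if i = n then b * mesh\<^sup>2 else 0)" for i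
  have cell: "gap n T i * \<bar>g (s i) - u (s i)\<bar> \<le> gap n T i * (G2 * mesh\<^sup>2) + q i" if i: "i < Suc n" for i
  proof (cases "1 \<le> i \<and> i < n")
    case True
    then have "gap n T i * \<bar>g (s i) - u (s i)\<bar> \<le> gap n T i * (G2 * mesh\<^sup>2)"
      by (intro mult_left_mono error_inner_cell[of i] s gap_nonneg) auto
    moreover have "0 \<le> q i"
      using b by (simp add: q_def)
    ultimately show ?thesis
      by simp
  next
    case False
    have "\<bar>g (s i) - u (s i)\<bar> \<le> b * mesh"
    proof (cases "i = 0")
      case True
      then have "\<bar>g (s i) - u (s i)\<bar> \<le> (Lg + B0 * Bg) * mesh"
        using s[of 0] by (intro error_first_cell) auto
      also have "\<dots> \<le> b * mesh"
        using b mesh_nonneg by (intro mult_right_mono)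
      finally show ?thesis .
    next
      case nonzero: False
      then have "i = n"
        using i False by auto
      then have "\<bar>g (s i) - u (s i)\<bar> \<le> (Lg + B1 * Bg) * mesh"
        using s[of n] by (intro error_last_cell) auto
      also have "\<dots> \<le> b * mesh"
        using b mesh_nonneg by (intro mult_right_mono)
      finally show ?thesis .
    qed
    then have "gap n T i * \<bar>g (s i) - u (s i)\<bar> \<le> mesh * (b * mesh)"
      using i mesh_nonneg by (intro mult_mono gap_le_mesh) auto
    also have "\<dots> \<le> q i"
      using False i b n by (auto simp: q_def power2_eq_square)
    finally show ?thesis
      using mult_nonneg_nonneg[OF gap_nonneg[of i], of "G2 * mesh\<^sup>2"] G2_nonneg by simp
  qed
  have "(\<Sum>i<Suc n. cell_weight i * \<bar>g (s i) - u (s i)\<bar>) \<le>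
      (\<Sum>i<Suc n. Ks / h * (gap n T i * (G2 * mesh\<^sup>2) + q i))"
  proof (rule sum_mono)
    fix i assume "i \<in> {..<Suc n}"
    then have i: "i < Suc n"
      by simp
    have "cell_weight i * \<bar>g (s i) - u (s i)\<bar> \<le> (Ks / h * gap n T i) * \<bar>g (s i) - u (s i)\<bar>"
      by (intro mult_right_mono cell_weight_le) auto
    also have "\<dots> \<le> Ks / h * (gap n T i * (G2 * mesh\<^sup>2) + q i)"
      unfolding mult.assoc using cell[OF i] Kh by (rule mult_left_mono)
    finally show "cell_weight i * \<bar>g (s i) - u (s i)\<bar> \<le> Ks / h * (gap n T i * (G2 * mesh\<^sup>2) + q i)" .
  qed
  also have "\<dots> = Ks / h * ((\<Sum>i<Suc n. gap n T i) * (G2 * mesh\<^sup>2) + (\<Sum>i<Suc n. q i))"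
    unfolding sum_distrib_left[symmetric] sum.distrib sum_distrib_right ..
  also have "(\<Sum>i<Suc n. q i) = 2 * (b * mesh\<^sup>2)"
    unfolding q_def sum.distrib by (subst (1 2) sum.delta) auto
  finally show ?thesis
    using le unfolding sum_gap b_def[symmetric] by (simp add: algebra_simps)
qed

end

end

subsection \<open>Expectation and smoothing bias\<close>

text \<open>The errors are tied to \<open>X\<close> through the law of their paths. Evaluation at
  \<open>t\<close> is a measurable coordinate of the path space, so integrability and mean carry
  over from \<open>X\<close>.\<close>

lemma error_integral_zero:
  assumes process: "centered_second_order_process P X R" and iid: "iid_copies M m \<epsilon> P X"
    and j: "j \<in> {1..m}" and t: "t \<in> {0..1}"
  shows "integrable M (\<epsilon> j t)" "(LINT \<omega>|M. \<epsilon> j t \<omega>) = 0"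
proof -
  interpret M: prob_space M
    using iid by (simp add: iid_copies_def)
  interpret P: prob_space P
    using process by (simp add: centered_second_order_process_def)
  have X: "\<And>t. t \<in> {0..1} \<Longrightarrow> X t \<in> borel_measurable P" "integrable P (\<lambda>\<omega>. (X t \<omega>)\<^sup>2)"
    "(LINT \<omega>|P. X t \<omega>) = 0"
    using process t by (auto simp: centered_second_order_process_def)
  have \<epsilon>_meas: "sample_path (\<epsilon> j) \<in> measurable M path_space"
    using iid j by (auto simp: iid_copies_def M.indep_vars_def)
  have X_meas: "sample_path X \<in> measurable P path_space"
    unfolding path_space_def sample_path_def by (rule measurable_restrict) (rule X(1))
  have ev: "(\<lambda>f. f t) \<in> borel_measurable path_space"
    unfolding path_space_def by (rule measurable_component_singleton[OF t])
  have same: "distr M path_space (sample_path (\<epsilon> j)) = distr P path_space (sample_path X)"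
    using iid j by (simp add: iid_copies_def)
  have "integrable P (X t)"
    using P.square_integrable_imp_integrable[OF X(1)[OF t] X(2)] .
  then have "integrable (distr P path_space (sample_path X)) (\<lambda>f. f t)"
    using t by (subst integrable_distr_eq[OF X_meas ev]) (simp add: sample_path_def)
  then show "integrable M (\<epsilon> j t)"
    using t unfolding same[symmetric] integrable_distr_eq[OF \<epsilon>_meas ev] by (simp add: sample_path_def)
  have "(LINT \<omega>|M. \<epsilon> j t \<omega>) = (LINT f|distr M path_space (sample_path (\<epsilon> j)). f t)"
    using t by (subst integral_distr[OF \<epsilon>_meas ev]) (simp add: sample_path_def)
  also have "\<dots> = (LINT \<omega>|P. X t \<omega>)"
    using t unfolding same by (subst integral_distr[OF X_meas ev]) (simp add: sample_path_def)
  finally show "(LINT \<omega>|M. \<epsilon> j t \<omega>) = 0"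
    using X(3) by simp
qed

lemma expectation_g_pro:
  assumes process: "centered_second_order_process P X R" and iid: "iid_copies M m \<epsilon> P X"
    and m: "1 \<le> m" and T: "T ` {1..n} \<subseteq> {0..1}"
  shows "(LINT \<omega>|M. g_pro g \<epsilon> m R K x h n T \<omega>) = (\<Sum>i = 1..n. weight R K x h n T i * g (T i))"
proof -
  interpret M: prob_space M
    using iid by (simp add: iid_copies_def)
  have obs: "integrable M (observation g \<epsilon> j t)" "(LINT \<omega>|M. observation g \<epsilon> j t \<omega>) = g t"
    if "j \<in> {1..m}" "t \<in> {0..1}" for j t
    using error_integral_zero[OF process iid that] unfolding observation_def[abs_def]
    by (auto simp: M.prob_space)
  have mean: "integrable M (mean_observation g \<epsilon> m t)" "(LINT \<omega>|M. mean_observation g \<epsilon> m t \<omega>) = g t"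
    if t: "t \<in> {0..1}" for t
  proof -
    show "integrable M (mean_observation g \<epsilon> m t)"
      unfolding mean_observation_def[abs_def] using t by (intro integrable_mult_right Bochner_Integration.integrable_sum obs)
    have "(LINT \<omega>|M. mean_observation g \<epsilon> m t \<omega>) = 1 / real m * (\<Sum>j = 1..m. LINT \<omega>|M. observation g \<epsilon> j t \<omega>)"
      unfolding mean_observation_def using t by (subst integral_mult_right_zero, subst Bochner_Integration.integral_sum) (auto intro: obs)
    also have "\<dots> = 1 / real m * (\<Sum>j = 1..m. g t)"
      using t by (simp add: obs)
    finally show "(LINT \<omega>|M. mean_observation g \<epsilon> m t \<omega>) = g t"
      using m by simp
  qed
  have Ti: "T i \<in> {0..1}" if "i \<in> {1..n}" for i
    using T that by blast
  have "(LINT \<omega>|M. g_pro g \<epsilon> m R K x h n T \<omega>) =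
      (\<Sum>i = 1..n. LINT \<omega>|M. weight R K x h n T i * mean_observation g \<epsilon> m (T i) \<omega>)"
    unfolding g_pro_def by (intro Bochner_Integration.integral_sum integrable_mult_right mean Ti)
  also have "\<dots> = (\<Sum>i = 1..n. weight R K x h n T i * g (T i))"
    by (intro sum.cong refl) (simp add: mean(2)[OF Ti])
  finally show ?thesis .
qed

context
  fixes K K' :: "real \<Rightarrow> real"
  assumes kernel: "C1_kernel K K'"
begin

lemma C1_kernel_continuous: "continuous_on S K"
  using kernel by (auto simp: C1_kernel_def intro!: continuous_at_imp_continuous_on DERIV_isCont)

lemma C1_kernel_support: "t \<notin> {-1..1} \<Longrightarrow> K t = 0"
proof -
  have "{t. K t \<noteq> 0} \<subseteq> {-1..1}"
    using kernel closure_subset[of "{t. K t \<noteq> 0}"] by (simp add: C1_kernel_def)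
  then show "t \<notin> {-1..1} \<Longrightarrow> K t = 0"
    by auto
qed

lemma K_sup_bound: "\<bar>K t\<bar> \<le> K_sup K"
proof -
  have "compact ((\<lambda>t. \<bar>K t\<bar>) ` {-1..1})"
    by (intro compact_continuous_image continuous_intros C1_kernel_continuous) auto
  then have bdd: "bdd_above ((\<lambda>t. \<bar>K t\<bar>) ` {-1..1})"
    by (intro bounded_imp_bdd_above compact_imp_bounded)
  have inside: "\<bar>K t\<bar> \<le> K_sup K" if "t \<in> {-1..1}" for t
    unfolding K_sup_def by (rule cSUP_upper[OF that bdd])
  show ?thesis
    using inside[of t] inside[of 0] C1_kernel_support[of t] by (cases "t \<in> {-1..1}") auto
qed

text \<open>Otherwise \<open>K\<close> would vanish and could not have integral 1.\<close>

lemma K_sup_pos: "0 < K_sup K"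
proof (rule ccontr)
  assume "\<not> 0 < K_sup K"
  then have "K t = 0" for t
    using K_sup_bound[of t] by simp
  then have "integral {-1..1} K = 0"
    by (metis (no_types, lifting) integral_0 ext)
  then show False
    using kernel by (simp add: C1_kernel_def)
qed

lemma kernel_moments:
  "(K has_integral 1) {-1..1}" "((\<lambda>t. t * K t) has_integral 0) {-1..1}"
  "((\<lambda>t. t\<^sup>2 * K t) has_integral integral {-1..1} (\<lambda>t. t\<^sup>2 * K t)) {-1..1}"
proof -
  have "(K has_integral integral {-1..1} K) {-1..1}"
    by (intro integrable_integral integrable_continuous_real C1_kernel_continuous)
  then show "(K has_integral 1) {-1..1}"
    using kernel by (simp add: C1_kernel_def)
  have "((\<lambda>t. t * K t) has_integral integral {-1..1} (\<lambda>t. t * K t)) {-1..1}"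
    by (intro integrable_integral integrable_continuous_real continuous_intros C1_kernel_continuous)
  then show "((\<lambda>t. t * K t) has_integral 0) {-1..1}"
    using kernel by (simp add: C1_kernel_def)
  show "((\<lambda>t. t\<^sup>2 * K t) has_integral integral {-1..1} (\<lambda>t. t\<^sup>2 * K t)) {-1..1}"
    by (intro integrable_integral integrable_continuous_real continuous_intros C1_kernel_continuous)
qed

text \<open>Substituting \<open>s = x + \<eta> * t\<close> produces \<open>K (- t)\<close>, which
  evenness turns into \<open>K t\<close>. The bounds on \<open>\<eta>\<close> keep the window inside
  \<open>{0..1}\<close>, so no mass of the kernel is cut off.\<close>

lemma phi_integral_substitution:
  assumes even: "\<And>t. K (- t) = K t" and \<eta>: "0 < \<eta>" "\<eta> \<le> x" "x + \<eta> \<le> 1"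
    and g: "continuous_on {0..1} g"
  shows "((\<lambda>t. K t * g (x + \<eta> * t)) has_integral integral {0..1} (\<lambda>s. phi K x \<eta> s * g s)) {-1..1}"
proof -
  define I where "I = integral {-1..1} (\<lambda>t. K t * g (x + \<eta> * t))"
  have inside: "x + \<eta> * t \<in> {0..1}" if "t \<in> {-1..1}" for t
  proof -
    have "\<bar>\<eta> * t\<bar> \<le> \<eta>"
      using that \<eta> by (auto simp: abs_mult intro!: mult_left_le)
    then show ?thesis
      using \<eta> by auto
  qed
  have "continuous_on {-1..1} (\<lambda>t. K t * g (x + \<eta> * t))"
    by (intro continuous_intros C1_kernel_continuous continuous_on_compose2[OF g])
      (use inside in auto)
  then have I: "((\<lambda>t. K t * g (x + \<eta> * t)) has_integral I) (cbox (-1) 1)"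
    unfolding I_def cbox_interval by (intro integrable_integral integrable_continuous_real)
  \<comment> \<open>The image is written in the form in which \<open>has_integral_affinity\<close>
    yields it for the scale \<open>1 / \<eta>\<close> and the shift
    \<open>- x / \<eta>\<close>.\<close>
  have img: "(\<lambda>t. (1 / (1 / \<eta>)) *\<^sub>R t + - ((1 / (1 / \<eta>)) *\<^sub>R (- x / \<eta>))) ` cbox (-1) 1 = {x - \<eta>..x + \<eta>}"
  proof -
    have "(\<lambda>t. \<eta> * t + x) ` {-1..1} = {x - \<eta>..x + \<eta>}"
      using \<eta> by (subst image_affinity_atLeastAtMost) (auto simp: algebra_simps)
    moreover have "(1 / (1 / \<eta>)) *\<^sub>R t + - ((1 / (1 / \<eta>)) *\<^sub>R (- x / \<eta>)) = \<eta> * t + x" for t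
      using \<eta> by simp
    ultimately show ?thesis
      by (simp only: cbox_interval)
  qed
  have "((\<lambda>s. K ((1 / \<eta>) *\<^sub>R s + - x / \<eta>) * g (x + \<eta> * ((1 / \<eta>) *\<^sub>R s + - x / \<eta>))) has_integral
      (1 / \<bar>1 / \<eta>\<bar> ^ DIM(real)) *\<^sub>R I) {x - \<eta>..x + \<eta>}"
    using has_integral_affinity[OF I, of "1 / \<eta>" "- x / \<eta>"] \<eta> unfolding img by simp
  then have "((\<lambda>s. (1 / \<eta>) * (K ((1 / \<eta>) *\<^sub>R s + - x / \<eta>) * g (x + \<eta> * ((1 / \<eta>) *\<^sub>R s + - x / \<eta>)))) has_integral
      (1 / \<eta>) * ((1 / \<bar>1 / \<eta>\<bar> ^ DIM(real)) *\<^sub>R I)) {x - \<eta>..x + \<eta>}"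
    by (rule has_integral_mult_right)
  moreover have "(1 / \<eta>) * ((1 / \<bar>1 / \<eta>\<bar> ^ DIM(real)) *\<^sub>R I) = I"
    using \<eta> by simp
  moreover have "(1 / \<eta>) * (K ((1 / \<eta>) *\<^sub>R s + - x / \<eta>) * g (x + \<eta> * ((1 / \<eta>) *\<^sub>R s + - x / \<eta>))) =
      phi K x \<eta> s * g s" for s
  proof -
    have "(1 / \<eta>) *\<^sub>R s + - x / \<eta> = - ((x - s) / \<eta>)" "x + \<eta> * ((1 / \<eta>) *\<^sub>R s + - x / \<eta>) = s"
      using \<eta> by (auto simp: field_simps)
    then show ?thesis
      by (simp add: phi_def even)
  qed
  ultimately have local: "((\<lambda>s. phi K x \<eta> s * g s) has_integral I) {x - \<eta>..x + \<eta>}"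
    by simp
  have outside: "phi K x \<eta> s = 0" if "s \<notin> {x - \<eta>..x + \<eta>}" for s
  proof -
    have "(x - s) / \<eta> \<notin> {-1..1}"
      using that \<eta> by (auto simp: field_simps)
    then show ?thesis
      by (simp add: phi_def C1_kernel_support)
  qed
  have "((\<lambda>s. phi K x \<eta> s * g s) has_integral I) {0..1}"
    by (rule has_integral_on_superset[OF local]) (use outside \<eta> in auto)
  then have "integral {0..1} (\<lambda>s. phi K x \<eta> s * g s) = I"
    by (rule integral_unique)
  then show ?thesis
    using I by (simp add: cbox_interval)
qed

text \<open>The moments 1 and 0 of \<open>K\<close> remove the constant and the linear Taylor term
  at \<open>x\<close>, and the quadratic one is subtracted. The Taylor remainder \<open>f\<close>
  has second derivative \<open>g'' y - g'' x\<close>, small near \<open>x\<close> by continuity, so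
  \<open>f\<close> is at most \<open>e * \<eta>\<^sup>2\<close> on the window.\<close>

lemma smoothing_bias:
  assumes even: "\<And>t. K (- t) = K t" and x: "0 < x" "x < 1"
    and g1: "\<And>t. t \<in> {0..1} \<Longrightarrow> (g has_real_derivative g' t) (at t within {0..1})"
    and g2: "\<And>t. t \<in> {0..1} \<Longrightarrow> (g' has_real_derivative g'' t) (at t within {0..1})"
    and g2c: "continuous_on {0..1} g''"
  shows "(\<lambda>\<eta>. integral {0..1} (\<lambda>s. phi K x \<eta> s * g s) - g x -
      1 / 2 * \<eta>\<^sup>2 * g'' x * integral {-1..1} (\<lambda>t. t\<^sup>2 * K t)) \<in> o[at_right 0](\<lambda>\<eta>. \<eta>\<^sup>2)"
proof (rule landau_o.smallI)
  fix c :: real assume c: "0 < c"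
  \<comment> \<open>The remainder is weighted by at most \<open>K_sup K\<close> over an interval of
    length 2, so this choice yields exactly \<open>c * \<eta>\<^sup>2\<close>.\<close>
  define e where "e = c / (2 * K_sup K)"
  have e: "0 < e"
    using c K_sup_pos by (simp add: e_def)
  have g: "continuous_on {0..1} g"
    using g1 by (rule DERIV_continuous_on)
  obtain d where d: "0 < d" "\<And>y. y \<in> {0..1} \<Longrightarrow> dist y x < d \<Longrightarrow> dist (g'' y) (g'' x) < e"
    using g2c x e unfolding continuous_on_iff by fastforce
  \<comment> \<open>Below \<open>d'\<close> the window stays in \<open>{0..1}\<close> and in the
    range where \<open>g''\<close> is within \<open>e\<close> of its value at
    \<open>x\<close>.\<close>
  define d' where "d' = min d (min x (1 - x))"
  have d': "0 < d'"
    using d(1) x by (simp add: d'_def)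
  show "\<forall>\<^sub>F \<eta> in at_right 0. norm (integral {0..1} (\<lambda>s. phi K x \<eta> s * g s) - g x -
      1 / 2 * \<eta>\<^sup>2 * g'' x * integral {-1..1} (\<lambda>t. t\<^sup>2 * K t)) \<le> c * norm (\<eta>\<^sup>2)"
  proof (rule eventually_at_rightI[of 0 d'])
    fix \<eta> assume "\<eta> \<in> {0<..<d'}"
    then have \<eta>: "0 < \<eta>" "\<eta> < d" "\<eta> \<le> x" "x + \<eta> \<le> 1"
      by (auto simp: d'_def)
    define f where "f y = g y - g x - (y - x) * g' x - 1 / 2 * (y - x)\<^sup>2 * g'' x" for y
    define f' where "f' y = g' y - g' x - (y - x) * g'' x" for y
    let ?S = "{x - \<eta>..x + \<eta>}"
    have S: "?S \<subseteq> {0..1}"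
      using \<eta> by auto
    have df: "(f has_real_derivative f' y) (at y within ?S)" if "y \<in> ?S" for y
    proof -
      have "(g has_real_derivative g' y) (at y within ?S)"
        by (rule has_field_derivative_subset[OF g1 S]) (use S that in auto)
      then show ?thesis
        unfolding f_def f'_def by (auto intro!: derivative_eq_intros)
    qed
    have df': "(f' has_real_derivative g'' y - g'' x) (at y within ?S)" if "y \<in> ?S" for y
    proof -
      have "(g' has_real_derivative g'' y) (at y within ?S)"
        by (rule has_field_derivative_subset[OF g2 S]) (use S that in auto)
      then show ?thesis
        unfolding f'_def by (auto intro!: derivative_eq_intros)
    qed
    have f'_bound: "\<bar>f' y\<bar> \<le> e * \<eta>" if y: "y \<in> ?S" for y
    proof -
      have "norm (f' y - f' x) \<le> e * norm (y - x)"
      proof (rule field_differentiable_bound[of ?S f' "\<lambda>y. g'' y - g'' x", OF _ df'])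
        fix z assume z: "z \<in> ?S"
        have "dist (g'' z) (g'' x) < e"
          using z S \<eta> by (intro d(2)) (auto simp: dist_real_def)
        then show "norm (g'' z - g'' x) \<le> e"
          by (simp add: dist_real_def)
      qed (use y \<eta> in auto)
      also have "\<dots> \<le> e * \<eta>"
        using y e by (intro mult_left_mono) auto
      finally show ?thesis
        by (simp add: f'_def)
    qed
    have f_bound: "\<bar>f y\<bar> \<le> e * \<eta>\<^sup>2" if y: "y \<in> ?S" for y
    proof -
      have "norm (f y - f x) \<le> (e * \<eta>) * norm (y - x)"
        by (rule field_differentiable_bound[of ?S f f', OF _ df]) (use y \<eta> f'_bound in auto)
      also have "\<dots> \<le> (e * \<eta>) * \<eta>"
        using y e \<eta> by (intro mult_left_mono) auto
      finally show ?thesis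
        by (simp add: f_def power2_eq_square)
    qed
    have "((\<lambda>t. K t * g (x + \<eta> * t) - g x * K t - \<eta> * g' x * (t * K t) - 1 / 2 * \<eta>\<^sup>2 * g'' x * (t\<^sup>2 * K t)) has_integral
        (integral {0..1} (\<lambda>s. phi K x \<eta> s * g s) - g x * 1 - \<eta> * g' x * 0 -
         1 / 2 * \<eta>\<^sup>2 * g'' x * integral {-1..1} (\<lambda>t. t\<^sup>2 * K t))) {-1..1}"
      by (intro has_integral_diff has_integral_mult_right kernel_moments
          phi_integral_substitution[OF even \<eta>(1,3,4) g])
    then have "\<bar>integral {0..1} (\<lambda>s. phi K x \<eta> s * g s) - g x * 1 - \<eta> * g' x * 0 -
         1 / 2 * \<eta>\<^sup>2 * g'' x * integral {-1..1} (\<lambda>t. t\<^sup>2 * K t)\<bar> \<le> (K_sup K * (e * \<eta>\<^sup>2)) * (1 - - 1)"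
    proof (rule has_integral_abs_bound[where S = "{}"])
      fix t :: real assume t: "t \<in> {-1..1} - {}"
      have "K t * g (x + \<eta> * t) - g x * K t - \<eta> * g' x * (t * K t) - 1 / 2 * \<eta>\<^sup>2 * g'' x * (t\<^sup>2 * K t) =
          K t * f (x + \<eta> * t)"
        by (simp add: f_def algebra_simps power_mult_distrib)
      then have "\<bar>K t * g (x + \<eta> * t) - g x * K t - \<eta> * g' x * (t * K t) - 1 / 2 * \<eta>\<^sup>2 * g'' x * (t\<^sup>2 * K t)\<bar> =
          \<bar>K t\<bar> * \<bar>f (x + \<eta> * t)\<bar>"
        by (simp add: abs_mult)
      also have "\<dots> \<le> K_sup K * (e * \<eta>\<^sup>2)"
      proof (intro mult_mono K_sup_bound f_bound)
        have "\<bar>\<eta> * t\<bar> \<le> \<eta>"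
          using t \<eta> by (auto simp: abs_mult intro!: mult_left_le)
        then show "x + \<eta> * t \<in> ?S"
          by auto
      qed (use K_sup_pos in auto)
      finally show "\<bar>K t * g (x + \<eta> * t) - g x * K t - \<eta> * g' x * (t * K t) - 1 / 2 * \<eta>\<^sup>2 * g'' x * (t\<^sup>2 * K t)\<bar>
          \<le> K_sup K * (e * \<eta>\<^sup>2)" .
    qed (use e K_sup_pos in auto)
    also have "\<dots> = c * \<eta>\<^sup>2"
      using K_sup_pos by (simp add: e_def)
    finally show "norm (integral {0..1} (\<lambda>s. phi K x \<eta> s * g s) - g x -
      1 / 2 * \<eta>\<^sup>2 * g'' x * integral {-1..1} (\<lambda>t. t\<^sup>2 * K t)) \<le> c * norm (\<eta>\<^sup>2)"
      by simp
  qed (use d' in auto)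
qed

end

subsection \<open>The bias of the projection estimator\<close>

theorem proposition3:
  fixes P :: "'b measure" and X :: "real \<Rightarrow> 'b \<Rightarrow> real"
    and M :: "'a measure" and \<epsilon> :: "nat \<Rightarrow> real \<Rightarrow> 'a \<Rightarrow> real" and m :: nat
    and R :: "real \<Rightarrow> real \<Rightarrow> real"
    and H :: "(real \<Rightarrow> real) set" and ip :: "(real \<Rightarrow> real) \<Rightarrow> (real \<Rightarrow> real) \<Rightarrow> real"
    and K K' g g' g'' :: "real \<Rightarrow> real"
    and T :: "nat \<Rightarrow> nat \<Rightarrow> real" and h :: "nat \<Rightarrow> real" and x :: real
  assumes process: "centered_second_order_process P X R"
    and nonsingular: "nonsingular_kernel R"
    and errors: "m \<ge> 1" "iid_copies M m \<epsilon> P X"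
    and g_C1: "\<And>t. t \<in> {0..1} \<Longrightarrow> (g has_real_derivative g' t) (at t within {0..1})"
    and g_C2: "\<And>t. t \<in> {0..1} \<Longrightarrow> (g' has_real_derivative g'' t) (at t within {0..1})"
      "continuous_on {0..1} g''"
    and kernel: "C1_kernel K K'"
    and rkhs: "is_rkhs {0..1} R H ip"
    and A: "assumption_A R"
    and B: "assumption_B R"
    and C: "assumption_C R H ip"
    and D: "assumption_D K K'"
    and R11_finite: "bdd_above (abs_R11_values R)"
    and designs: "\<And>n. n \<ge> 1 \<Longrightarrow> design n (T n)"
    and bandwidth: "\<And>n. n \<ge> 1 \<Longrightarrow> 0 < h n \<and> h n < 1"
    and x: "0 < x" "x < 1"
    and design_near_x: "\<forall>\<^sub>F n in sequentially. T n ` {1..n} \<inter> {x - h n<..<x + h n} \<noteq> {}"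
    and nh: "\<forall>\<^sub>F n in sequentially. real n * h n \<ge> 1"
  shows "\<exists>r :: real \<Rightarrow> real. r \<in> o[at_right 0](\<lambda>\<eta>. \<eta>\<^sup>2) \<and>
    (\<lambda>n. (LINT \<omega>|M. g_pro g \<epsilon> m R K x (h n) n (T n) \<omega>) - g x
         - (1 / 2 * (h n)\<^sup>2 * g'' x * integral {-1..1} (\<lambda>t. t\<^sup>2 * K t) + r (h n)))
    \<in> O(\<lambda>n. real (N_design x (h n) n (T n)) / (h n) ^ 3 * (SUP j\<in>{0..n}. (gap n (T n) j) ^ 3)
            + real (N_design x (h n) n (T n)) * alpha_nh R K x (h n) n (T n)
            + real n * beta_nh ip R K x (h n) n (T n))"
proof -
  interpret cov: covariance R H ip
    by unfold_locales (fact rkhs A B C R11_finite nonsingular)+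
  have bounded: "\<exists>b. \<forall>t\<in>{0..1}. \<bar>f t\<bar> \<le> b" if "continuous_on {0..1} f" for f :: "real \<Rightarrow> real"
  proof -
    have "bounded (f ` {0..1})"
      using that by (intro compact_imp_bounded compact_continuous_image) auto
    then show ?thesis
      unfolding bounded_iff by (auto simp: image_iff)
  qed
  obtain G2 where G2: "\<And>t. t \<in> {0..1} \<Longrightarrow> \<bar>g'' t\<bar> \<le> G2"
    using bounded[OF g_C2(2)] by metis
  have "continuous_on {0..1} g'"
    using g_C2(1) by (rule DERIV_continuous_on)
  then obtain Lg where Lg: "\<And>t. t \<in> {0..1} \<Longrightarrow> \<bar>g' t\<bar> \<le> Lg"
    using bounded[of g'] by metis
  have "0 \<le> Lg"
    using Lg[of 0] by force
  then have lip: "Lg-lipschitz_on {0..1} g"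
    using field_differentiable_bound[of "{0..1}" g g' Lg] g_C1 Lg
    by (intro lipschitz_onI) (auto simp: dist_norm)
  obtain Bg where Bg: "0 \<le> Bg" "cov.eval_bounded Bg g"
    using cov.lipschitz_eval_bounded[OF lip] by blast
  obtain B0 where B0: "0 \<le> B0" "cov.eval_bounded B0 cov.edge0"
    using cov.eval_bounded_nonneg[OF cov.edge0_eval_bounded] by blast
  obtain B1 where B1: "0 \<le> B1" "cov.eval_bounded B1 cov.edge1"
    using cov.eval_bounded_nonneg[OF cov.edge1_eval_bounded] by blast
  \<comment> \<open>The remainder is a function of the bandwidth alone. With this choice
    \<open>\<Delta> n\<close> reduces, for every \<open>n \<ge> 1\<close>, to the integral of
    \<open>phi\<close> against the interpolation error, up to sign.\<close>
  define r where "r \<eta> = integral {0..1} (\<lambda>s. phi K x \<eta> s * g s) - g x -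
      1 / 2 * \<eta>\<^sup>2 * g'' x * integral {-1..1} (\<lambda>t. t\<^sup>2 * K t)" for \<eta>
  have r: "r \<in> o[at_right 0](\<lambda>\<eta>. \<eta>\<^sup>2)"
    unfolding r_def using smoothing_bias[OF kernel _ x g_C1 g_C2] D by (simp add: assumption_D_def)
  define \<Delta> where "\<Delta> n = (LINT \<omega>|M. g_pro g \<epsilon> m R K x (h n) n (T n) \<omega>) - g x
      - (1 / 2 * (h n)\<^sup>2 * g'' x * integral {-1..1} (\<lambda>t. t\<^sup>2 * K t) + r (h n))" for n
  define Q where "Q n = real (N_design x (h n) n (T n)) / (h n) ^ 3 * (SUP j\<in>{0..n}. (gap n (T n) j) ^ 3)
      + real (N_design x (h n) n (T n)) * alpha_nh R K x (h n) n (T n)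
      + real n * beta_nh ip R K x (h n) n (T n)" for n
  \<comment> \<open>\<open>CA\<close> and \<open>CB\<close> are the constants of
    \<open>error_le\<close> and \<open>flat_error_le\<close>, \<open>qA\<close> is that of
    \<open>n_beta_nh_ge\<close>. None of them depends on \<open>n\<close>.\<close>
  define CA where "CA = 2 * K_sup K * Lg + 2 * K_sup K * Bg * sqrt (R11_sup R + cov.M1)"
  define CB where "CB = K_sup K * (G2 + 2 * (Lg + (B0 + B1) * Bg))"
  define qA where "qA = cov.section_sup * sqrt ((K_sup K)\<^sup>2 * (4 / 3 * alpha_sup R)) / 2"
  have Kpos: "0 < K_sup K"
    by (rule K_sup_pos[OF kernel])
  have CA: "0 \<le> CA"
    using Kpos Bg \<open>0 \<le> Lg\<close> cov.R1_nonneg cov.M1_nonneg by (simp add: CA_def)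
  have CB: "0 \<le> CB"
    using Kpos Bg \<open>0 \<le> Lg\<close> B0 B1 G2[of 0] by (force simp: CB_def)
  \<comment> \<open>The alternative concerns \<open>R\<close> and its RKHS only, so the same case
    holds for all \<open>n\<close>.\<close>
  define flat where "flat \<longleftrightarrow> (\<forall>t\<in>{0..1}. ip_norm ip (R02_section R t) = 0)"
  \<comment> \<open>\<open>\<mu>\<close> is the largest gap of the design of size \<open>n\<close>.
    Each upper bound for \<open>\<Delta> n\<close> is paired with a lower bound for
    \<open>Q n\<close> of the same order in \<open>\<mu>\<close> and \<open>h n\<close>.\<close>
  have step: "\<exists>\<mu>. \<bar>\<Delta> n\<bar> \<le> CA * (\<mu> / sqrt (h n)) \<and> qA * (\<mu> / sqrt (h n)) \<le> Q n \<and>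
      (flat \<longrightarrow> \<bar>\<Delta> n\<bar> \<le> CB * (\<mu>\<^sup>2 / h n)) \<and> (1 - x) / 2 * (\<mu>\<^sup>2 / h n) \<le> Q n" if n: "n \<ge> 1" for n
  proof -
    have T01: "T n ` {1..n} \<subseteq> {0..1}"
      using designs[OF n] by (simp add: design_def)
    obtain c where c: "\<forall>t\<in>T n ` {1..n}. cov.ksum (T n ` {1..n}) c t = g t"
      using cov.gram_interpolation[OF _ T01, of g] by auto
    interpret ie: interpolation_error R H ip n "T n" K "K_sup K" x "h n" g g' g'' c Lg G2 Bg
    proof unfold_locales
      show "continuous_on UNIV K"
        by (rule C1_kernel_continuous[OF kernel])
      show "\<bar>K t\<bar> \<le> K_sup K" for t
        by (rule K_sup_bound[OF kernel])
      show "K t = 0" if "t \<notin> {-1..1}" for t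
        using C1_kernel_support[OF kernel that] .
      show "cov.ksum (T n ` {1..n}) c t = g t" if "t \<in> T n ` {1..n}" for t
        using c that by (rule bspec)
    qed (use n designs bandwidth[OF n] lip Bg g_C1 g_C2(1) G2 in auto)
    have "(LINT \<omega>|M. g_pro g \<epsilon> m R K x (h n) n (T n) \<omega>) = (\<Sum>i = 1..n. weight R K x (h n) n (T n) i * g (T n i))"
      by (rule expectation_g_pro[OF process errors(2,1) T01])
    then have "\<Delta> n = - integral {0..1} (\<lambda>t. phi K x (h n) t * (g t - ie.u t))"
      using ie.estimator_error by (simp add: \<Delta>_def r_def)
    then have abs: "\<bar>\<Delta> n\<bar> = \<bar>integral {0..1} (\<lambda>t. phi K x (h n) t * (g t - ie.u t))\<bar>"
      by simp
    note nonneg = ie.remainder_terms_nonneg[OF x]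
    have "\<bar>\<Delta> n\<bar> \<le> CA * (ie.mesh / sqrt (h n))"
      unfolding abs CA_def by (rule ie.error_le)
    moreover have "qA * (ie.mesh / sqrt (h n)) \<le> Q n"
      using ie.n_beta_nh_ge nonneg unfolding Q_def qA_def by linarith
    moreover have "\<bar>\<Delta> n\<bar> \<le> CB * (ie.mesh\<^sup>2 / h n)" if flat
    proof -
      have "pd2 (pd2 R) s t = 0" if "s \<in> {0..1}" "t \<in> {0..1}" "s \<noteq> t" for s t
        using cov.flat_if_sections_zero[OF _ that] \<open>flat\<close> unfolding flat_def by blast
      from ie.flat_error_le[OF this B0(2,1) B1(2,1)] show ?thesis
        unfolding abs CB_def .
    qed
    moreover have "(1 - x) / 2 * (ie.mesh\<^sup>2 / h n) \<le> Q n"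
      using ie.cubic_term_ge[OF x] nonneg unfolding Q_def by linarith
    ultimately show ?thesis
      by (intro exI[of _ ie.mesh]) blast
  qed
  have "\<exists>C. \<forall>n\<ge>1. \<bar>\<Delta> n\<bar> \<le> C * \<bar>Q n\<bar>"
  proof (cases flat)
    case True
    have "\<bar>\<Delta> n\<bar> \<le> CB * (2 / (1 - x)) * \<bar>Q n\<bar>" if n: "n \<ge> 1" for n
    proof -
      obtain \<mu> where \<mu>: "\<bar>\<Delta> n\<bar> \<le> CB * (\<mu>\<^sup>2 / h n)" "(1 - x) / 2 * (\<mu>\<^sup>2 / h n) \<le> Q n"
        using step[OF n] True by blast
      note \<mu>(1)
      also have "CB * (\<mu>\<^sup>2 / h n) = CB * (2 / (1 - x)) * ((1 - x) / 2 * (\<mu>\<^sup>2 / h n))"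
        using x by simp
      also have "\<dots> \<le> CB * (2 / (1 - x)) * \<bar>Q n\<bar>"
        using \<mu>(2) CB x by (intro mult_left_mono) auto
      finally show ?thesis .
    qed
    then show ?thesis by blast
  next
    case False
    then obtain t where t: "t \<in> {0..1}" "ip_norm ip (R02_section R t) \<noteq> 0"
      by (auto simp: flat_def)
    \<comment> \<open>One nonzero section makes \<open>section_sup\<close>, and with it
      \<open>qA\<close>, positive, so that the two bounds of order \<open>\<mu> / sqrt (h n)\<close>
      can be compared.\<close>
    then have "0 < 1 / alpha R t * ip_norm ip (R02_section R t)"
      using cov.alpha_pos[OF t(1)] cov.hnorm_nonneg[OF cov.section_mem[OF t(1)]] by simp
    then have "0 < cov.section_sup"
      using cov.section_sup_ge[OF t(1)] by linarith
    then have qA: "0 < qA"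
      using Kpos cov.alpha_sup_pos by (simp add: qA_def)
    have "\<bar>\<Delta> n\<bar> \<le> CA / qA * \<bar>Q n\<bar>" if n: "n \<ge> 1" for n
    proof -
      obtain \<mu> where \<mu>: "\<bar>\<Delta> n\<bar> \<le> CA * (\<mu> / sqrt (h n))" "qA * (\<mu> / sqrt (h n)) \<le> Q n"
        using step[OF n] by blast
      note \<mu>(1)
      also have "CA * (\<mu> / sqrt (h n)) = CA / qA * (qA * (\<mu> / sqrt (h n)))"
        using qA by simp
      also have "\<dots> \<le> CA / qA * \<bar>Q n\<bar>"
        using \<mu>(2) CA qA by (intro mult_left_mono) auto
      finally show ?thesis .
    qed
    then show ?thesis by blast
  qed
  then obtain C where "\<And>n. n \<ge> 1 \<Longrightarrow> \<bar>\<Delta> n\<bar> \<le> C * \<bar>Q n\<bar>"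
    by blast
  then have "\<Delta> \<in> O(Q)"
    by (intro bigoI[of _ C] eventually_sequentiallyI[of 1]) auto
  then show ?thesis
    using r unfolding \<Delta>_def Q_def by blast
qed

end
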